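(* There is a polynomial-time algorithm that, given an $n$-vertex, $m$-edge colored weighted graph $G$ and integers $k,f\ge1$, outputs an $f$-CFT $(2k-1)$-spanner of $G$ with $s$ edges, where: 1. $s=O(kfn^{1+1/k})$ in the ECFT setting; 2. $s=O(kf^{1-1/k}n^{1+1/k})$ in the VCFT setting; 3. $s=O(k^2f^{2-1/k}n^{1+1/k})$ in the MCFT setting. The running time is $O(mf\cdot s)$.
   Context: $G$ is a finite undirected graph with positive edge weights; distances are weighted shortest-path distances. A subgraph $H$ is a $t$-spanner of $G$ if $\operatorname{dist}_H(u,v)\le t\,\operatorname{dist}_G(u,v)$ for all $u,v$. Colors are arbitrary (no legality restrictions). The three settings are as follows: in ECFT, each edge is colored; in VCFT, each vertex is colored; in MCFT, both edges and vertices are colored, and a color may appear on both. For a set $F$ of colors, $G-F$ deletes every edge $e=\{u,v\}$ such that the color of $e$ (ECFT), the color of $u$ or of $v$ (VCFT), or the color of any of $e,u,v$ (MCFT) lies in $F$. An $f$-CFT $t$-spanner of $G$ is a subgraph $H$ (inheriting colors) such that for every set $F$ of at most $f$ colors, $H-F$ is a $t$-spanner of $G-F$. *)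

theory Defs
  imports Complex_Main "HOL-Library.Extended_Real" "HOL-Library.Log_Nat"
begin

section \<open>Colored weighted graphs and color fault-tolerant spanners\<close>

datatype ('v, 'c) coloring =
    ECFT (edge_col: "'v set \<Rightarrow> 'c")
  | VCFT (vertex_col: "'v \<Rightarrow> 'c")
  | MCFT (edge_col: "'v set \<Rightarrow> 'c") (vertex_col: "'v \<Rightarrow> 'c")

text \<open>The colors whose failure destroys an edge.\<close>

fun edge_colors :: "('v, 'c) coloring \<Rightarrow> 'v set \<Rightarrow> 'c set" where
  "edge_colors (ECFT ce) e = {ce e}"
| "edge_colors (VCFT cv) e = cv ` e"
| "edge_colors (MCFT ce cv) e = insert (ce e) (cv ` e)"

text \<open>The values of \<open>weight\<close> and \<open>coloring\<close> outside \<open>edges\<close> and \<open>verts\<close> are irrelevant.\<close>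

record ('v, 'c) cgraph =
  verts :: "'v set"
  edges :: "'v set set"
  weight :: "'v set \<Rightarrow> real"
  coloring :: "('v, 'c) coloring"

definition wf_cgraph :: "('v, 'c) cgraph \<Rightarrow> bool" where
  "wf_cgraph G \<longleftrightarrow> finite (verts G) \<and>
     (\<forall>e \<in> edges G. \<exists>u \<in> verts G. \<exists>v \<in> verts G. u \<noteq> v \<and> e = {u, v}) \<and>
     (\<forall>e \<in> edges G. 0 < weight G e)"

fun walk :: "('v, 'c) cgraph \<Rightarrow> 'v list \<Rightarrow> bool" where
  "walk G [] \<longleftrightarrow> False"
| "walk G [u] \<longleftrightarrow> u \<in> verts G"
| "walk G (u # v # p) \<longleftrightarrow> u \<in> verts G \<and> {u, v} \<in> edges G \<and> walk G (v # p)"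

fun walk_length :: "('v, 'c) cgraph \<Rightarrow> 'v list \<Rightarrow> real" where
  "walk_length G (u # v # p) = weight G {u, v} + walk_length G (v # p)"
| "walk_length G _ = 0"

text \<open>Vertices in different components have distance \<open>\<infinity>\<close>, the infimum of the empty set.\<close>

definition gdist :: "('v, 'c) cgraph \<Rightarrow> 'v \<Rightarrow> 'v \<Rightarrow> ereal" where
  "gdist G u v = (INF p \<in> {p. walk G p \<and> hd p = u \<and> last p = v}. ereal (walk_length G p))"

definition subgraph :: "('v, 'c) cgraph \<Rightarrow> ('v, 'c) cgraph \<Rightarrow> bool" where
  "subgraph H G \<longleftrightarrow> verts H \<subseteq> verts G \<and> edges H \<subseteq> edges G \<and> \<Union> (edges H) \<subseteq> verts H \<and>
     weight H = weight G \<and> coloring H = coloring G"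

definition spanner :: "real \<Rightarrow> ('v, 'c) cgraph \<Rightarrow> ('v, 'c) cgraph \<Rightarrow> bool" where
  "spanner t H G \<longleftrightarrow> subgraph H G \<and>
     (\<forall>u \<in> verts G. \<forall>v \<in> verts G. gdist H u v \<le> ereal t * gdist G u v)"

definition delete_colors :: "('v, 'c) cgraph \<Rightarrow> 'c set \<Rightarrow> ('v, 'c) cgraph" where
  "delete_colors G F = G\<lparr>edges := {e \<in> edges G. edge_colors (coloring G) e \<inter> F = {}}\<rparr>"

definition cft_spanner :: "nat \<Rightarrow> real \<Rightarrow> ('v, 'c) cgraph \<Rightarrow> ('v, 'c) cgraph \<Rightarrow> bool" where
  "cft_spanner f t H G \<longleftrightarrow> subgraph H G \<and>
     (\<forall>F. finite F \<and> card F \<le> f \<longrightarrow> spanner t (delete_colors H F) (delete_colors G F))"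


section \<open>Algorithms\<close>

text \<open>
  Algorithms are programs of a random access machine with natural-number registers, named
  natural-number arrays and named arrays of real numbers (for the edge weights).
  Every evaluated operator, constant, memory access and command costs one unit.
  There is no multiplication, and the only real constants are natural numbers. Hence in \<open>T\<close>
  steps bit lengths grow by only \<open>O(T)\<close>, and neither long integers nor real constants can be
  used to hide work or advice. Reals influence the control flow only through comparisons.
\<close>

record state =
  reg :: "string \<Rightarrow> nat"
  arr :: "string \<Rightarrow> nat \<Rightarrow> nat"
  rarr :: "string \<Rightarrow> nat \<Rightarrow> real"

datatype aexp =
    Num nat
  | Reg string
  | Arr string aexp
  | Plus aexp aexp
  | Minus aexp aexp

datatype rexp =
    RNum nat
  | RArr string aexp
  | RPlus rexp rexp
  | RMinus rexp rexp

datatype bexp =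
    Less aexp aexp
  | RLess rexp rexp
  | Neg bexp
  | Conj bexp bexp

datatype com =
    Skip
  | Assign string aexp
  | Store string aexp aexp
  | RStore string aexp rexp
  | Seq com com
  | If bexp com com
  | While bexp com

text \<open>Subtraction of natural numbers is truncated at 0.\<close>

fun aval :: "aexp \<Rightarrow> state \<Rightarrow> nat" where
  "aval (Num i) \<sigma> = i"
| "aval (Reg x) \<sigma> = reg \<sigma> x"
| "aval (Arr x a) \<sigma> = arr \<sigma> x (aval a \<sigma>)"
| "aval (Plus a b) \<sigma> = aval a \<sigma> + aval b \<sigma>"
| "aval (Minus a b) \<sigma> = aval a \<sigma> - aval b \<sigma>"

fun rval :: "rexp \<Rightarrow> state \<Rightarrow> real" where
  "rval (RNum i) \<sigma> = real i"
| "rval (RArr x a) \<sigma> = rarr \<sigma> x (aval a \<sigma>)"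
| "rval (RPlus a b) \<sigma> = rval a \<sigma> + rval b \<sigma>"
| "rval (RMinus a b) \<sigma> = rval a \<sigma> - rval b \<sigma>"

fun bval :: "bexp \<Rightarrow> state \<Rightarrow> bool" where
  "bval (Less a b) \<sigma> \<longleftrightarrow> aval a \<sigma> < aval b \<sigma>"
| "bval (RLess a b) \<sigma> \<longleftrightarrow> rval a \<sigma> < rval b \<sigma>"
| "bval (Neg b) \<sigma> \<longleftrightarrow> \<not> bval b \<sigma>"
| "bval (Conj b c) \<sigma> \<longleftrightarrow> bval b \<sigma> \<and> bval c \<sigma>"

fun acost :: "aexp \<Rightarrow> nat" where
  "acost (Num i) = 1"
| "acost (Reg x) = 1"
| "acost (Arr x a) = 1 + acost a"
| "acost (Plus a b) = 1 + acost a + acost b"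
| "acost (Minus a b) = 1 + acost a + acost b"

fun rcost :: "rexp \<Rightarrow> nat" where
  "rcost (RNum i) = 1"
| "rcost (RArr x a) = 1 + acost a"
| "rcost (RPlus a b) = 1 + rcost a + rcost b"
| "rcost (RMinus a b) = 1 + rcost a + rcost b"

fun bcost :: "bexp \<Rightarrow> nat" where
  "bcost (Less a b) = 1 + acost a + acost b"
| "bcost (RLess a b) = 1 + rcost a + rcost b"
| "bcost (Neg b) = 1 + bcost b"
| "bcost (Conj b c) = 1 + bcost b + bcost c"

text \<open>\<open>runs P \<sigma> T \<sigma>'\<close>: started in \<open>\<sigma>\<close>, the program \<open>P\<close> halts after \<open>T\<close> steps in \<open>\<sigma>'\<close>.\<close>

inductive runs :: "com \<Rightarrow> state \<Rightarrow> nat \<Rightarrow> state \<Rightarrow> bool" where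
  runs_Skip: "runs Skip \<sigma> 1 \<sigma>"
| runs_Assign: "runs (Assign x a) \<sigma> (1 + acost a) (\<sigma>\<lparr>reg := (reg \<sigma>)(x := aval a \<sigma>)\<rparr>)"
| runs_Store: "runs (Store x i a) \<sigma> (1 + acost i + acost a)
    (\<sigma>\<lparr>arr := (arr \<sigma>)(x := (arr \<sigma> x)(aval i \<sigma> := aval a \<sigma>))\<rparr>)"
| runs_RStore: "runs (RStore x i r) \<sigma> (1 + acost i + rcost r)
    (\<sigma>\<lparr>rarr := (rarr \<sigma>)(x := (rarr \<sigma> x)(aval i \<sigma> := rval r \<sigma>))\<rparr>)"
| runs_Seq: "runs P \<sigma> T \<sigma>' \<Longrightarrow> runs Q \<sigma>' U \<sigma>'' \<Longrightarrow> runs (Seq P Q) \<sigma> (T + U) \<sigma>''"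
| runs_IfTrue: "bval b \<sigma> \<Longrightarrow> runs P \<sigma> T \<sigma>' \<Longrightarrow> runs (If b P Q) \<sigma> (1 + bcost b + T) \<sigma>'"
| runs_IfFalse: "\<not> bval b \<sigma> \<Longrightarrow> runs Q \<sigma> T \<sigma>' \<Longrightarrow> runs (If b P Q) \<sigma> (1 + bcost b + T) \<sigma>'"
| runs_WhileFalse: "\<not> bval b \<sigma> \<Longrightarrow> runs (While b P) \<sigma> (1 + bcost b) \<sigma>"
| runs_WhileTrue: "bval b \<sigma> \<Longrightarrow> runs P \<sigma> T \<sigma>' \<Longrightarrow> runs (While b P) \<sigma>' U \<sigma>'' \<Longrightarrow>
    runs (While b P) \<sigma> (1 + bcost b + T + U) \<sigma>''"

inductive_cases runs_SkipE: "runs Skip \<sigma> T \<sigma>'"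
inductive_cases runs_AssignE: "runs (Assign x a) \<sigma> T \<sigma>'"
inductive_cases runs_StoreE: "runs (Store x i a) \<sigma> T \<sigma>'"
inductive_cases runs_RStoreE: "runs (RStore x i r) \<sigma> T \<sigma>'"
inductive_cases runs_SeqE: "runs (Seq P Q) \<sigma> T \<sigma>'"
inductive_cases runs_IfE: "runs (If b P Q) \<sigma> T \<sigma>'"
inductive_cases runs_WhileE: "runs (While b P) \<sigma> T \<sigma>'"

lemma runs_deterministic:
  "runs P \<sigma> T \<sigma>' \<Longrightarrow> runs P \<sigma> U \<sigma>'' \<Longrightarrow> U = T \<and> \<sigma>'' = \<sigma>'"
proof (induction arbitrary: U \<sigma>'' rule: runs.induct)
  case (runs_Seq P \<sigma> T \<sigma>' Q U' \<tau>)
  from runs_Seq.prems show ?case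
    by (rule runs_SeqE) (auto dest!: runs_Seq.IH)
next
  case (runs_IfTrue b \<sigma> P T \<sigma>' Q)
  from runs_IfTrue.prems show ?case
    by (rule runs_IfE) (auto dest!: runs_IfTrue.IH simp: runs_IfTrue.hyps(1))
next
  case (runs_IfFalse b \<sigma> Q T \<sigma>' P)
  from runs_IfFalse.prems show ?case
    by (rule runs_IfE) (auto dest!: runs_IfFalse.IH simp: runs_IfFalse.hyps(1))
next
  case (runs_WhileFalse b \<sigma> P)
  from runs_WhileFalse.prems show ?case
    by (rule runs_WhileE) (auto simp: runs_WhileFalse.hyps(1))
next
  case (runs_WhileTrue b \<sigma> P T \<sigma>' U' \<tau>)
  from runs_WhileTrue.prems show ?case
    by (rule runs_WhileE) (auto dest!: runs_WhileTrue.IH simp: runs_WhileTrue.hyps(1))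
qed (erule runs_SkipE runs_AssignE runs_StoreE runs_RStoreE, simp)+


section \<open>Input and output of a spanner algorithm\<close>

text \<open>
  An input graph has vertices \<open>0, \<dots>, n - 1\<close> and natural numbers as colors. Its edges are presented
  in an arbitrary order and with arbitrary orientation. The colors loaded are exactly those that
  the setting has, and memory not used for the input is initially 0.
\<close>

definition edge_of :: "nat \<times> nat \<Rightarrow> nat set" where
  "edge_of p = {fst p, snd p}"

definition presents :: "nat \<Rightarrow> (nat \<times> nat) list \<Rightarrow> (nat, nat) cgraph \<Rightarrow> bool" where
  "presents n es G \<longleftrightarrow>
     verts G = {..<n} \<and> distinct (map edge_of es) \<and> set (map edge_of es) = edges G"

fun setting_code :: "('v, 'c) coloring \<Rightarrow> nat" where
  "setting_code (ECFT ce) = 0"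
| "setting_code (VCFT cv) = 1"
| "setting_code (MCFT ce cv) = 2"

fun ecol_input :: "(nat, nat) coloring \<Rightarrow> nat set \<Rightarrow> nat" where
  "ecol_input (ECFT ce) e = ce e"
| "ecol_input (VCFT cv) e = 0"
| "ecol_input (MCFT ce cv) e = ce e"

fun vcol_input :: "(nat, nat) coloring \<Rightarrow> nat \<Rightarrow> nat" where
  "vcol_input (ECFT ce) v = 0"
| "vcol_input (VCFT cv) v = cv v"
| "vcol_input (MCFT ce cv) v = cv v"

definition input_state ::
  "nat \<Rightarrow> (nat \<times> nat) list \<Rightarrow> (nat, nat) cgraph \<Rightarrow> nat \<Rightarrow> nat \<Rightarrow> state" where
  "input_state n es G k f = \<lparr>
     reg = (\<lambda>_. 0)(''n'' := n, ''m'' := length es, ''k'' := k, ''f'' := f,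
       ''setting'' := setting_code (coloring G)),
     arr = (\<lambda>_ _. 0)(
       ''u'' := (\<lambda>i. if i < length es then fst (es ! i) else 0),
       ''v'' := (\<lambda>i. if i < length es then snd (es ! i) else 0),
       ''ecol'' := (\<lambda>i. if i < length es then ecol_input (coloring G) (edge_of (es ! i)) else 0),
       ''vcol'' := (\<lambda>v. if v < n then vcol_input (coloring G) v else 0)),
     rarr = (\<lambda>_ _. 0)(
       ''w'' := (\<lambda>i. if i < length es then weight G (edge_of (es ! i)) else 0)) \<rparr>"

text \<open>
  The output is a duplicate-free list of positions in the input edge list: its length is in the
  register \<open>s\<close>, its entries are in the array \<open>out\<close>.
\<close>

definition output_list :: "state \<Rightarrow> nat list" where
  "output_list \<sigma> = map (arr \<sigma> ''out'') [0..<reg \<sigma> ''s'']"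

definition outputs :: "state \<Rightarrow> (nat \<times> nat) list \<Rightarrow> (nat, nat) cgraph \<Rightarrow> (nat, nat) cgraph \<Rightarrow> bool"
  where
  "outputs \<sigma> es G H \<longleftrightarrow>
     distinct (output_list \<sigma>) \<and> set (output_list \<sigma>) \<subseteq> {..<length es} \<and>
     H = G\<lparr>edges := (\<lambda>i. edge_of (es ! i)) ` set (output_list \<sigma>)\<rparr>"

fun size_bound :: "('v, 'c) coloring \<Rightarrow> real \<Rightarrow> real \<Rightarrow> real \<Rightarrow> real" where
  "size_bound (ECFT ce) k f n = k * f * n powr (1 + 1 / k)"
| "size_bound (VCFT cv) k f n = k * f powr (1 - 1 / k) * n powr (1 + 1 / k)"
| "size_bound (MCFT ce cv) k f n = k ^ 2 * f powr (2 - 1 / k) * n powr (1 + 1 / k)"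

text \<open>
  Input length for the polynomial bound. The numbers \<open>k\<close> and \<open>f\<close> count with their bit length, and
  every vertex and edge, together with its weight and colors, counts as 1. Counting the bits of
  colors as well would only make the size larger.
\<close>

definition input_size :: "nat \<Rightarrow> nat \<Rightarrow> nat \<Rightarrow> nat \<Rightarrow> nat" where
  "input_size n m k f = n + m + floorlog 2 k + floorlog 2 f"

end

theory Submission imports Defs
begin

text \<open>
  Edges \<open>e = {u, v}\<close> are taken by increasing weight. In the current spanner, paths from \<open>u\<close> to \<open>v\<close> with at most
  \<open>2k - 1\<close> edges are searched repeatedly, and after each success all colors of the path that \<open>e\<close> does not have are
  deleted. If \<open>f + 1\<close> paths are found, or a path has only colors of \<open>e\<close>, then every set of \<open>f\<close> faults that spares
  \<open>e\<close> spares one of the paths, and \<open>e\<close> is skipped. Otherwise at most \<open>6kf\<close> deleted colors separate \<open>u\<close> from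
  \<open>v\<close>, and \<open>e\<close> is added.

  Put \<open>K = 6kf\<close>. In a cycle of the output with at most \<open>2k\<close> edges, the last edge \<open>e\<close> has deleted a color of
  another edge of the cycle. Keep every color with probability \<open>p = 1/(2K)\<close>, and keep \<open>e\<close> if its own colors are
  kept and the at most \<open>K\<close> colors deleted for it are not. No cycle of length at most \<open>2k\<close> survives. Edges inside
  one vertex color class are therefore counted by the Moore bound. For the other edges the number of surviving
  vertices need not be concentrated, since color classes can be large; a refined Moore bound in terms of
  the number of vertices and the number of pairs of vertices of different colors, with expectations \<open>p n\<close> and at
  most \<open>(p n)\<^sup>2\<close>, yields \<open>O(K\<^bsup>q - 1 - 1/k\<^esup> n\<^bsup>1 + 1/k\<^esup>)\<close> if an edge has at most \<open>q\<close> colors.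

  A path is found by breadth-first search in time \<open>O(s)\<close>. The output covers every vertex of positive degree,
  so \<open>m \<le> 4 s\<^sup>2\<close>, and time \<open>O(\<surd>m)\<close> for the selection of the next edge is affordable.
\<close>

section \<open>Walks of bounded length\<close>

text \<open>A path has at most 2k - 1 edges with at most three colors each, and an accepted edge has
  seen at most f paths: hence 6kf. Colors of \<open>e\<close> are spared so that keeping them and
  avoiding the colors deleted for \<open>e\<close> are independent events.

  The obstacle is that a color class lives or dies as a whole. If all vertices share one color, all
  survive with probability p, and the expected (1 + 1/k)-th power of the number of survivors exceeds
  the power of the expectation by a factor p^(-1/k). So the power is fixed in advance as
  \<open>L powr (1 / k)\<close> with L = p n, times a bound that is linear in the vertices and in
  the bichromatic pairs divided by L. Dividing by the survival probability of order p^q gives the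
  exponent q - 1 - 1/k, with q = 2 for VCFT and q = 3 for MCFT. Inside a class its own color costs
  nothing, since edges having a color never delete it; in ECFT all vertices form one such class.

  The polynomial time bound counts only the bit length of f, so the searches per edge must also be
  bounded by s: every path that leads to deletions kills an edge of the current spanner.\<close>

fun reach :: "'v set set \<Rightarrow> nat \<Rightarrow> 'v \<Rightarrow> 'v \<Rightarrow> bool" where
  "reach E 0 x y \<longleftrightarrow> x = y"
| "reach E (Suc l) x y \<longleftrightarrow> x = y \<or> (\<exists>z. {x, z} \<in> E \<and> reach E l z y)"

lemma reach_refl [simp]: "reach E l x x"
  by (cases l) auto

lemma reach_mono: "reach E l x y \<Longrightarrow> E \<subseteq> E' \<Longrightarrow> l \<le> l' \<Longrightarrow> reach E' l' x y"
proof (induction E l x y arbitrary: l' rule: reach.induct)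
  case (2 E l x y)
  then obtain l'' where l': "l' = Suc l''" "l \<le> l''" by (cases l') auto
  show ?case using 2 unfolding l' by auto
qed auto

lemma reach_trans: "reach E l x y \<Longrightarrow> reach E l' y z \<Longrightarrow> reach E (l + l') x z"
proof (induction E l x y rule: reach.induct)
  case (2 E l x y)
  show ?case
  proof (cases "x = y")
    case True then show ?thesis using 2(3) reach_mono[of E l' x z E "Suc l + l'"] by auto
  next
    case False then show ?thesis using 2 by auto
  qed
qed auto

lemma reach_edge: "{x, y} \<in> E \<Longrightarrow> reach E (Suc l) x y"
  by (simp, rule disjI2, rule exI[of _ y]) auto

lemma reach_sym: "reach E l x y \<Longrightarrow> reach E l y x"
proof (induction E l x y rule: reach.induct)
  case (2 E l x y)
  show ?case
  proof (cases "x = y")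
    case False
    then obtain z where z: "{x, z} \<in> E" "reach E l z y" using 2 by auto
    then have "reach E l y z" using 2 by auto
    moreover have "reach E 1 z x" using z(1) reach_edge[of z x E 0] by (simp add: insert_commute)
    ultimately show ?thesis using reach_trans[of E l y z 1 x] by simp
  qed auto
qed auto

abbreviation vpath :: "'v set set \<Rightarrow> 'v list \<Rightarrow> bool" where
  "vpath E \<equiv> successively (\<lambda>a b. {a, b} \<in> E)"

lemma vpath_reach: "vpath E p \<Longrightarrow> p \<noteq> [] \<Longrightarrow> length p \<le> Suc l \<Longrightarrow> reach E l (hd p) (last p)"
proof (induction p arbitrary: l rule: induct_list012)
  case (3 a b p)
  then obtain l' where "l = Suc l'" by (cases l) auto
  then show ?case using 3 by auto
qed auto

lemma reach_distinct_vpath: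
  "reach E l x y \<Longrightarrow> \<exists>p. vpath E p \<and> distinct p \<and> p \<noteq> [] \<and> hd p = x \<and> last p = y \<and> length p \<le> Suc l"
proof (induction E l x y rule: reach.induct)
  case (1 E x y)
  then show ?case by (intro exI[of _ "[x]"]) auto
next
  case (2 E l x y)
  show ?case
  proof (cases "x = y")
    case True then show ?thesis by (intro exI[of _ "[x]"]) auto
  next
    case False
    then obtain z where z: "{x, z} \<in> E" "reach E l z y" using 2 by auto
    then obtain p where p: "vpath E p" "distinct p" "p \<noteq> []" "hd p = z" "last p = y" "length p \<le> Suc l"
      using 2 by blast
    show ?thesis
    proof (cases "x \<in> set p")
      case True
      then obtain p1 p2 where p12: "p = p1 @ x # p2" by (meson split_list)
      show ?thesis
        by (rule exI[of _ "x # p2"]) (use p p12 in \<open>auto simp: successively_append_iff\<close>)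
    next
      case False
      show ?thesis
        by (rule exI[of _ "x # p"]) (use p z False in \<open>auto simp: successively_Cons\<close>)
    qed
  qed
qed

text \<open>The premise exposes where on the path a pair of neighbors sits; this allows a particular
  edge to be excluded by distinctness of the vertices around it.\<close>

lemma vpath_cong_sub:
  assumes "vpath E p" "\<And>p1 a b p2. p = p1 @ a # b # p2 \<Longrightarrow> {a, b} \<in> E \<Longrightarrow> {a, b} \<in> E'"
  shows "vpath E' p"
  using assms
proof (induction p rule: induct_list012)
  case (3 a b p)
  have "vpath E' (b # p)"
  proof (rule 3(2))
    show "vpath E (b # p)" using 3 by simp
    fix p1 x y p2 assume "b # p = p1 @ x # y # p2" "{x, y} \<in> E"
    then show "{x, y} \<in> E'" using 3(4)[of "a # p1" x y p2] by simp
  qed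
  then show ?case using 3(3) 3(4)[of "[]" a b p] by simp
qed auto

text \<open>
  If each edge is not bypassed by a short walk of lower rank, then it is not bypassed by any short walk: the edge of
  highest rank on a shortest cycle would be bypassed by the rest of the cycle.
\<close>

lemma no_short_detour:
  assumes rk: "inj_on r J"
    and ac: "\<And>u v. {u, v} \<in> J \<Longrightarrow> \<not> reach {e \<in> J. r e < (r {u, v} :: nat)} g u v"
    and e: "{u, v} \<in> J"
  shows "\<not> reach (J - {{u, v}}) g u v"
proof
  assume "reach (J - {{u, v}}) g u v"
  from reach_distinct_vpath[OF this] obtain p where p: "vpath (J - {{u,
      v}}) p" "distinct p" "p \<noteq> []" "hd p = u" "last p = v"
    "length p \<le> Suc g" by auto
  define Z where "Z = {{a, b} | a b p1 p2. p = p1 @ a # b # p2}"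
  have fZ: "finite Z"
  proof (rule finite_subset)
    show "Z \<subseteq> Pow (set p)" unfolding Z_def by auto
  qed auto
  have ZJ: "Z \<subseteq> J - {{u, v}}" using p(1) unfolding Z_def by (auto simp: successively_append_iff)
  \<comment> \<open>\<open>M\<close> is the edge of highest rank on the cycle formed by the detour
    \<open>p\<close> and the edge \<open>{u, v}\<close>; by injectivity all other ranks on the cycle
    are strictly smaller.\<close>
  have "Max (r ` insert {u, v} Z) \<in> r ` insert {u, v} Z" using fZ by (intro Max_in) auto
  then obtain M where M1: "M \<in> insert {u, v} Z" and rM: "r M = Max (r ` insert {u, v} Z)"
    by (metis imageE)
  have "r e \<le> r M" if "e \<in> insert {u, v} Z" for e
    unfolding rM by (intro Max_ge finite_imageI imageI that) (simp add: fZ)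
  note M = M1 this
  have MJ: "M \<in> J" using M ZJ e by auto
  have lt: "r e' < r M" if "e' \<in> insert {u, v} Z" "e' \<noteq> M" for e'
  proof -
    have "e' \<in> J" using that ZJ e by auto
    then have "r e' \<noteq> r M" using rk MJ that by (meson inj_onD)
    then show ?thesis using M(2)[OF that(1)] by simp
  qed
  let ?J = "{e \<in> J. r e < r M}"
  show False
  proof (cases "M = {u, v}")
    case True
    have "vpath ?J p"
    proof (rule vpath_cong_sub[OF p(1)])
      fix p1 a b p2 assume "p = p1 @ a # b # p2" and ab: "{a, b} \<in> J - {{u, v}}"
      then have "{a, b} \<in> Z" unfolding Z_def by auto
      then show "{a, b} \<in> ?J" using lt[of "{a, b}"] ab True by auto
    qed
    then have "reach ?J g u v" using vpath_reach[of ?J p g] p by auto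
    then show False using ac e True by auto
  next
    case False
    then obtain a b p1 p2 where Mab: "M = {a, b}" and pp: "p = p1 @ a # b # p2"
      using M(1) unfolding Z_def by auto
    have v1: "vpath ?J (p1 @ [a])"
    proof (rule vpath_cong_sub[of "J - {{u, v}}"])
      show "vpath (J - {{u, v}}) (p1 @ [a])" using p(1) pp by (auto simp: successively_append_iff)
      fix q1 x y q2 assume q: "p1 @ [a] = q1 @ x # y # q2" and xy: "{x, y} \<in> J - {{u, v}}"
      have "p = q1 @ x # y # q2 @ b # p2" using q pp by (metis append.assoc append_Cons append_Nil)
      then have "{x, y} \<in> Z" unfolding Z_def by blast
      \<comment> \<open>A vertex occurs only once on \<open>p\<close>, so no edge of the prefix ends
        in \<open>b\<close>, and none of them is \<open>M\<close>.\<close>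
      moreover have "b \<notin> set (p1 @ [a])" using p(2) pp by auto
      then have "b \<notin> set (q1 @ x # y # q2)" using q by metis
      then have "{x, y} \<noteq> M" using Mab by auto
      ultimately show "{x, y} \<in> ?J" using lt[of "{x, y}"] xy by auto
    qed
    have v2: "vpath ?J (b # p2)"
    proof (rule vpath_cong_sub[of "J - {{u, v}}"])
      show "vpath (J - {{u, v}}) (b # p2)" using p(1) pp by (auto simp: successively_append_iff)
      fix q1 x y q2 assume q: "b # p2 = q1 @ x # y # q2" and xy: "{x, y} \<in> J - {{u, v}}"
      have "p = (p1 @ a # q1) @ x # y # q2" using q pp by simp
      then have "{x, y} \<in> Z" unfolding Z_def by blast
      moreover have "a \<notin> set (b # p2)" using p(2) pp by auto
      then have "a \<noteq> x" "a \<noteq> y" using q by auto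
      then have "{x, y} \<noteq> M" using Mab by auto
      ultimately show "{x, y} \<in> ?J" using lt[of "{x, y}"] xy by auto
    qed
    have "reach ?J (length p1) (hd (p1 @ [a])) a" using vpath_reach[OF v1, of "length p1"] by auto
    moreover have "hd (p1 @ [a]) = u" using p(4) pp by (cases p1) auto
    ultimately have w1: "reach ?J (length p1) a u" using reach_sym by metis
    have "reach ?J (length p2) b v" using vpath_reach[OF v2, of "length p2"] p(5) pp by auto
    then have w2: "reach ?J (length p2) v b" using reach_sym by metis
    \<comment> \<open>The rest of the cycle bypasses \<open>M\<close>: from \<open>a\<close> back to
      \<open>u\<close>, across \<open>{u, v}\<close>, from \<open>v\<close> back to
      \<open>b\<close>. Since \<open>p\<close> has at most g + 1 vertices, these are at most g
      edges.\<close>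
    have "{u, v} \<in> ?J" using lt[of "{u, v}"] e False by auto
    then have "reach ?J 1 u v" using reach_edge[of u v ?J 0] by simp
    then have "reach ?J (length p1 + 1 + length p2) a b"
      using reach_trans w1 w2 by meson
    from reach_mono[OF this subset_refl] have "reach ?J g a b" using p(6) pp by simp
    then show False using ac[of a b] MJ Mab by auto
  qed
qed

section \<open>Edge counts of graphs without short cycles\<close>

text \<open>Paths with \<open>i\<close> edges that end in the root \<open>v\<close>; the growing end
  is the head of the list, so that a path is extended by a cons.\<close>

definition spaths :: "'v set set \<Rightarrow> 'v \<Rightarrow> nat \<Rightarrow> 'v list set" where
  "spaths J v i = {p. vpath J p \<and> distinct p \<and> p \<noteq> [] \<and> last p = v \<and> length p = Suc i}"

definition nbrs :: "'v set set \<Rightarrow> 'v \<Rightarrow> 'v set" where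
  "nbrs J x = {y. {x, y} \<in> J}"

lemma vpath_avoid:
  assumes "vpath J p" "x \<notin> set p" "x \<in> e"
  shows "vpath (J - {e}) p"
  using assms by (intro vpath_cong_sub[OF assms(1)]) auto

text \<open>This excludes cycles with at most g + 1 edges without mentioning cycles. Loops are
  excluded as well, because a walk of length 0 bypasses them.\<close>

locale high_girth =
  fixes J :: "'v set set" and g :: nat
  assumes no_detour: "\<And>u v. {u, v} \<in> J \<Longrightarrow> \<not> reach (J - {{u, v}}) g u v"
begin

lemma irrefl: "{u, u} \<notin> J"
  using no_detour[of u u] by auto

text \<open>If two paths share the head \<open>w\<close> but continue to different vertices
  \<open>x\<close> and \<open>y\<close>, then the edge \<open>{w, x}\<close> is bypassed through
  \<open>y\<close>, the root and back to \<open>x\<close>, with 2i + 1 edges when both tails have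
  \<open>i\<close>. So up to half the girth the paths form a tree.\<close>

lemma hd_unique:
  "p \<in> spaths J v i \<Longrightarrow> q \<in> spaths J v i \<Longrightarrow> hd p = hd q \<Longrightarrow> 2 * i \<le> Suc g \<Longrightarrow> p = q"
proof (induction i arbitrary: p q)
  case 0
  then show ?case by (auto simp: spaths_def length_Suc_conv)
next
  case (Suc i)
  obtain w x p' where p: "p = w # x # p'"
    using Suc.prems(1) by (auto simp: spaths_def length_Suc_conv)
  obtain y q' where q: "q = w # y # q'"
    using Suc.prems(2,3) p by (auto simp: spaths_def length_Suc_conv)
  have xp: "x # p' \<in> spaths J v i" using Suc.prems(1) p by (auto simp: spaths_def)
  have yq: "y # q' \<in> spaths J v i" using Suc.prems(2) q by (auto simp: spaths_def)
  have dw: "w \<notin> set (x # p')" "w \<notin> set (y # q')"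
    using Suc.prems(1,2) p q by (auto simp: spaths_def)
  show ?case
  proof (cases "x = y")
    case True
    then show ?thesis using Suc.IH[OF xp yq] Suc.prems(4) p q by simp
  next
    case False
    let ?E = "J - {{w, x}}"
    have wx: "{w, x} \<in> J" and wy: "{w, y} \<in> ?E"
      using Suc.prems(1,2) p q False by (auto simp: spaths_def doubleton_eq_iff)
    \<comment> \<open>Neither tail contains \<open>w\<close>, hence neither uses the edge
      \<open>{w, x}\<close>.\<close>
    have "vpath ?E (x # p')" "vpath ?E (y # q')"
      using xp yq dw by (auto simp only: spaths_def mem_Collect_eq intro!: vpath_avoid[of J _ w])
    then have "reach ?E i x v" "reach ?E i y v"
      using vpath_reach[of ?E "x # p'" i] vpath_reach[of ?E "y # q'" i] xp yq
      by (auto simp: spaths_def)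
    then have "reach ?E (Suc i) w v" "reach ?E i v x" using wy reach_sym[of ?E i x v] by auto
    then have "reach ?E (Suc i + i) w x" by (rule reach_trans)
    from reach_mono[OF this subset_refl] have "reach ?E g w x" using Suc.prems(4) by simp
    then show ?thesis using no_detour[OF wx] by simp
  qed
qed

text \<open>If \<open>y\<close> were already on the path, the part of the path from its head to
  \<open>y\<close> would bypass the edge to \<open>y\<close>; only the predecessor of the head has
  to be excluded. For i = 0 the excluded vertex \<open>hd (tl p)\<close> is an unspecified value,
  which costs at most one neighbor.\<close>

lemma extend:
  assumes p: "p \<in> spaths J v i" and y: "{hd p, y} \<in> J" "y \<noteq> hd (tl p)" and i: "i \<le> g"
  shows "y # p \<in> spaths J v (Suc i)"
proof -
  obtain w p' where wp: "p = w # p'" using p by (auto simp: spaths_def length_Suc_conv)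
  have "y \<notin> set p"
  proof
    assume "y \<in> set p"
    moreover have "y \<noteq> w" using y irrefl wp by auto
    ultimately have "y \<in> set p'" using wp by auto
    then obtain a b where ab: "p' = a @ y # b" by (meson split_list)
    obtain x a' where a: "a = x # a'" using ab y(2) wp by (cases a) auto
    let ?E = "J - {{w, y}}"
    have "vpath J (a @ [y])" using p wp ab by (auto simp: spaths_def successively_Cons successively_append_iff)
    moreover have "w \<notin> set (a @ [y])" using p wp ab by (auto simp: spaths_def)
    ultimately have "vpath ?E (a @ [y])" by (rule vpath_avoid) auto
    from vpath_reach[OF this, of "length a"] have "reach ?E (length a) x y"
      using a by auto
    moreover have "{w, x} \<in> ?E" using p wp ab a by (auto simp: spaths_def doubleton_eq_iff)
    ultimately have "reach ?E (Suc (length a)) w y" by auto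
    from reach_mono[OF this subset_refl] have "reach ?E g w y" using i p wp ab by (simp add: spaths_def)
    then show False using no_detour[of w y] y wp by simp
  qed
  then show ?thesis using p y wp by (auto simp: spaths_def insert_commute)
qed

text \<open>A head loses at most one neighbor to its predecessor, hence the degree minus 1, and a
  cons determines its parts, so no extension is counted twice. The last conjunct serves to locate
  the new heads.\<close>

lemma card_extend:
  assumes Q: "Q \<subseteq> spaths J v i" "finite Q" and i: "i \<le> g"
    and fin: "\<And>x. finite (nbrs J x)"
    and d: "\<And>p. p \<in> Q \<Longrightarrow> d \<le> real (card (nbrs J (hd p))) - 1"
  shows "\<exists>Q'. Q' \<subseteq> spaths J v (Suc i) \<and> finite Q' \<and> real (card Q) * d \<le> real (card Q') \<and>
    (\<forall>q \<in> Q'. \<exists>p \<in> Q. {hd p, hd q} \<in> J)"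
proof -
  define S where "S = (SIGMA p : Q. nbrs J (hd p) - {hd (tl p)})"
  let ?Q' = "(\<lambda>(p, y). y # p) ` S"
  have fS: "finite S" unfolding S_def using Q fin by auto
  have "?Q' \<subseteq> spaths J v (Suc i)"
  proof
    fix q assume "q \<in> ?Q'"
    then obtain p y where "q = y # p" "p \<in> Q" "{hd p, y} \<in> J" "y \<noteq> hd (tl p)"
      by (auto simp: S_def nbrs_def)
    then show "q \<in> spaths J v (Suc i)" using Q i extend by blast
  qed
  moreover have "real (card Q) * d \<le> real (card ?Q')"
  proof -
    have "card ?Q' = card S" by (rule card_image) (auto simp: inj_on_def)
    also have "\<dots> = (\<Sum>p\<in>Q. card (nbrs J (hd p) - {hd (tl p)}))"
      unfolding S_def using Q fin by (intro card_SigmaI) auto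
    finally have "real (card ?Q') = (\<Sum>p\<in>Q. real (card (nbrs J (hd p) - {hd (tl p)})))" by simp
    also have "\<dots> \<ge> (\<Sum>p\<in>Q. d)"
    proof (rule sum_mono)
      fix p assume "p \<in> Q"
      then have "d \<le> real (card (nbrs J (hd p))) - 1" by (rule d)
      also have "\<dots> \<le> real (card (nbrs J (hd p) - {hd (tl p)}))"
        using fin[of "hd p"] by (auto simp: card_Diff_singleton_if)
      finally show "d \<le> real (card (nbrs J (hd p) - {hd (tl p)}))" .
    qed
    finally show ?thesis by simp
  qed
  moreover have "\<forall>q \<in> ?Q'. \<exists>p \<in> Q. {hd p, hd q} \<in> J" by (auto simp: S_def nbrs_def)
  moreover have "finite ?Q'" using fS by auto
  ultimately show ?thesis by blast
qed

text \<open>By \<open>hd_unique\<close>, counting paths amounts to counting their heads;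
  contradictions arise from more paths than \<open>Y\<close> has room for.\<close>

lemma card_heads:
  assumes "Q \<subseteq> spaths J v i" "hd ` Q \<subseteq> Y" "finite Y" "2 * i \<le> Suc g"
  shows "card Q \<le> card Y"
proof -
  have "inj_on hd Q" using assms hd_unique by (meson inj_onI subsetD)
  then show ?thesis using assms by (metis card_inj_on_le)
qed

text \<open>
  Let \<open>R\<close> be the number of vertices outside the largest class \<open>a\<close>. Outside \<open>a\<close> all degrees are large because of
  the size of \<open>a\<close>, and the neighbors of a vertex of \<open>a\<close> all lie among the \<open>R\<close> other vertices. Hence the last
  step of the growth of the tree of paths overflows either the complement of \<open>a\<close> or the whole graph.
\<close>

lemma no_dense_bichromatic:
  fixes \<kappa> :: "'v \<Rightarrow> 'c" and L \<alpha> :: real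
  assumes V: "finite V" and g: "g = 2 * k - 1" "k \<ge> 1" and L: "L > 0" "\<alpha> > 0" "\<alpha> ^ k = 4 ^ k * L"
    and bi: "\<And>x y. {x, y} \<in> J \<Longrightarrow> \<kappa> x \<noteq> \<kappa> y"
    and W: "v \<in> W" "W \<subseteq> V" and closed: "\<And>u y. u \<in> W \<Longrightarrow> {u, y} \<in> J \<Longrightarrow> y \<in> W"
    and deg: "\<And>u. u \<in> W \<Longrightarrow>
      \<alpha> * (1 + real (card {x \<in> V. \<kappa> x \<noteq> \<kappa> u}) / L) \<le> real (card (nbrs J u)) - 1"
    and fin: "\<And>x. finite (nbrs J x)"
  shows False
proof -
  define cl where "cl c = card {x \<in> V. \<kappa> x = c}" for c
  define N where "N = card V"
  have split: "card {x \<in> V. \<kappa> x \<noteq> c} + cl c = N" for c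
    unfolding cl_def N_def by (subst card_Un_disjoint[symmetric]) (use V in \<open>auto intro: arg_cong[where f = card]\<close>)
  have vV: "v \<in> V" using W by auto
  have "Max (cl ` \<kappa> ` V) \<in> cl ` \<kappa> ` V" using V vV by (intro Max_in) auto
  then obtain a where a: "cl a = Max (cl ` \<kappa> ` V)" by (metis imageE)
  have amax: "cl (\<kappa> u) \<le> cl a" if "u \<in> V" for u
    unfolding a using V that by (intro Max_ge) auto
  define R where "R = real (card {x \<in> V. \<kappa> x \<noteq> a})"
  define nA where "nA = real (cl a)"
  have NR: "real N = R + nA" using split[of a] by (simp add: R_def nA_def)
  have R0: "R \<ge> 0" "nA \<ge> 0" by (auto simp: R_def nA_def)
  \<comment> \<open>A common lower bound for the branching: every color class has at most the size
    of class \<open>a\<close>, so at least \<open>R\<close> vertices lie outside it.\<close>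
  define \<beta> where "\<beta> = \<alpha> * (1 + R / L)"
  have \<beta>0: "\<beta> > 0" unfolding \<beta>_def using L R0 by (simp add: add_pos_nonneg)
  have d1: "\<beta> \<le> real (card (nbrs J u)) - 1" if "u \<in> W" for u
  proof -
    have "R \<le> real (card {x \<in> V. \<kappa> x \<noteq> \<kappa> u})"
      using split[of a] split[of "\<kappa> u"] amax[of u] W that by (auto simp: R_def)
    then have "\<beta> \<le> \<alpha> * (1 + real (card {x \<in> V. \<kappa> x \<noteq> \<kappa> u}) / L)"
      unfolding \<beta>_def using L by (intro mult_left_mono add_left_mono divide_right_mono) auto
    also have "\<dots> \<le> real (card (nbrs J u)) - 1" using that by (rule deg)
    finally show ?thesis .
  qed
  have d2: "\<alpha> * (1 + nA / L) \<le> real (card (nbrs J u)) - 1" if "u \<in> W" "\<kappa> u \<noteq> a" for u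
  proof -
    have "cl a \<le> card {x \<in> V. \<kappa> x \<noteq> \<kappa> u}"
      unfolding cl_def using V that by (intro card_mono) auto
    then have "\<alpha> * (1 + nA / L) \<le> \<alpha> * (1 + real (card {x \<in> V. \<kappa> x \<noteq> \<kappa> u}) / L)"
      unfolding nA_def using L by (intro mult_left_mono add_left_mono divide_right_mono) auto
    also have "\<dots> \<le> real (card (nbrs J u)) - 1" using that by (intro deg)
    finally show ?thesis .
  qed
  have levels: "\<exists>P. P \<subseteq> spaths J v i \<and> finite P \<and> hd ` P \<subseteq> W \<and> \<beta> ^ i \<le> real (card P)"
    if "i \<le> k" for i
    using that
  proof (induction i)
    case 0
    have "[v] \<in> spaths J v 0" by (simp add: spaths_def)
    then show ?case using W by (intro exI[of _ "{[v]}"]) auto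
  next
    case (Suc i)
    then obtain P where P: "P \<subseteq> spaths J v i" "finite P" "hd ` P \<subseteq> W" "\<beta> ^ i \<le> real (card P)" by auto
    have ig: "i \<le> g" using Suc.prems g by linarith
    have "\<beta> \<le> real (card (nbrs J (hd p))) - 1" if "p \<in> P" for p using d1 P(3) that by auto
    from card_extend[OF P(1,2) ig fin this]
    obtain P' where P': "P' \<subseteq> spaths J v (Suc i)" "finite P'" "real (card P) * \<beta> \<le> real (card P')"
      "\<forall>q \<in> P'. \<exists>p \<in> P. {hd p, hd q} \<in> J" by auto
    have "hd ` P' \<subseteq> W"
    proof
      fix x assume "x \<in> hd ` P'"
      then obtain q where "q \<in> P'" "x = hd q" by auto
      then obtain p where "p \<in> P" "{hd p, x} \<in> J" using P'(4) by auto
      then show "x \<in> W" using P(3) closed by blast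
    qed
    moreover have "\<beta> ^ Suc i \<le> real (card P')"
      using order_trans[OF mult_right_mono[OF P(4), of \<beta>] P'(3)] \<beta>0 by (simp add: mult.commute)
    ultimately show ?case using P' by auto
  qed
  have gk: "2 * k \<le> Suc g" using g by simp
  \<comment> \<open>Here the normalization of \<open>\<alpha>\<close> enters: the factor
    \<open>4 ^ k\<close> and the estimate of the power by its base make the last level four times
    larger than \<open>L + R\<close>.\<close>
  have \<beta>k: "\<beta> ^ k = 4 ^ k * L * (1 + R / L) ^ k" unfolding \<beta>_def power_mult_distrib L(3) by simp
  have p4: "(4::real) \<le> 4 ^ k" using power_increasing[of 1 k "4::real"] g by simp
  have "4 * (L * (1 + R / L)) \<le> 4 ^ k * (L * (1 + R / L) ^ k)"
    using p4 L R0 g self_le_power[of "1 + R / L" k] by (intro mult_mono mult_left_mono) auto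
  moreover have "L * (1 + R / L) = L + R" using L by (simp add: field_simps)
  ultimately have big: "4 * (L + R) \<le> \<beta> ^ k" unfolding \<beta>k by (simp add: mult.assoc)
  obtain Pk where Pk: "Pk \<subseteq> spaths J v k" "finite Pk" "hd ` Pk \<subseteq> W" "\<beta> ^ k \<le> real (card Pk)"
    using levels[of k] by auto
  have big': "4 * L + 4 * R \<le> \<beta> ^ k" using big unfolding distrib_left .
  \<comment> \<open>Level \<open>k\<close> fits into \<open>V\<close>; together with the lower bound
    this makes \<open>nA\<close> exceed \<open>3 * R\<close>, so class \<open>a\<close> holds most
    vertices.\<close>
  have "card Pk \<le> N" unfolding N_def using Pk W V gk by (intro card_heads) auto
  then have N1: "4 * L + 4 * R \<le> R + nA" using big' Pk(4) NR by linarith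
  obtain X where X: "X \<subseteq> spaths J v (k - 1)" "finite X" "hd ` X \<subseteq> W" "\<beta> ^ (k - 1) \<le> real (card X)"
    using levels[of "k - 1"] by auto
  \<comment> \<open>Only the last step treats heads inside and outside class \<open>a\<close>
    differently; whichever half of level k - 1 is larger yields the contradiction.\<close>
  define XA where "XA = {p \<in> X. \<kappa> (hd p) = a}"
  define XB where "XB = {p \<in> X. \<kappa> (hd p) \<noteq> a}"
  have cX: "card X = card XA + card XB"
    unfolding XA_def XB_def by (subst card_Un_disjoint[symmetric]) (use X in \<open>auto intro: arg_cong[where f = card]\<close>)
  have kS: "Suc (k - 1) = k" and kg: "k - 1 \<le> g" using g by simp_all
  have A: "real (card XA) * \<beta> \<le> R"
  proof -
    have "XA \<subseteq> spaths J v (k - 1)" "finite XA" using X by (auto simp: XA_def)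
    moreover have "\<beta> \<le> real (card (nbrs J (hd p))) - 1" if "p \<in> XA" for p
      using d1 X(3) that by (auto simp: XA_def)
    ultimately obtain Q where Q: "Q \<subseteq> spaths J v k" "finite Q" "real (card XA) * \<beta> \<le> real (card Q)"
      "\<forall>q \<in> Q. \<exists>p \<in> XA. {hd p, hd q} \<in> J"
      using card_extend[OF _ _ kg fin, of XA v \<beta>] unfolding kS by metis
    have "hd ` Q \<subseteq> {x \<in> V. \<kappa> x \<noteq> a}"
    proof
      fix x assume "x \<in> hd ` Q"
      then obtain p where p: "p \<in> XA" "{hd p, x} \<in> J" using Q(4) by auto
      then have "\<kappa> x \<noteq> a" "x \<in> W" using bi[of "hd p" x] closed[of "hd p" x] X by (auto simp: XA_def)
      then show "x \<in> {x \<in> V. \<kappa> x \<noteq> a}" using W by auto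
    qed
    then have "card Q \<le> card {x \<in> V. \<kappa> x \<noteq> a}" using Q V gk by (intro card_heads) auto
    then show ?thesis using Q(3) by (simp add: R_def)
  qed
  have B: "real (card XB) * (\<alpha> * (1 + nA / L)) \<le> real N"
  proof -
    have "XB \<subseteq> spaths J v (k - 1)" "finite XB" using X by (auto simp: XB_def)
    moreover have "\<alpha> * (1 + nA / L) \<le> real (card (nbrs J (hd p))) - 1" if "p \<in> XB" for p
      using d2 X(3) that by (auto simp: XB_def)
    ultimately obtain Q where Q: "Q \<subseteq> spaths J v k" "finite Q"
      "real (card XB) * (\<alpha> * (1 + nA / L)) \<le> real (card Q)" "\<forall>q \<in> Q. \<exists>p \<in> XB. {hd p, hd q} \<in> J"
      using card_extend[OF _ _ kg fin, of XB v "\<alpha> * (1 + nA / L)"] unfolding kS by metis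
    have "hd ` Q \<subseteq> V"
    proof
      fix x assume "x \<in> hd ` Q"
      then obtain p where p: "p \<in> XB" "{hd p, x} \<in> J" using Q(4) by auto
      then show "x \<in> V" using closed[of "hd p" x] X W by (auto simp: XB_def)
    qed
    then have "card Q \<le> N" unfolding N_def using Q V gk by (intro card_heads) auto
    then show ?thesis using Q(3) by simp
  qed
  show False
  proof (cases "card XB \<le> card XA")
    case True
    then have "\<beta> ^ (k - 1) * \<beta> \<le> 2 * real (card XA) * \<beta>" using X(4) cX \<beta>0 by (intro mult_right_mono) auto
    then have "\<beta> ^ k \<le> 2 * R" using A power_Suc2[of \<beta> "k - 1"] kS by simp
    then show False using big L R0 by simp
  next
    case False
    then have "\<beta> ^ (k - 1) * (\<alpha> * (1 + nA / L)) \<le> 2 * real (card XB) * (\<alpha> * (1 + nA / L))"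
      using X(4) cX L R0 by (intro mult_right_mono) auto
    then have b: "\<beta> ^ (k - 1) * (\<alpha> * (1 + nA / L)) \<le> 2 * real N" using B by simp
    have "\<alpha> ^ (k - 1) \<le> \<beta> ^ (k - 1)" unfolding \<beta>_def using L R0 by (intro power_mono) auto
    then have "\<alpha> ^ (k - 1) * (\<alpha> * (1 + nA / L)) \<le> \<beta> ^ (k - 1) * (\<alpha> * (1 + nA / L))"
      using L R0 by (intro mult_right_mono) auto
    moreover have "\<alpha> ^ (k - 1) * (\<alpha> * (1 + nA / L)) = 4 ^ k * (L + nA)"
      using L power_Suc2[of \<alpha> "k - 1"] kS by (simp add: field_simps)
    ultimately have "4 ^ k * (L + nA) \<le> 2 * real N" using b by simp
    moreover have "4 * (L + nA) \<le> 4 ^ k * (L + nA)" using p4 L R0 by (intro mult_right_mono) auto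
    ultimately have "4 * (L + nA) \<le> 2 * real N" by (rule order_trans[rotated])
    \<comment> \<open>From \<open>4 * (L + nA) \<le> 2 * (R + nA)\<close>; this contradicts the
      dominance of class \<open>a\<close>.\<close>
    then have "nA \<le> R" using NR L(1) by (simp add: algebra_simps)
    then show False using N1 L R0 by linarith
  qed
qed

end

section \<open>Dense parts and the bound by bichromatic pairs\<close>

lemma high_girth_mono: "high_girth J g \<Longrightarrow> J' \<subseteq> J \<Longrightarrow> high_girth J' g"
  unfolding high_girth_def by (meson Diff_mono order_refl reach_mono subsetD)

text \<open>Take a smallest vertex set that spans more edges than its thresholds sum up to: removing
  a vertex with at most \<open>t u\<close> neighbors would leave a smaller set of this kind. The
  threshold varies with the vertex because the required degree depends on its color class.\<close>

lemma dense_part: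
  fixes t :: "'v \<Rightarrow> real"
  assumes V: "finite V" and J: "\<And>e. e \<in> J \<Longrightarrow> e \<subseteq> V" "\<And>e. e \<in> J \<Longrightarrow> \<exists>x y. e = {x, y}" "{} \<notin> J"
    and big: "(\<Sum>v\<in>V. t v) < real (card J)"
  obtains W where "W \<subseteq> V" "W \<noteq> {}" "\<And>u. u \<in> W \<Longrightarrow> t u < real (card (nbrs {e \<in> J. e \<subseteq> W} u))"
proof -
  have fJ: "finite J" using V J by (intro finite_subset[of J "Pow V"]) auto
  define bad where "bad W \<longleftrightarrow> W \<subseteq> V \<and> (\<Sum>v\<in>W. t v) < real (card {e \<in> J. e \<subseteq> W})" for W
  have "{e \<in> J. e \<subseteq> V} = J" using J by auto
  then have "bad V" using big by (simp add: bad_def)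
  then obtain W where W: "bad W" "\<And>U. bad U \<Longrightarrow> card W \<le> card U"
    using ex_has_least_nat[of bad V card] by metis
  have WV: "W \<subseteq> V" and fW: "finite W" using W V finite_subset by (auto simp: bad_def)
  have "W \<noteq> {}"
  proof
    assume "W = {}"
    then have "{e \<in> J. e \<subseteq> W} = {}" using J(3) by auto
    then have "\<not> bad W" unfolding bad_def by (simp only: card.empty \<open>W = {}\<close>) simp
    then show False using W(1) by simp
  qed
  moreover have "t u < real (card (nbrs {e \<in> J. e \<subseteq> W} u))" if u: "u \<in> W" for u
  proof (rule ccontr)
    assume neg: "\<not> ?thesis"
    let ?J = "{e \<in> J. e \<subseteq> W}" and ?U = "{e \<in> J. e \<subseteq> W - {u}}"
    have nb: "nbrs ?J u \<subseteq> W" by (auto simp: nbrs_def)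
    have "?J \<subseteq> ?U \<union> (\<lambda>y. {u, y}) ` nbrs ?J u"
    proof
      fix e assume e: "e \<in> ?J"
      then obtain x y where xy: "e = {x, y}" using J(2) by blast
      show "e \<in> ?U \<union> (\<lambda>y. {u, y}) ` nbrs ?J u"
      proof (cases "u \<in> e")
        case True
        then obtain z where "e = {u, z}" using xy by auto
        then show ?thesis using e by (auto simp: nbrs_def)
      next
        case False
        then show ?thesis using e by auto
      qed
    qed
    then have "card ?J \<le> card (?U \<union> (\<lambda>y. {u, y}) ` nbrs ?J u)"
      using fJ finite_subset[OF nb fW] by (intro card_mono) auto
    also have "\<dots> \<le> card ?U + card ((\<lambda>y. {u, y}) ` nbrs ?J u)" by (rule card_Un_le)
    also have "\<dots> \<le> card ?U + card (nbrs ?J u)" using finite_subset[OF nb fW] by (simp add: card_image_le)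
    finally have "real (card ?J) \<le> real (card ?U) + t u" using neg by linarith
    moreover have "(\<Sum>v\<in>W. t v) = t u + (\<Sum>v\<in>W - {u}. t v)" using fW u by (simp add: sum.remove)
    ultimately have "bad (W - {u})" using W(1) by (auto simp: bad_def)
    then have "card W \<le> card (W - {u})" by (rule W(2))
    then show False using u fW by (metis card_Diff1_less not_less)
  qed
  ultimately show ?thesis using that WV by blast
qed

text \<open>Ordered pairs, so that the cardinality is the sum over all vertices of the number of
  differently colored vertices.\<close>

definition bipairs :: "('v \<Rightarrow> 'c) \<Rightarrow> 'v set \<Rightarrow> ('v \<times> 'v) set" where
  "bipairs \<kappa> V = {(u, v) \<in> V \<times> V. \<kappa> u \<noteq> \<kappa> v}"

text \<open>
  For injective \<open>\<kappa>\<close> and \<open>L = card V\<close> this is the Moore bound. The bound is linear in the number of vertices and of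
  bichromatic pairs, so that its expectation over random color classes is easy even if single classes are huge.
\<close>

lemma high_girth_card:
  fixes L :: real
  assumes hg: "high_girth J (2 * k - 1)" and k: "k \<ge> 1" and L: "L \<ge> 1" and V: "finite V"
    and J: "\<And>e. e \<in> J \<Longrightarrow> \<exists>x\<in>V. \<exists>y\<in>V. e = {x, y} \<and> \<kappa> x \<noteq> \<kappa> y"
  shows "real (card J) \<le> 5 * L powr (1 / k) * (card V + card (bipairs \<kappa> V) / L)"
proof (rule ccontr)
  assume neg: "\<not> ?thesis"
  define \<alpha> where "\<alpha> = 4 * L powr (1 / k)"
  have k0: "real k > 0" using k by simp
  have "(L powr (1 / k)) ^ k = L" using L k by (simp add: powr_powr flip: powr_realpow)
  then have \<alpha>k: "\<alpha> ^ k = 4 ^ k * L" by (simp add: \<alpha>_def power_mult_distrib)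
  have Lk: "1 \<le> L powr (1 / k)" using L k0 by (simp add: ge_one_powr_ge_zero)
  have \<alpha>0: "\<alpha> > 0" using Lk L by (simp add: \<alpha>_def)
  \<comment> \<open>The leading 1 pays for the one neighbor that a path may not return to.\<close>
  define t where "t u = 1 + \<alpha> * (1 + real (card {x \<in> V. \<kappa> x \<noteq> \<kappa> u}) / L)" for u
  have "bipairs \<kappa> V = (SIGMA u : V. {x \<in> V. \<kappa> x \<noteq> \<kappa> u})" by (auto simp: bipairs_def)
  then have "card (bipairs \<kappa> V) = (\<Sum>u\<in>V. card {x \<in> V. \<kappa> x \<noteq> \<kappa> u})"
    using V by (simp add: card_SigmaI)
  then have "(\<Sum>u\<in>V. t u) = card V + \<alpha> * (card V + card (bipairs \<kappa> V) / L)"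
    by (simp add: t_def sum.distrib sum_divide_distrib flip: sum_distrib_left)
  \<comment> \<open>The sum of the leading ones is absorbed since
    \<open>L powr (1 / k) \<ge> 1\<close>; this raises the factor 4 of \<open>\<alpha>\<close> to
    5.\<close>
  also have "\<dots> \<le> L powr (1 / k) * (card V + card (bipairs \<kappa> V) / L) + \<alpha> * (card V + card (bipairs \<kappa> V) / L)"
  proof -
    have "1 * real (card V) \<le> L powr (1 / k) * (card V + card (bipairs \<kappa> V) / L)"
      using Lk L by (intro mult_mono) auto
    then show ?thesis by simp
  qed
  also have "\<dots> = 5 * L powr (1 / k) * (card V + card (bipairs \<kappa> V) / L)"
    by (simp add: \<alpha>_def algebra_simps)
  finally have big: "(\<Sum>u\<in>V. t u) < real (card J)" using neg by simp
  have "e \<subseteq> V" "\<exists>x y. e = {x, y}" "e \<noteq> {}" if "e \<in> J" for e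
    using J[OF that] by auto
  then obtain W where W: "W \<subseteq> V" "W \<noteq> {}"
    "\<And>u. u \<in> W \<Longrightarrow> t u < real (card (nbrs {e \<in> J. e \<subseteq> W} u))"
    using dense_part[OF V, of J t] big by metis
  obtain v where v: "v \<in> W" using W by auto
  interpret high_girth "{e \<in> J. e \<subseteq> W}" "2 * k - 1"
    by (rule high_girth_mono[OF hg]) auto
  show False
  proof (rule no_dense_bichromatic[OF V refl k _ \<alpha>0 \<alpha>k _ v W(1)])
    show "L > 0" using L by simp
    fix x y assume "{x, y} \<in> {e \<in> J. e \<subseteq> W}"
    then obtain x' y' where "{x, y} = {x', y'}" "\<kappa> x' \<noteq> \<kappa> y'" using J[of "{x, y}"] by auto
    then show "\<kappa> x \<noteq> \<kappa> y" by (auto simp: doubleton_eq_iff)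
  next
    fix u assume "u \<in> W"
    then show "\<alpha> * (1 + real (card {x \<in> V. \<kappa> x \<noteq> \<kappa> u}) / L) \<le> real (card (nbrs {e \<in> J. e \<subseteq> W} u)) - 1"
      using W(3)[of u] by (simp add: t_def)
  next
    fix x show "finite (nbrs {e \<in> J. e \<subseteq> W} x)"
      by (rule finite_subset[of _ V]) (use V W in \<open>auto simp: nbrs_def\<close>)
  qed auto
qed

section \<open>Random sets of colors\<close>

text \<open>The probability that exactly the colors \<open>S\<close> of \<open>C\<close> are kept
  when each is kept independently with probability \<open>p\<close>. Expectations become finite sums
  over \<open>Pow C\<close>.\<close>

definition sample_weight :: "real \<Rightarrow> 'c set \<Rightarrow> 'c set \<Rightarrow> real" where
  "sample_weight p C S = p ^ card S * (1 - p) ^ card (C - S)"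

text \<open>Multiplying out the product over \<open>C\<close> of a factor for keeping plus a factor
  for dropping yields the sum over all \<open>S\<close>; a factor is set to 0 where the choice
  contradicts \<open>A\<close> or \<open>B\<close>. With both sets empty the weights sum to
  1.\<close>

lemma sum_sample_weight:
  assumes C: "finite C" and AB: "A \<subseteq> C" "B \<subseteq> C" "A \<inter> B = {}"
  shows "(\<Sum>S\<in>Pow C. sample_weight p C S * of_bool (A \<subseteq> S \<and> S \<inter> B = {})) = p ^ card A * (1 - p) ^ card B"
proof -
  let ?f = "\<lambda>x. if x \<in> B then 0 else p" and ?h = "\<lambda>x. if x \<in> A then 0 else 1 - p"
  have fin: "finite A" "finite B" using finite_subset[OF AB(1) C] finite_subset[OF AB(2) C] by auto
  have "sample_weight p C S * of_bool (A \<subseteq> S \<and> S \<inter> B = {}) = (\<Prod>x\<in>S. ?f x) * (\<Prod>x\<in>C - S. ?h x)"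
    if "S \<in> Pow C" for S
  proof -
    have fS: "finite S" "finite (C - S)" using that C finite_subset by auto
    show ?thesis
    proof (cases "A \<subseteq> S \<and> S \<inter> B = {}")
      case True
      have "(\<Prod>x\<in>S. ?f x) = (\<Prod>x\<in>S. p)" by (intro prod.cong refl) (use True in auto)
      moreover have "(\<Prod>x\<in>C - S. ?h x) = (\<Prod>x\<in>C - S. 1 - p)"
        by (intro prod.cong refl) (use True in auto)
      ultimately show ?thesis using True by (simp add: sample_weight_def)
    next
      case False
      then have "(\<exists>x\<in>S. ?f x = 0) \<or> (\<exists>x\<in>C - S. ?h x = 0)" using AB by auto
      then have "(\<Prod>x\<in>S. ?f x) = 0 \<or> (\<Prod>x\<in>C - S. ?h x) = 0"
        using prod_zero_iff[OF fS(1), of ?f] prod_zero_iff[OF fS(2), of ?h] by blast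
      then show ?thesis using False by auto
    qed
  qed
  then have "(\<Sum>S\<in>Pow C. sample_weight p C S * of_bool (A \<subseteq> S \<and> S \<inter> B = {})) = (\<Prod>x\<in>C. ?f x + ?h x)"
    using prod_add[OF C, of ?f ?h] by simp
  also have "\<dots> = (\<Prod>x\<in>C. (if x \<in> A then p else 1) * (if x \<in> B then 1 - p else 1))"
    using AB by (intro prod.cong) auto
  also have "\<dots> = p ^ card A * (1 - p) ^ card B"
    using C AB fin by (simp add: prod.distrib prod.If_cases Int_absorb1)
  finally show ?thesis .
qed

text \<open>An edge survives with probability at least \<open>p ^ q * (1 - p) ^ K\<close>, and
  Bernoulli's inequality with \<open>p * K \<le> 1 / 2\<close> bounds the second factor below by
  1/2; exchanging the sums gives the expected number of survivors. \<open>need e\<close> stands for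
  the colors whose survival has to be paid for.\<close>

lemma sampling_average:
  fixes p :: real and b :: "'c set \<Rightarrow> real"
  assumes C: "finite C" and p: "0 < p" "p * K \<le> 1 / 2" "p \<le> 1" and E: "finite E"
    and need: "\<And>e. e \<in> E \<Longrightarrow> need e \<subseteq> C" "\<And>e. e \<in> E \<Longrightarrow> card (need e) \<le> q"
    and F: "\<And>e. e \<in> E \<Longrightarrow> F e \<subseteq> C" "\<And>e. e \<in> E \<Longrightarrow> card (F e) \<le> K" "\<And>e. e \<in> E \<Longrightarrow> need e \<inter> F e = {}"
    and b: "\<And>S. S \<subseteq> C \<Longrightarrow> real (card {e \<in> E. need e \<subseteq> S \<and> S \<inter> F e = {}}) \<le> b S"
  shows "real (card E) * p ^ q / 2 \<le> (\<Sum>S\<in>Pow C. sample_weight p C S * b S)"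
proof -
  have each: "p ^ q / 2 \<le> p ^ card (need e) * (1 - p) ^ card (F e)" if "e \<in> E" for e
  proof -
    have "p ^ q \<le> p ^ card (need e)" using p need(2)[OF that] by (intro power_decreasing) auto
    moreover have "1 / 2 \<le> (1 - p) ^ card (F e)"
    proof -
      have "p * real (card (F e)) \<le> p * K" using F(2)[OF that] p by (intro mult_left_mono) auto
      then have "1 / 2 \<le> 1 + real (card (F e)) * (- p)" using p(2) by (simp add: mult.commute[of _ p])
      also have "\<dots> \<le> (1 + - p) ^ card (F e)" using p by (intro Bernoulli_inequality) auto
      finally show ?thesis by simp
    qed
    ultimately have "p ^ q * (1 / 2) \<le> p ^ card (need e) * (1 - p) ^ card (F e)"
      using p by (intro mult_mono) auto
    then show ?thesis by simp
  qed
  have "real (card E) * p ^ q / 2 = (\<Sum>e\<in>E. p ^ q / 2)" by simp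
  also have "\<dots> \<le> (\<Sum>e\<in>E. \<Sum>S\<in>Pow C. sample_weight p C S * of_bool (need e \<subseteq> S \<and> S \<inter> F e = {}))"
    using each by (intro sum_mono) (simp add: sum_sample_weight[OF C need(1) F(1) F(3)])
  also have "\<dots> = (\<Sum>S\<in>Pow C. sample_weight p C S * (\<Sum>e\<in>E. of_bool (need e \<subseteq> S \<and> S \<inter> F e = {})))"
    by (subst sum.swap) (simp add: sum_distrib_left)
  also have "\<dots> \<le> (\<Sum>S\<in>Pow C. sample_weight p C S * b S)"
  proof (rule sum_mono)
    fix S assume S: "S \<in> Pow C"
    have "(\<Sum>e\<in>E. of_bool (need e \<subseteq> S \<and> S \<inter> F e = {})) = real (card {e \<in> E. need e \<subseteq> S \<and> S \<inter> F e = {}})"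
      using E by (simp add: of_bool_def sum.If_cases Int_def)
    then have "(\<Sum>e\<in>E. of_bool (need e \<subseteq> S \<and> S \<inter> F e = {})) \<le> b S" using b S by auto
    then show "sample_weight p C S * (\<Sum>e\<in>E. of_bool (need e \<subseteq> S \<and> S \<inter> F e = {})) \<le> sample_weight p C S * b S"
      using p by (intro mult_left_mono) (auto simp: sample_weight_def)
  qed
  finally show ?thesis .
qed

section \<open>Graphs whose short cycles are blocked by colors\<close>

text \<open>
  The edges are ranked by \<open>r\<close> in the order of insertion; \<open>F e\<close> is the set of colors that was deleted when
  \<open>e\<close> was inserted.
\<close>

locale blocked_graph =
  fixes V :: "'v set" and E :: "'v set set" and r :: "'v set \<Rightarrow> nat"
    and col F :: "'v set \<Rightarrow> 'c set" and k K :: nat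
  assumes finite_V: "finite V"
    and edge: "\<And>e. e \<in> E \<Longrightarrow> \<exists>u\<in>V. \<exists>v\<in>V. e = {u, v}"
    and rank: "inj_on r E"
    and finite_col: "\<And>e. e \<in> E \<Longrightarrow> finite (col e)"
    and F: "\<And>e. e \<in> E \<Longrightarrow> finite (F e)" "\<And>e. e \<in> E \<Longrightarrow> card (F e) \<le> K"
    and F_col: "\<And>e. e \<in> E \<Longrightarrow> F e \<inter> col e = {}"
    and blocked: "\<And>u v. {u, v} \<in> E \<Longrightarrow>
      \<not> reach {e \<in> E. r e < r {u, v} \<and> col e \<inter> F {u, v} = {}} (2 * k - 1) u v"
    and k: "k \<ge> 1" and K: "K \<ge> 1"
begin

lemma finite_E: "finite E"
  by (rule finite_subset[of _ "Pow V"]) (use edge finite_V in \<open>auto dest!: edge\<close>)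

lemma irreflexive: "{u, u} \<notin> E"
  using blocked[of u u] by auto

text \<open>A detour of survivors with lower rank than \<open>e\<close> would avoid every color of
  \<open>F e\<close>, contradicting \<open>blocked\<close>. The premise on \<open>need\<close>
  admits colors that are left out because no edge of \<open>E0\<close> deletes them, such as a dummy
  color or the common color of a class.\<close>

lemma survivors_high_girth:
  assumes E0: "E0 \<subseteq> E" and need: "\<And>e e'. e \<in> E0 \<Longrightarrow> e' \<in> E0 \<Longrightarrow> need e' \<inter> F e = {} \<Longrightarrow> col e' \<inter> F e = {}"
  shows "high_girth {e \<in> E0. need e \<subseteq> S \<and> S \<inter> F e = {}} (2 * k - 1)"
proof
  let ?J = "{e \<in> E0. need e \<subseteq> S \<and> S \<inter> F e = {}}"
  fix u v assume uv: "{u, v} \<in> ?J"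
  show "\<not> reach (?J - {{u, v}}) (2 * k - 1) u v"
  proof (rule no_short_detour[OF _ _ uv])
    show "inj_on r ?J" using rank E0 by (auto intro: inj_on_subset)
    fix u v assume uv: "{u, v} \<in> ?J"
    show "\<not> reach {e \<in> ?J. r e < r {u, v}} (2 * k - 1) u v"
    proof
      assume "reach {e \<in> ?J. r e < r {u, v}} (2 * k - 1) u v"
      moreover have "{e \<in> ?J. r e < r {u, v}} \<subseteq> {e \<in> E. r e < r {u, v} \<and> col e \<inter> F {u, v} = {}}"
      proof
        fix e assume e: "e \<in> {e \<in> ?J. r e < r {u, v}}"
        then have "need e \<inter> F {u, v} = {}" using uv by blast
        then have "col e \<inter> F {u, v} = {}" using need[of "{u, v}" e] e uv by auto
        then show "e \<in> {e \<in> E. r e < r {u, v} \<and> col e \<inter> F {u, v} = {}}" using e E0 by auto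
      qed
      ultimately have "reach {e \<in> E. r e < r {u, v} \<and> col e \<inter> F {u, v} = {}} (2 * k - 1) u v"
        by (rule reach_mono) simp
      then show False using blocked[of u v] uv E0 by auto
    qed
  qed
qed

text \<open>\<open>W S\<close> contains the ends of all survivors, and \<open>\<kappa>\<close> is a
  free choice: the vertex colors, or the identity if all edges lie in one class. With
  \<open>p = 1 / (2 * K)\<close> the expected number of colors of \<open>F e\<close> in the sample
  is at most 1/2.\<close>

lemma sampled_card:
  fixes \<kappa> :: "'v \<Rightarrow> 'd" and L p :: real
  assumes E0: "E0 \<subseteq> E"
    and need: "\<And>e e'. e \<in> E0 \<Longrightarrow> e' \<in> E0 \<Longrightarrow> need e' \<inter> F e = {} \<Longrightarrow> col e' \<inter> F e = {}"
    and sub: "\<And>e. e \<in> E0 \<Longrightarrow> need e \<subseteq> col e" "\<And>e. e \<in> E0 \<Longrightarrow> card (need e) \<le> q"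
    and bi: "\<And>e x y. e \<in> E0 \<Longrightarrow> e = {x, y} \<Longrightarrow> \<kappa> x \<noteq> \<kappa> y"
    and W: "\<And>S. W S \<subseteq> V" "\<And>S e. e \<in> E0 \<Longrightarrow> need e \<subseteq> S \<Longrightarrow> e \<subseteq> W S"
    and L: "L \<ge> 1" and p: "p = 1 / (2 * K)" and C: "finite C" "\<And>e. e \<in> E \<Longrightarrow> col e \<union> F e \<subseteq> C"
  shows "real (card E0) * p ^ q / 2 \<le>
    (\<Sum>S\<in>Pow C. sample_weight p C S * (5 * L powr (1 / k) * (card (W S) + card (bipairs \<kappa> (W S)) / L)))"
proof (rule sampling_average[OF C(1), where need = need and F = F])
  show "0 < p" "p * real K \<le> 1 / 2" "p \<le> 1" unfolding p using K by (auto simp: field_simps)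
  show "finite E0" using E0 finite_E finite_subset by auto
  fix S assume "S \<subseteq> C"
  show "real (card {e \<in> E0. need e \<subseteq> S \<and> S \<inter> F e = {}})
    \<le> 5 * L powr (1 / k) * (card (W S) + card (bipairs \<kappa> (W S)) / L)"
  proof (rule high_girth_card[OF survivors_high_girth[OF E0 need] k L])
    show "finite (W S)" using W(1) finite_V finite_subset by blast
    fix e assume e: "e \<in> {e \<in> E0. need e \<subseteq> S \<and> S \<inter> F e = {}}"
    then obtain u v where "e = {u, v}" using edge E0 by blast
    then show "\<exists>x\<in>W S. \<exists>y\<in>W S. e = {x, y} \<and> \<kappa> x \<noteq> \<kappa> y" using W(2)[of e S] bi[of e u v] e by auto
  qed
next
  fix e assume e: "e \<in> E0"
  then have eE: "e \<in> E" using E0 by auto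
  show "need e \<subseteq> C" using sub(1)[OF e] C(2)[OF eE] by auto
  show "F e \<subseteq> C" using C(2)[OF eE] by auto
  show "card (F e) \<le> K" using F(2)[OF eE] .
  show "need e \<inter> F e = {}" using sub(1)[OF e] F_col[OF eE] by auto
  show "card (need e) \<le> q" using sub(2)[OF e] .
qed

lemma within_class_card:
  assumes U: "U \<subseteq> V" and E0: "E0 \<subseteq> E" "\<And>e. e \<in> E0 \<Longrightarrow> e \<subseteq> U"
    and need: "\<And>e e'. e \<in> E0 \<Longrightarrow> e' \<in> E0 \<Longrightarrow> need e' \<inter> F e = {} \<Longrightarrow> col e' \<inter> F e = {}"
    and sub: "\<And>e. e \<in> E0 \<Longrightarrow> need e \<subseteq> col e" "\<And>e. e \<in> E0 \<Longrightarrow> card (need e) \<le> q"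
  shows "real (card E0) \<le> 20 * (2 * K) ^ q * (card U * real (card V) powr (1 / k))"
proof (cases "U = {}")
  case True
  then have "E0 = {}" using E0 edge by blast
  then show ?thesis by simp
next
  case False
  define p where "p = 1 / (2 * real K)"
  have p: "0 < p" "p \<le> 1" using K by (auto simp: p_def)
  define C where "C = (\<Union>e\<in>E. col e \<union> F e)"
  have C: "finite C" unfolding C_def using finite_E finite_col F by auto
  have fU: "finite U" using U finite_V finite_subset by auto
  then have cU: "card U \<ge> 1" using False by (simp add: Suc_leI card_gt_0_iff)
  \<comment> \<open>Inside a class the vertices are not sampled: with \<open>id\<close> telling all
    vertices apart and the size of \<open>U\<close> as \<open>L\<close>, this is the plain Moore
    bound for \<open>U\<close>.\<close>
  define B where "B = 5 * real (card U) powr (1 / k) * (card U + card (bipairs id U) / card U)"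
  have "real (card E0) * p ^ q / 2 \<le> (\<Sum>S\<in>Pow C. sample_weight p C S * B)"
    unfolding B_def
  proof (rule sampled_card[where W = "\<lambda>_. U" and need = need, OF E0(1) need sub _ U E0(2)])
    show "id x \<noteq> id y" if "e \<in> E0" "e = {x, y}" for e x y
      using that irreflexive[of x] E0(1) by auto
  qed (use cU C in \<open>auto simp: p_def C_def\<close>)
  also have "\<dots> = B"
    using sum_sample_weight[OF C, of "{}" "{}" p] by (simp flip: sum_distrib_right)
  also have "\<dots> \<le> 10 * (card U * real (card V) powr (1 / k))"
  proof -
    have "card (bipairs id U) \<le> card (U \<times> U)"
      unfolding bipairs_def using fU by (intro card_mono) auto
    then have "real (card (bipairs id U)) \<le> real (card U * card U)" by (simp only: card_cartesian_product
        of_nat_le_iff)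
    then have "card (bipairs id U) / card U \<le> real (card U)" using cU by (simp add: field_simps)
    \<comment> \<open>Passing to \<open>V\<close> leaves a bound that is linear in
      \<open>card U\<close> and can be summed over the classes.\<close>
    moreover have "real (card U) powr (1 / k) \<le> real (card V) powr (1 / k)"
      using U finite_V cU by (intro powr_mono2) (auto simp: card_mono)
    ultimately have "B \<le> 5 * real (card V) powr (1 / k) * (card U + card U)"
      unfolding B_def by (intro mult_mono add_mono) auto
    then show ?thesis by (simp add: mult_ac)
  qed
  finally show ?thesis using p K by (simp add: p_def field_simps power_divide)
qed

text \<open>An edge inside class \<open>c\<close> has color \<open>c\<close> and therefore does not
  delete it; so \<open>c\<close> and the dummy colors in \<open>D\<close> are left out of the colors
  to be kept. The classes are disjoint and their sizes add up to \<open>card V\<close>.\<close>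

lemma mono_card:
  fixes vc :: "'v \<Rightarrow> 'c"
  assumes vc: "\<And>e. e \<in> E \<Longrightarrow> vc ` e \<subseteq> col e" and D: "\<And>e. e \<in> E \<Longrightarrow> D \<inter> F e = {}"
    and q: "\<And>e c. e \<in> E \<Longrightarrow> vc ` e = {c} \<Longrightarrow> card (col e - D - {c}) \<le> q"
  shows "real (card {e \<in> E. \<exists>c. vc ` e = {c}}) \<le> 20 * (2 * K) ^ q * real (card V) powr (1 + 1 / k)"
proof -
  define U where "U c = {v \<in> V. vc v = c}" for c
  define M where "M c = {e \<in> E. vc ` e = {c}}" for c
  have "{e \<in> E. \<exists>c. vc ` e = {c}} \<subseteq> (\<Union>c\<in>vc ` V. M c)"
  proof
    fix e assume "e \<in> {e \<in> E. \<exists>c. vc ` e = {c}}"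
    then obtain c where c: "e \<in> E" "vc ` e = {c}" by auto
    then obtain u where "u \<in> V" "u \<in> e" using edge by blast
    then show "e \<in> (\<Union>c\<in>vc ` V. M c)" using c by (auto simp: M_def)
  qed
  then have "card {e \<in> E. \<exists>c. vc ` e = {c}} \<le> card (\<Union>c\<in>vc ` V. M c)"
    using finite_V finite_E by (intro card_mono) (auto simp: M_def)
  also have "\<dots> \<le> (\<Sum>c\<in>vc ` V. card (M c))" using finite_V by (intro card_UN_le) auto
  finally have "real (card {e \<in> E. \<exists>c. vc ` e = {c}}) \<le> (\<Sum>c\<in>vc ` V. real (card (M c)))"
    by (simp flip: of_nat_sum)
  also have "\<dots> \<le> (\<Sum>c\<in>vc ` V. 20 * (2 * K) ^ q * (card (U c) * real (card V) powr (1 / k)))"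
  proof (rule sum_mono)
    fix c
    show "real (card (M c)) \<le> 20 * (2 * K) ^ q * (card (U c) * real (card V) powr (1 / k))"
    proof (rule within_class_card[where need = "\<lambda>e. col e - D - {c}"])
      show "e \<subseteq> U c" if "e \<in> M c" for e
        using that edge[of e] by (auto simp: M_def U_def)
      show "col e' \<inter> F e = {}" if "e \<in> M c" "e' \<in> M c" "(col e' - D - {c}) \<inter> F e = {}" for e e'
      proof -
        have "c \<in> col e" using vc[of e] that by (auto simp: M_def)
        then have "c \<notin> F e" using F_col[of e] that by (auto simp: M_def)
        then show ?thesis using that D[of e] by (auto simp: M_def)
      qed
    qed (use q in \<open>auto simp: U_def M_def\<close>)
  qed
  also have "\<dots> = 20 * (2 * K) ^ q * ((\<Sum>c\<in>vc ` V. card (U c)) * real (card V) powr (1 / k))"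
    by (simp add: sum_distrib_left sum_distrib_right)
  also have "(\<Sum>c\<in>vc ` V. card (U c)) = card V"
    using sum.image_gen[OF finite_V, of "\<lambda>_. 1::nat" vc] by (simp add: U_def)
  also have "card V * real (card V) powr (1 / k) = real (card V) powr (1 + 1 / k)"
    by (cases "card V = 0") (auto simp: powr_add)
  finally show ?thesis .
qed

text \<open>\<open>D\<close> holds dummy colors, which are not paid for. Vertex colors lie outside
  \<open>D\<close> and are kept with every surviving edge, so survivors live on the vertices whose
  color is in the sample.\<close>

lemma bichromatic_card:
  fixes vc :: "'v \<Rightarrow> 'c"
  assumes vc: "\<And>e. e \<in> E \<Longrightarrow> vc ` e \<subseteq> col e" and D: "\<And>e. e \<in> E \<Longrightarrow> D \<inter> F e = {}"
    and vD: "\<And>v. v \<in> V \<Longrightarrow> vc v \<notin> D"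
    and q: "\<And>e. e \<in> E \<Longrightarrow> card (col e - D) \<le> q" "q \<ge> 2"
  shows "real (card {e \<in> E. \<nexists>c. vc ` e = {c}}) \<le>
    20 * (2 * real K) powr (real q - 1 - 1 / k) * real (card V) powr (1 + 1 / k)"
proof -
  define E0 where "E0 = {e \<in> E. \<nexists>c. vc ` e = {c}}"
  define n where "n = real (card V)"
  define p where "p = 1 / (2 * real K)"
  have p: "0 < p" "p \<le> 1" using K by (auto simp: p_def)
  have k0: "real k > 0" using k by simp
  have n0: "n \<ge> 0" by (simp add: n_def)
  have "real (card E0) \<le> 20 * (2 * real K) powr (real q - 1 - 1 / k) * n powr (1 + 1 / k)"
  proof (cases "p * n \<ge> 1")
    \<comment> \<open>With fewer than 2K vertices the choice L = p n would be below 1, but the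
      trivial bound n^2 suffices because q is at least 2.\<close>
    case False
    have "E0 \<subseteq> (\<lambda>(u, v). {u, v}) ` (V \<times> V)" using edge by (fastforce simp: E0_def)
    then have "card E0 \<le> card ((\<lambda>(u, v). {u, v}) ` (V \<times> V))" using finite_V by (intro card_mono) auto
    also have "\<dots> \<le> card (V \<times> V)" using finite_V by (intro card_image_le) auto
    finally have "real (card E0) \<le> n * n" unfolding n_def card_cartesian_product by (metis of_nat_le_iff of_nat_mult)
    also have "n * n = n powr (1 - 1 / k) * n powr (1 + 1 / k)"
      using n0 by (cases "n = 0") (auto simp flip: powr_add simp: power2_eq_square)
    also have "\<dots> \<le> (2 * real K) powr (real q - 1 - 1 / k) * n powr (1 + 1 / k)"
    proof (rule mult_right_mono)
      have nK: "n \<le> 2 * real K" using False K by (auto simp: p_def field_simps)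
      have "n powr (1 - 1 / k) \<le> (2 * real K) powr (1 - 1 / k)"
        using n0 nK k by (intro powr_mono2) auto
      also have "\<dots> \<le> (2 * real K) powr (real q - 1 - 1 / k)"
        using K q by (intro powr_mono) auto
      finally show "n powr (1 - 1 / k) \<le> (2 * real K) powr (real q - 1 - 1 / k)" .
    qed simp
    also have "\<dots> \<le> 20 * ((2 * real K) powr (real q - 1 - 1 / k) * n powr (1 + 1 / k))" by simp
    finally show ?thesis by simp
  next
    case True
    \<comment> \<open>The expected number of surviving vertices; this choice makes both terms of the
      bound at most \<open>L\<close> in expectation.\<close>
    define L where "L = p * n"
    define C where "C = (\<Union>e\<in>E. col e \<union> F e) \<union> vc ` V"
    have C: "finite C" unfolding C_def using finite_E finite_V finite_col F by auto
    define W where "W S = {v \<in> V. vc v \<in> S}" for S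
    let ?w = "sample_weight p C"
    have "real (card E0) * p ^ q / 2 \<le>
      (\<Sum>S\<in>Pow C. ?w S * (5 * L powr (1 / k) * (card (W S) + card (bipairs vc (W S)) / L)))"
    proof (rule sampled_card[where need = "\<lambda>e. col e - D"])
      show "vc x \<noteq> vc y" if "e \<in> E0" "e = {x, y}" for e x y using that by (auto simp: E0_def)
      show "e \<subseteq> W S" if "e \<in> E0" "col e - D \<subseteq> S" for e S
      proof
        fix x assume "x \<in> e"
        then have "x \<in> V" "vc x \<in> col e" using that edge[of e] vc[of e] by (auto simp: E0_def)
        then show "x \<in> W S" using vD[of x] that by (auto simp: W_def)
      qed
      show "col e' \<inter> F e = {}" if "e \<in> E0" "e' \<in> E0" "(col e' - D) \<inter> F e = {}" for e e'
        using that D[of e] by (auto simp: E0_def)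
    qed (use q True C in \<open>auto simp: E0_def W_def L_def p_def C_def\<close>)
    also have "\<dots> = 5 * L powr (1 / k) *
      ((\<Sum>S\<in>Pow C. ?w S * card (W S)) + (\<Sum>S\<in>Pow C. ?w S * card (bipairs vc (W S))) / L)"
      by (simp add: sum_distrib_left sum.distrib sum_divide_distrib algebra_simps)
    also have "(\<Sum>S\<in>Pow C. ?w S * card (W S)) = p * n"
    proof -
      have "(\<Sum>S\<in>Pow C. ?w S * card (W S)) = (\<Sum>S\<in>Pow C. \<Sum>v\<in>V. ?w S * of_bool ({vc v} \<subseteq> S \<and> S \<inter> {} = {}))"
        using finite_V by (intro sum.cong) (auto simp: W_def of_bool_def sum.If_cases Int_def simp flip:
            sum_distrib_left)
      also have "\<dots> = (\<Sum>v\<in>V. p)"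
        by (subst sum.swap, intro sum.cong refl, subst sum_sample_weight[OF C]) (auto simp: C_def)
      finally show ?thesis by (simp add: n_def)
    qed
    also have "(\<Sum>S\<in>Pow C. ?w S * card (bipairs vc (W S))) = p\<^sup>2 * card (bipairs vc V)"
    proof -
      have fb: "finite (bipairs vc V)" using finite_V finite_subset[of "bipairs vc V" "V \<times> V"] by (auto simp:
          bipairs_def)
      have bW: "bipairs vc (W S) = {x \<in> bipairs vc V. {vc (fst x), vc (snd x)} \<subseteq> S \<and> S \<inter> {} = {}}" for S
        by (auto simp: bipairs_def W_def)
      have "(\<Sum>S\<in>Pow C. ?w S * card (bipairs vc (W S))) = (\<Sum>S\<in>Pow C. \<Sum>x\<in>bipairs vc V.
          ?w S * of_bool ({vc (fst x), vc (snd x)} \<subseteq> S \<and> S \<inter> {} = {}))"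
        using fb unfolding bW
        by (intro sum.cong refl) (auto simp: of_bool_def sum.If_cases Int_def simp flip: sum_distrib_left)
      also have "\<dots> = (\<Sum>x\<in>bipairs vc V. \<Sum>S\<in>Pow C. ?w S * of_bool ({vc (fst x), vc (snd x)} \<subseteq> S \<and> S \<inter> {} = {}))"
        by (rule sum.swap)
      \<comment> \<open>Different colors are kept independently, so a pair survives with probability
        \<open>p ^ 2\<close>. Pairs inside a class would survive with probability \<open>p\<close>,
        which is why only bichromatic pairs are counted.\<close>
      also have "\<dots> = (\<Sum>x\<in>bipairs vc V. p\<^sup>2)"
        by (intro sum.cong refl, subst sum_sample_weight[OF C]) (auto simp: C_def bipairs_def power2_eq_square)
      finally show ?thesis by simp
    qed
    also have "5 * L powr (1 / k) * (p * n + p\<^sup>2 * card (bipairs vc V) / L) \<le> 5 * L powr (1 / k) * (L + L)"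
    proof (intro mult_left_mono add_mono)
      have "card (bipairs vc V) \<le> card (V \<times> V)"
        unfolding bipairs_def using finite_V by (intro card_mono) auto
      then have "real (card (bipairs vc V)) \<le> n * n"
        unfolding n_def card_cartesian_product by (metis of_nat_le_iff of_nat_mult)
      then have "p\<^sup>2 * card (bipairs vc V) \<le> p\<^sup>2 * (n * n)" by (intro mult_left_mono) auto
      also have "\<dots> = L * L" by (simp add: L_def power2_eq_square)
      finally show "p\<^sup>2 * card (bipairs vc V) / L \<le> L" using True by (simp add: L_def field_simps)
    qed (auto simp: L_def)
    also have "5 * L powr (1 / k) * (L + L) = 10 * L powr (1 + 1 / k)"
      using True by (simp add: powr_add L_def)
    finally have "real (card E0) * p ^ q \<le> 20 * (p powr (1 + 1 / k) * n powr (1 + 1 / k))"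
      using p n0 by (simp add: L_def powr_mult)
    then have "real (card E0) \<le> 20 * (p powr (1 + 1 / k) * n powr (1 + 1 / k)) / p ^ q"
      using p by (simp add: field_simps)
    also have "p ^ q = p powr real q" using p by (simp add: powr_realpow)
    also have "20 * (p powr (1 + 1 / k) * n powr (1 + 1 / k)) / p powr real q
      = 20 * p powr (1 + 1 / k - real q) * n powr (1 + 1 / k)"
      using p by (simp add: powr_diff)
    also have "p powr (1 + 1 / k - real q) = (2 * real K) powr (real q - 1 - 1 / k)"
    proof -
      have "p = (2 * real K) powr (- 1)" using K by (simp add: p_def powr_minus field_simps)
      then have "p powr (1 + 1 / k - real q) = (2 * real K) powr (- 1 * (1 + 1 / k - real q))"
        by (simp only: powr_powr)
      then show ?thesis by (simp add: algebra_simps)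
    qed
    finally show ?thesis .
  qed
  then show ?thesis by (simp add: E0_def n_def)
qed

end

section \<open>Spanners from detours of single edges\<close>

lemma walk_append:
  assumes "walk X p" "walk X q" "last p = hd q"
  shows "walk X (p @ tl q) \<and> hd (p @ tl q) = hd p \<and> last (p @ tl q) = last q \<and>
    walk_length X (p @ tl q) = walk_length X p + walk_length X q"
  using assms
proof (induction p rule: induct_list012)
  case (2 u)
  then show ?case by (cases q) auto
next
  case (3 u v p)
  then show ?case by auto
qed auto

lemma reach_walk:
  assumes "reach E l u v" "E \<subseteq> edges X" "\<And>e. e \<in> E \<Longrightarrow> e \<subseteq> verts X" "u \<in> verts X"
    "\<And>e. e \<in> E \<Longrightarrow> weight X e \<le> w" "0 \<le> w"
  shows "\<exists>p. walk X p \<and> hd p = u \<and> last p = v \<and> walk_length X p \<le> real l * w"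
  using assms
proof (induction E l u v rule: reach.induct)
  case (1 E x y)
  then show ?case by (intro exI[of _ "[x]"]) auto
next
  case (2 E l x y)
  show ?case
  proof (cases "x = y")
    case True
    then show ?thesis using 2 by (intro exI[of _ "[x]"]) auto
  next
    case False
    then obtain z where z: "{x, z} \<in> E" "reach E l z y" using 2(2) by auto
    then obtain p where p: "walk X p" "hd p = z" "last p = y" "walk_length X p \<le> real l * w"
      using 2(1)[of z] 2 by blast
    then obtain p' where p': "p = z # p'" by (cases p) auto
    have "weight X {x, z} \<le> w" using 2 z by auto
    then have "walk_length X (x # p) \<le> real (Suc l) * w" using p(4) p' by (simp add: algebra_simps)
    moreover have "walk X (x # p)" using p p' z 2(3,5) by auto
    ultimately show ?thesis using p p' by (intro exI[of _ "x # p"]) auto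
  qed
qed

text \<open>The factor is moved to the other side so that the infimum on the right can be treated
  walk by walk; without any walk in \<open>G\<close> it is infinite and there is nothing to
  show.\<close>

lemma gdist_stretch:
  assumes t: "0 < t"
    and "\<And>p. walk G p \<Longrightarrow> hd p = u \<Longrightarrow> last p = v \<Longrightarrow>
      \<exists>q. walk H q \<and> hd q = u \<and> last q = v \<and> walk_length H q \<le> t * walk_length G p"
  shows "gdist H u v \<le> ereal t * gdist G u v"
proof -
  have "gdist H u v / ereal t \<le> gdist G u v"
    unfolding gdist_def[of G]
  proof (rule INF_greatest)
    fix p assume "p \<in> {p. walk G p \<and> hd p = u \<and> last p = v}"
    then obtain q where q: "walk H q" "hd q = u" "last q = v" "walk_length H q \<le> t * walk_length G p"
      using assms(2) by blast
    have "gdist H u v \<le> ereal (walk_length H q)" unfolding gdist_def using q by (intro INF_lower) auto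
    also have "\<dots> \<le> ereal t * ereal (walk_length G p)" using q by simp
    finally show "gdist H u v / ereal t \<le> ereal (walk_length G p)"
      using t by (simp add: ereal_divide_le_pos)
  qed
  then show ?thesis using t by (simp add: ereal_divide_le_pos)
qed

lemma walk_stretch:
  assumes edge: "\<And>u v. {u, v} \<in> edges G \<Longrightarrow> u \<in> verts G \<Longrightarrow>
      \<exists>q. walk H q \<and> hd q = u \<and> last q = v \<and> walk_length H q \<le> t * weight G {u, v}"
    and "verts G \<subseteq> verts H" "walk G p"
  shows "\<exists>q. walk H q \<and> hd q = hd p \<and> last q = last p \<and> walk_length H q \<le> t * walk_length G p"
  using assms(3)
proof (induction p rule: induct_list012)
  case (2 u)
  then show ?case using assms(2) by (intro exI[of _ "[u]"]) auto
next
  case (3 u v p)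
  then obtain q where q: "walk H q" "hd q = v" "last q = last (v # p)" "walk_length H q \<le> t * walk_length G (v # p)"
    by auto
  obtain q' where q': "walk H q'" "hd q' = u" "last q' = v" "walk_length H q' \<le> t * weight G {u, v}"
    using edge[of u v] 3 by auto
  have "walk H (q' @ tl q) \<and> hd (q' @ tl q) = u \<and> last (q' @ tl q) = last q \<and>
    walk_length H (q' @ tl q) = walk_length H q' + walk_length H q"
    using walk_append[OF q'(1) q(1)] q q' by simp
  then show ?case using q(3,4) q'(4) by (intro exI[of _ "q' @ tl q"]) (auto simp: algebra_simps)
qed auto

text \<open>Replacing every edge of a surviving walk by its own detour multiplies the length by at
  most 2k - 1, as a detour has at most that many edges, none heavier than the edge replaced. So only
  single edges have to be checked.\<close>

lemma cft_spannerI: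
  assumes wf: "wf_cgraph G" and H: "H = G\<lparr>edges := EH\<rparr>" "EH \<subseteq> edges G" and k: "k \<ge> 1"
    and key: "\<And>u v Fs. {u, v} \<in> edges G \<Longrightarrow> finite Fs \<Longrightarrow> card Fs \<le> f \<Longrightarrow>
      edge_colors (coloring G) {u, v} \<inter> Fs = {} \<Longrightarrow>
      reach {e \<in> EH. edge_colors (coloring G) e \<inter> Fs = {} \<and> weight G e \<le> weight G {u, v}} (2 * k - 1) u v"
  shows "cft_spanner f (2 * real k - 1) H G"
proof -
  have sub: "\<Union> EH \<subseteq> verts G" using wf H(2) by (fastforce simp: wf_cgraph_def)
  have t: "2 * real k - 1 = real (2 * k - 1)" using k by (simp add: of_nat_diff)
  have "spanner (2 * real k - 1) (delete_colors H Fs) (delete_colors G Fs)"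
    if Fs: "finite Fs" "card Fs \<le> f" for Fs
    unfolding spanner_def
  proof (intro conjI ballI)
    show "subgraph (delete_colors H Fs) (delete_colors G Fs)"
      using sub H by (auto simp: subgraph_def delete_colors_def)
    fix u v
    show "gdist (delete_colors H Fs) u v \<le> ereal (2 * real k - 1) * gdist (delete_colors G Fs) u v"
    proof (rule gdist_stretch)
      show "0 < 2 * real k - 1" using k by simp
      fix p assume p: "walk (delete_colors G Fs) p" "hd p = u" "last p = v"
      have "\<exists>q. walk (delete_colors H Fs) q \<and> hd q = hd p \<and> last q = last p \<and>
        walk_length (delete_colors H Fs) q \<le> (2 * real k - 1) * walk_length (delete_colors G Fs) p"
      proof (rule walk_stretch[OF _ _ p(1)])
        fix x y assume xy: "{x, y} \<in> edges (delete_colors G Fs)" "x \<in> verts (delete_colors G Fs)"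
        then have xyG: "{x, y} \<in> edges G" "edge_colors (coloring G) {x, y} \<inter> Fs = {}" "x \<in> verts G"
          by (auto simp: delete_colors_def)
        have "0 \<le> weight G {x, y}" using wf xyG unfolding wf_cgraph_def by (metis less_imp_le)
        then have "\<exists>p. walk (delete_colors H Fs) p \<and> hd p = x \<and> last p = y \<and>
          walk_length (delete_colors H Fs) p \<le> real (2 * k - 1) * weight G {x, y}"
          using sub xyG by (intro reach_walk[OF key[OF xyG(1) Fs xyG(2)]]) (auto simp: delete_colors_def H)
        then show "\<exists>q. walk (delete_colors H Fs) q \<and> hd q = x \<and> last q = y \<and>
          walk_length (delete_colors H Fs) q \<le> (2 * real k - 1) * weight (delete_colors G Fs) {x, y}"
          unfolding t by (simp add: delete_colors_def)
      qed (auto simp: delete_colors_def H)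
      then show "\<exists>q. walk (delete_colors H Fs) q \<and> hd q = u \<and> last q = v \<and>
        walk_length (delete_colors H Fs) q \<le> (2 * real k - 1) * walk_length (delete_colors G Fs) p"
        using p by simp
    qed
  qed
  moreover have "subgraph H G" using sub H by (auto simp: subgraph_def)
  ultimately show ?thesis by (simp add: cft_spanner_def)
qed

section \<open>Weakest preconditions with running time\<close>

text \<open>Total correctness with the running time passed to the postcondition. The machine is
  deterministic, so on straight-line code this becomes an equivalence that the simplifier can
  execute with exact costs.\<close>

definition wp :: "com \<Rightarrow> (nat \<Rightarrow> state \<Rightarrow> bool) \<Rightarrow> state \<Rightarrow> bool" where
  "wp P Q \<sigma> \<longleftrightarrow> (\<exists>T \<sigma>'. runs P \<sigma> T \<sigma>' \<and> Q T \<sigma>')"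

lemma wp_iff: "runs P \<sigma> T \<sigma>' \<Longrightarrow> wp P Q \<sigma> \<longleftrightarrow> Q T \<sigma>'"
  unfolding wp_def using runs_deterministic by blast

lemmas wp_Skip = wp_iff[OF runs_Skip]
  and wp_Assign = wp_iff[OF runs_Assign]
  and wp_Store = wp_iff[OF runs_Store]

lemma wp_Seq: "wp (Seq P R) Q \<sigma> \<longleftrightarrow> wp P (\<lambda>T \<sigma>'. wp R (\<lambda>U. Q (T + U)) \<sigma>') \<sigma>"
  unfolding wp_def by (blast intro: runs_Seq elim: runs_SeqE)

lemma runs_If_iff: "runs (If b P R) \<sigma> T \<sigma>' \<longleftrightarrow>
    (\<exists>U. T = 1 + bcost b + U \<and> runs (if bval b \<sigma> then P else R) \<sigma> U \<sigma>')"
proof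
  assume "runs (If b P R) \<sigma> T \<sigma>'"
  then show "\<exists>U. T = 1 + bcost b + U \<and> runs (if bval b \<sigma> then P else R) \<sigma> U \<sigma>'"
    by (rule runs_IfE) auto
next
  assume "\<exists>U. T = 1 + bcost b + U \<and> runs (if bval b \<sigma> then P else R) \<sigma> U \<sigma>'"
  then show "runs (If b P R) \<sigma> T \<sigma>'"
    by (metis runs_IfTrue runs_IfFalse)
qed

lemma wp_If: "wp (If b P R) Q \<sigma> \<longleftrightarrow>
    (if bval b \<sigma> then wp P (\<lambda>T. Q (1 + bcost b + T)) \<sigma> else wp R (\<lambda>T. Q (1 + bcost b + T)) \<sigma>)"
  unfolding wp_def runs_If_iff by (cases "bval b \<sigma>") (simp; blast)+

lemmas wp_simps = wp_Skip wp_Assign wp_Store wp_Seq wp_If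

lemma wp_mono: "wp P Q \<sigma> \<Longrightarrow> (\<And>T \<sigma>'. Q T \<sigma>' \<Longrightarrow> Q' T \<sigma>') \<Longrightarrow> wp P Q' \<sigma>"
  unfolding wp_def by blast

text \<open>The time spent so far is an argument of the invariant, so it may be bounded by
  quantities that are only known at the end; \<open>\<mu>\<close> separately ensures
  termination.\<close>

lemma wp_While_time:
  assumes "J 0 \<sigma>"
    and step: "\<And>T \<sigma>. J T \<sigma> \<Longrightarrow> bval b \<sigma> \<Longrightarrow>
      wp P (\<lambda>U \<sigma>'. J (T + 1 + bcost b + U) \<sigma>' \<and> \<mu> \<sigma>' < (\<mu> \<sigma> :: nat)) \<sigma>"
    and final: "\<And>T \<sigma>. J T \<sigma> \<Longrightarrow> \<not> bval b \<sigma> \<Longrightarrow> Q (T + 1 + bcost b) \<sigma>"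
  shows "wp (While b P) Q \<sigma>"
proof -
  have "\<exists>T' \<sigma>'. runs (While b P) \<sigma> T' \<sigma>' \<and> Q (T + T') \<sigma>'" if "J T \<sigma>" for T \<sigma>
    using that
  proof (induction "\<mu> \<sigma>" arbitrary: T \<sigma> rule: less_induct)
    case less
    show ?case
    proof (cases "bval b \<sigma>")
      case True
      then obtain U \<sigma>' where U: "runs P \<sigma> U \<sigma>'" "J (T + 1 + bcost b + U) \<sigma>'" "\<mu> \<sigma>' < \<mu> \<sigma>"
        using step[OF less.prems] by (auto simp: wp_def)
      then obtain T' \<sigma>'' where "runs (While b P) \<sigma>' T' \<sigma>''" "Q (T + 1 + bcost b + U + T') \<sigma>''"
        using less.hyps by blast
      then show ?thesis using runs_WhileTrue[OF True U(1)]
        by (intro exI[of _ "1 + bcost b + U + T'"] exI[of _ \<sigma>'']) (simp add: ac_simps)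
    next
      case False
      then show ?thesis using runs_WhileFalse[OF False] final[OF less.prems False]
        by (intro exI[of _ "1 + bcost b"] exI[of _ \<sigma>]) simp
    qed
  qed
  then show ?thesis using assms(1) unfolding wp_def by (metis add_0)
qed

text \<open>Amortized form: \<open>pot\<close> pays for the body and for the test of the guard.
  Since a test costs at least one step, the potential decreases and termination comes for
  free.\<close>

lemma wp_While:
  assumes "I \<sigma>"
    and step: "\<And>\<sigma>. I \<sigma> \<Longrightarrow> bval b \<sigma> \<Longrightarrow> wp P (\<lambda>T \<sigma>'. I \<sigma>' \<and> 1 + bcost b + T + pot \<sigma>' \<le> pot \<sigma>) \<sigma>"
    and final: "\<And>T \<sigma>'. I \<sigma>' \<Longrightarrow> \<not> bval b \<sigma>' \<Longrightarrow> T \<le> pot \<sigma> + 1 + bcost b \<Longrightarrow> Q T \<sigma>'"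
  shows "wp (While b P) Q \<sigma>"
proof (rule wp_While_time[where J = "\<lambda>T \<sigma>'. I \<sigma>' \<and> T + pot \<sigma>' \<le> pot \<sigma>" and \<mu> = pot])
  fix T \<sigma>' assume "I \<sigma>' \<and> T + pot \<sigma>' \<le> pot \<sigma>" "bval b \<sigma>'"
  then show "wp P (\<lambda>U \<sigma>''. (I \<sigma>'' \<and> T + 1 + bcost b + U + pot \<sigma>'' \<le> pot \<sigma>) \<and> pot \<sigma>'' < pot \<sigma>') \<sigma>'"
    using step[of \<sigma>'] by (elim conjE) (rule wp_mono[where Q = "\<lambda>T \<sigma>''. I \<sigma>'' \<and> 1 + bcost b + T +
        pot \<sigma>'' \<le> pot \<sigma>'"], auto)
qed (use assms in auto)

definition frame :: "string set \<Rightarrow> string set \<Rightarrow> state \<Rightarrow> state \<Rightarrow> bool" where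
  "frame R A \<sigma> \<sigma>' \<longleftrightarrow> (\<forall>x. x \<notin> R \<longrightarrow> reg \<sigma>' x = reg \<sigma> x) \<and> (\<forall>x. x \<notin> A \<longrightarrow> arr \<sigma>' x = arr \<sigma> x) \<and> rarr \<sigma>' = rarr \<sigma>"

lemma frame_refl: "frame R A \<sigma> \<sigma>"
  by (simp add: frame_def)

lemma frame_trans: "frame R A \<sigma> \<sigma>' \<Longrightarrow> frame R' A' \<sigma>' \<sigma>'' \<Longrightarrow> R \<subseteq> S \<Longrightarrow> R' \<subseteq> S \<Longrightarrow> A \<subseteq> D \<Longrightarrow> A' \<subseteq> D \<Longrightarrow> frame S D \<sigma> \<sigma>''"
  unfolding frame_def by (metis subsetD)

lemma frame_reg: "frame R A \<sigma> \<sigma>' \<Longrightarrow> x \<notin> R \<Longrightarrow> reg \<sigma>' x = reg \<sigma> x"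
  and frame_arr: "frame R A \<sigma> \<sigma>' \<Longrightarrow> x \<notin> A \<Longrightarrow> arr \<sigma>' x = arr \<sigma> x"
  and frame_rarr: "frame R A \<sigma> \<sigma>' \<Longrightarrow> rarr \<sigma>' = rarr \<sigma>"
  by (auto simp: frame_def)

text \<open>The singleton case avoids a final \<open>Skip\<close>, which would cost a step.\<close>

fun seq :: "com list \<Rightarrow> com" where
  "seq [] = Skip"
| "seq [P] = P"
| "seq (P # Q # Ps) = Seq P (seq (Q # Ps))"

section \<open>Breadth-first search in the surviving graph\<close>

text \<open>
  Arrays are never reset: a color is deleted if its entry in \<open>mark\<close> equals the stamp \<open>d\<close>, and a vertex is
  visited if its entry in \<open>vis\<close> equals the stamp \<open>g\<close>.
\<close>

definition unmarked :: "aexp \<Rightarrow> bexp" where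
  "unmarked c = Less (Arr ''mark'' c) (Reg ''d'')"

text \<open>The registers \<open>a\<close> and \<open>b\<close> hold shifts of 0 or 1 that free
  color 0 as a dummy for the settings without edge colors or without vertex colors.\<close>

definition edge_color :: "aexp \<Rightarrow> aexp" where
  "edge_color i = Plus (Arr ''ecol'' i) (Reg ''a'')"

definition end_color :: "string \<Rightarrow> aexp \<Rightarrow> aexp" where
  "end_color x i = Plus (Arr ''vcol'' (Arr x i)) (Reg ''b'')"

definition alive_edge :: "aexp \<Rightarrow> bexp" where
  "alive_edge i = Conj (unmarked (edge_color i)) (Conj (unmarked (end_color ''u'' i)) (unmarked (end_color ''v'' i)))"

definition visit :: com where
  "visit = seq [
     Store ''vis'' (Reg ''z'') (Reg ''g''),
     Store ''hop'' (Reg ''z'') (Plus (Arr ''hop'' (Reg ''o'')) (Num 1)),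
     Store ''par'' (Reg ''z'') (Reg ''o''),
     Store ''pe'' (Reg ''z'') (Reg ''j''),
     Store ''queue'' (Reg ''l'') (Reg ''z''),
     Assign ''l'' (Plus (Reg ''l'') (Num 1))]"

definition scan_cell :: com where
  "scan_cell = seq [
     Assign ''j'' (Arr ''cell'' (Reg ''e'')),
     Assign ''z'' (Arr ''to'' (Reg ''e'')),
     If (Conj (Less (Arr ''vis'' (Reg ''z'')) (Reg ''g'')) (alive_edge (Reg ''j''))) visit Skip,
     Assign ''e'' (Arr ''next'' (Reg ''e''))]"

definition scan :: com where
  "scan = While (Less (Num 0) (Reg ''e'')) scan_cell"

text \<open>Vertices at depth 2k - 1 are not expanded; adding \<open>k\<close> to itself stands in
  for a multiplication.\<close>

definition bfs_vertex :: com where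
  "bfs_vertex = seq [
       Assign ''o'' (Arr ''queue'' (Reg ''h'')),
       Assign ''h'' (Plus (Reg ''h'') (Num 1)),
       If (Less (Plus (Arr ''hop'' (Reg ''o'')) (Num 1)) (Plus (Reg ''k'') (Reg ''k'')))
         (Seq (Assign ''e'' (Arr ''head'' (Reg ''o''))) scan) Skip]"

definition bfs :: com where
  "bfs = seq [
     Assign ''g'' (Plus (Reg ''g'') (Num 1)),
     Store ''vis'' (Reg ''p'') (Reg ''g''),
     Store ''hop'' (Reg ''p'') (Num 0),
     Store ''queue'' (Num 0) (Reg ''p''),
     Assign ''h'' (Num 0),
     Assign ''l'' (Num 1),
     While (Less (Reg ''h'') (Reg ''l'')) bfs_vertex]"

section \<open>Combinatorial data behind the search\<close>

locale greedy_input =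
  fixes U V ecol vcol :: "nat \<Rightarrow> nat" and W :: "nat \<Rightarrow> real" and m k f a b :: nat
  assumes k1: "k \<ge> 1"
begin

definition ed :: "nat \<Rightarrow> nat set" where
  "ed i = {U i, V i}"

definition col :: "nat \<Rightarrow> nat set" where
  "col i = {ecol i + a, vcol (U i) + b, vcol (V i) + b}"

definition alive :: "nat set \<Rightarrow> nat set \<Rightarrow> nat set set" where
  "alive I F = ed ` {i \<in> I. col i \<inter> F = {}}"

definition env :: "state \<Rightarrow> bool" where
  "env \<sigma> \<longleftrightarrow> reg \<sigma> ''m'' = m \<and> reg \<sigma> ''k'' = k \<and> reg \<sigma> ''f'' = f \<and> reg \<sigma> ''a'' = a \<and> reg \<sigma> ''b'' = b \<and>
     arr \<sigma> ''u'' = U \<and> arr \<sigma> ''v'' = V \<and> arr \<sigma> ''ecol'' = ecol \<and> arr \<sigma> ''vcol'' = vcol \<and> rarr \<sigma> ''w'' = W"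

text \<open>
  Adjacency lists: a cell \<open>c \<ge> 1\<close> is the edge \<open>ce c\<close> directed towards \<open>to c\<close>. The list of a vertex \<open>x\<close> runs
  through all cells with tail \<open>x\<close> in decreasing order, from \<open>first x\<close> along \<open>nx\<close>, and 0 ends it.
\<close>

definition tail :: "(nat \<Rightarrow> nat) \<Rightarrow> (nat \<Rightarrow> nat) \<Rightarrow> nat \<Rightarrow> nat" where
  "tail ce to c = U (ce c) + V (ce c) - to c"

definition cells :: "nat set \<Rightarrow> nat \<Rightarrow> (nat \<Rightarrow> nat) \<Rightarrow> (nat \<Rightarrow> nat) \<Rightarrow> (nat \<Rightarrow> nat) \<Rightarrow> (nat \<Rightarrow> nat) \<Rightarrow> bool" where
  "cells I cn ce to nx first \<longleftrightarrow>
     (\<forall>c \<in> {1..cn}. ce c \<in> I \<and> (to c = U (ce c) \<or> to c = V (ce c)) \<and> nx c < c \<and>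
        (nx c = 0 \<or> tail ce to (nx c) = tail ce to c) \<and>
        (\<forall>c' \<in> {nx c<..<c}. tail ce to c' \<noteq> tail ce to c)) \<and>
     (\<forall>i \<in> I. (\<exists>c \<in> {1..cn}. ce c = i \<and> to c = U i) \<and> (\<exists>c \<in> {1..cn}. ce c = i \<and> to c = V i)) \<and>
     (\<forall>x. first x \<le> cn \<and> (first x = 0 \<or> tail ce to (first x) = x) \<and> (\<forall>c' \<in> {first x<..cn}. tail ce to c' \<noteq> x))"

text \<open>Strictly falling depths make retracing end at the root after \<open>hop\<close> edges;
  the order of depths along the queue keeps a newly found vertex from being shallower than an entry
  before it.\<close>

definition tree where
  "tree I F p g l Q vis hop par pe \<longleftrightarrow>
     inj_on Q {..<l} \<and> (\<forall>y. vis y \<le> g) \<and> (\<forall>y. vis y = g \<longleftrightarrow> y \<in> Q ` {..<l}) \<and> vis p = g \<and> hop p = (0::nat) \<and>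
     (\<forall>y. vis y = (g::nat) \<longrightarrow> hop y \<le> 2 * k - 1 \<and> (hop y = 0 \<longrightarrow> y = p) \<and>
       (0 < hop y \<longrightarrow> pe y \<in> I \<and> col (pe y) \<inter> F = {} \<and> ed (pe y) = {par y, y} \<and> vis (par y) = g \<and>
           hop y = Suc (hop (par y)))) \<and>
     (\<forall>i j. i \<le> j \<longrightarrow> j < l \<longrightarrow> hop (Q i) \<le> hop (Q j))"

text \<open>Vertices at depth 2k - 1 are exempt because the search stops there. The bound on
  \<open>hop z\<close> also covers neighbors found earlier, as completeness requires.\<close>

definition settled where
  "settled I F g h Q vis hop \<longleftrightarrow> (\<forall>i<(h::nat). hop (Q i) < 2 * k - 1 \<longrightarrow>
     (\<forall>j \<in> I. \<forall>z. col j \<inter> F = {} \<longrightarrow> ed j = {Q i, z} \<longrightarrow> vis z = (g::nat) \<and> hop z \<le> Suc (hop (Q i))))"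

lemma tree_visit:
  assumes T: "tree I F p g l Q vis hop par pe" and o: "vis o' = g" "hop o' < 2 * k - 1"
    and z: "vis z \<noteq> g" and j: "j \<in> I" "col j \<inter> F = {}" "ed j = {o', z}"
    and le: "\<And>i. i < l \<Longrightarrow> hop (Q i) \<le> Suc (hop o')"
  shows "tree I F p g (Suc l) (Q(l := z)) (vis(z := g)) (hop(z := Suc (hop o'))) (par(z := o')) (pe(z := j))"
proof -
  have zQ: "z \<notin> Q ` {..<l}" using T z by (auto simp: tree_def)
  have "inj_on (Q(l := z)) {..<Suc l}"
    using T zQ by (auto simp: tree_def inj_on_def less_Suc_eq)
  moreover have "(Q(l := z)) ` {..<Suc l} = insert z (Q ` {..<l})"
    by (auto simp: lessThan_Suc image_iff)
  moreover have "(hop(z := Suc (hop o'))) ((Q(l := z)) i) \<le> (hop(z := Suc (hop o'))) ((Q(l := z)) j)"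
    if "i \<le> j" "j < Suc l" for i j
    using that T zQ le by (auto simp: tree_def less_Suc_eq)
  moreover have "z \<noteq> p" "z \<noteq> o'" using T o z by (auto simp: tree_def)
  ultimately show ?thesis using T o z j by (auto simp: tree_def)
qed

lemma settled_visit:
  assumes T: "tree I F p g l Q vis hop par pe" and S: "settled I F g h Q vis hop" and "h \<le> l" "vis z \<noteq> g"
  shows "settled I F g h (Q(l := z)) (vis(z := g)) (hop(z := Suc (hop o')))"
proof -
  have "Q i \<noteq> z" if "i < l" for i using T assms(4) that by (auto simp: tree_def)
  then have q: "(Q(l := z)) i = Q i \<and> Q i \<noteq> z" if "i < h" for i
    using less_le_trans[OF that \<open>h \<le> l\<close>] by auto
  have "vis y = g \<and> hop y \<le> Suc (hop (Q i))"
    if "i < h" "hop (Q i) < 2 * k - 1" "j \<in> I" "col j \<inter> F = {}" "ed j = {Q i, y}" for i j y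
    using S that unfolding settled_def by blast
  then show ?thesis using q assms(4) unfolding settled_def by fastforce
qed

text \<open>Each step of a walk uses up one unit of the remaining length and raises the depth by at
  most one, so \<open>hop x + d \<le> 2 * k - 1\<close> is preserved and the current vertex is
  shallow enough to have been expanded.\<close>

lemma settled_complete:
  assumes T: "tree I F p g l Q vis hop par pe" and S: "settled I F g l Q vis hop"
  shows "reach (alive I F) d x y \<Longrightarrow> vis x = g \<Longrightarrow> hop x + d \<le> 2 * k - 1 \<Longrightarrow> vis y = g"
proof (induction d arbitrary: x)
  case (Suc d)
  show ?case
  proof (cases "x = y")
    case False
    then obtain z where z: "{x, z} \<in> alive I F" "reach (alive I F) d z y" using Suc.prems by auto
    obtain i where "i < l" "x = Q i" using T Suc.prems(2) by (auto simp: tree_def)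
    moreover obtain j where "j \<in> I" "col j \<inter> F = {}" "ed j = {x, z}" using z(1) by (auto simp: alive_def)
    ultimately have "vis z = g \<and> hop z \<le> Suc (hop x)" using S Suc.prems(3) by (auto simp: settled_def)
    then show ?thesis using Suc.IH[OF z(2)] Suc.prems(3) by auto
  qed (use Suc in auto)
qed auto

lemma cellsD:
  assumes "cells I cn ce to nx first" "c \<in> {1..cn}"
  shows "ce c \<in> I" "to c = U (ce c) \<or> to c = V (ce c)" "nx c < c"
    "nx c = 0 \<or> tail ce to (nx c) = tail ce to c"
    "nx c < c' \<Longrightarrow> c' < c \<Longrightarrow> tail ce to c' \<noteq> tail ce to c"
  using assms unfolding cells_def by (simp_all del: One_nat_def)

text \<open>\<open>to c\<close> is one end of the edge, so subtracting it from the sum of both ends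
  leaves the other.\<close>

lemma ed_tail:
  assumes "cells I cn ce to nx first" "c \<in> {1..cn}"
  shows "ed (ce c) = {tail ce to c, to c}"
  using cellsD(2)[OF assms] by (auto simp: ed_def tail_def)

text \<open>A \<open>next\<close> pointer skips only cells of other vertices, so the count drops by
  exactly one; it serves as the potential of a scan.\<close>

lemma tail_next:
  assumes C: "cells I cn ce to nx first" and c: "c \<in> {1..cn}"
  shows "card {i \<in> {1..c}. tail ce to i = tail ce to c} = Suc (card {i \<in> {1..nx c}. tail ce to i = tail ce to c})"
proof -
  have n: "nx c < c" "\<forall>c' \<in> {nx c<..<c}. tail ce to c' \<noteq> tail ce to c" using cellsD(3,5)[OF C c] by auto
  have "{i \<in> {1..c}. tail ce to i = tail ce to c} = insert c {i \<in> {1..nx c}. tail ce to i = tail ce to c}"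
    using n c by (fastforce simp: not_less)
  then show ?thesis using n by simp
qed

section \<open>The search loops on the machine\<close>

definition graph_state :: "nat set \<Rightarrow> nat set \<Rightarrow> state \<Rightarrow> bool" where
  "graph_state I F \<sigma> \<longleftrightarrow> env \<sigma> \<and>
     cells I (reg \<sigma> ''c'') (arr \<sigma> ''cell'') (arr \<sigma> ''to'') (arr \<sigma> ''next'') (arr \<sigma> ''head'') \<and>
     (\<forall>c. arr \<sigma> ''mark'' c \<le> reg \<sigma> ''d'') \<and> F = {c. arr \<sigma> ''mark'' c = reg \<sigma> ''d''}"

abbreviation bfs_regs :: "string set" where
  "bfs_regs \<equiv> {''g'', ''h'', ''l'', ''o'', ''e'', ''j'', ''z''}"

abbreviation bfs_arrs :: "string set" where
  "bfs_arrs \<equiv> {''vis'', ''hop'', ''par'', ''pe'', ''queue''}"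

lemma graph_state_frame:
  assumes "frame R A \<sigma> \<sigma>'" "R \<subseteq> bfs_regs" "A \<subseteq> bfs_arrs"
  shows "graph_state I F \<sigma>' = graph_state I F \<sigma>"
proof -
  have r: "reg \<sigma>' x = reg \<sigma> x" if "x \<notin> bfs_regs" for x using assms that unfolding frame_def by blast
  have a: "arr \<sigma>' x = arr \<sigma> x" if "x \<notin> bfs_arrs" for x using assms that unfolding frame_def by blast
  show ?thesis using frame_rarr[OF assms(1)] by (simp add: graph_state_def env_def r a)
qed

definition btree :: "nat set \<Rightarrow> nat set \<Rightarrow> state \<Rightarrow> bool" where
  "btree I F \<sigma> \<longleftrightarrow> tree I F (reg \<sigma> ''p'') (reg \<sigma> ''g'') (reg \<sigma> ''l'')
     (arr \<sigma> ''queue'') (arr \<sigma> ''vis'') (arr \<sigma> ''hop'') (arr \<sigma> ''par'') (arr \<sigma> ''pe'')"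

definition bsettled :: "nat set \<Rightarrow> nat set \<Rightarrow> nat \<Rightarrow> state \<Rightarrow> bool" where
  "bsettled I F h \<sigma> \<longleftrightarrow> settled I F (reg \<sigma> ''g'') h (arr \<sigma> ''queue'') (arr \<sigma> ''vis'') (arr \<sigma> ''hop'')"

text \<open>Marks never exceed the stamp \<open>d\<close>, so being smaller is the same as being
  different.\<close>

lemma alive_edge_iff:
  assumes "graph_state I F \<sigma>" "aval i \<sigma> = j"
  shows "bval (alive_edge i) \<sigma> \<longleftrightarrow> col j \<inter> F = {}"
  using assms
  by (auto simp: alive_edge_def unmarked_def edge_color_def end_color_def graph_state_def env_def col_def nat_less_le)

abbreviation tl_of :: "state \<Rightarrow> nat \<Rightarrow> nat" where
  "tl_of \<sigma> \<equiv> tail (arr \<sigma> ''cell'') (arr \<sigma> ''to'')"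

text \<open>The list runs through the cells in decreasing order, so those above the current
  \<open>e\<close> are done. The final conjunct charges each new queue entry to a scanned cell,
  which bounds the growth of the queue by the degree.\<close>

definition scan_inv where
  "scan_inv I F h \<sigma> \<sigma>' \<longleftrightarrow>
     frame {''e'', ''j'', ''z'', ''l''} bfs_arrs \<sigma> \<sigma>' \<and> btree I F \<sigma>' \<and> bsettled I F h \<sigma>' \<and>
     (let o' = reg \<sigma> ''o''; R = (\<lambda>e. card {c \<in> {1..e}. tl_of \<sigma> c = o'}) in
       (\<forall>i < reg \<sigma>' ''l''. arr \<sigma>' ''hop'' (arr \<sigma>' ''queue'' i) \<le> Suc (arr \<sigma>' ''hop'' o')) \<and>
       reg \<sigma> ''l'' \<le> reg \<sigma>' ''l'' \<and> (\<forall>i < reg \<sigma> ''l''. arr \<sigma>' ''queue'' i = arr \<sigma> ''queue'' i) \<and>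
       arr \<sigma>' ''hop'' o' < 2 * k - 1 \<and>
       reg \<sigma>' ''e'' \<le> reg \<sigma> ''c'' \<and> (reg \<sigma>' ''e'' = 0 \<or> tl_of \<sigma> (reg \<sigma>' ''e'') = o') \<and>
       (\<forall>c \<in> {reg \<sigma>' ''e''<..reg \<sigma> ''c''}. tl_of \<sigma> c = o' \<longrightarrow> col (arr \<sigma> ''cell'' c) \<inter> F = {} \<longrightarrow>
          arr \<sigma>' ''vis'' (arr \<sigma> ''to'' c) = reg \<sigma> ''g'' \<and>
          arr \<sigma>' ''hop'' (arr \<sigma> ''to'' c) \<le> Suc (arr \<sigma>' ''hop'' o')) \<and>
       reg \<sigma>' ''l'' + R (reg \<sigma>' ''e'') \<le> reg \<sigma> ''l'' + R (reg \<sigma> ''e''))"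

lemma scan_cell_wp:
  assumes G: "graph_state I F \<sigma>" and h: "h < reg \<sigma> ''l''" "reg \<sigma> ''o'' = arr \<sigma> ''queue'' h"
    and I: "scan_inv I F h \<sigma> \<sigma>'" and e: "0 < reg \<sigma>' ''e''"
  shows "wp scan_cell (\<lambda>T \<sigma>''. scan_inv I F h \<sigma> \<sigma>'' \<and>
       4 + T + 100 * card {c \<in> {1..reg \<sigma>'' ''e''}. tl_of \<sigma> c = reg \<sigma> ''o''}
         \<le> 100 * card {c \<in> {1..reg \<sigma>' ''e''}. tl_of \<sigma> c = reg \<sigma> ''o''}) \<sigma>'"
proof -
  let ?o = "reg \<sigma> ''o''" and ?c = "reg \<sigma>' ''e''" and ?g = "reg \<sigma> ''g''"
  let ?j = "arr \<sigma> ''cell'' ?c" and ?z = "arr \<sigma> ''to'' ?c" and ?n = "arr \<sigma> ''next'' ?c"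
  let ?vis = "arr \<sigma>' ''vis''" and ?hop = "arr \<sigma>' ''hop''" and ?Q = "arr \<sigma>' ''queue''" and ?l = "reg \<sigma>' ''l''"
  have fr: "frame {''e'', ''j'', ''z'', ''l''} bfs_arrs \<sigma> \<sigma>'" using I by (simp add: scan_inv_def)
  have r [simp]: "reg \<sigma>' ''g'' = ?g" "reg \<sigma>' ''o'' = ?o" "reg \<sigma>' ''p'' = reg \<sigma> ''p''" "reg \<sigma>' ''c'' = reg \<sigma> ''c''"
    using fr by (simp_all add: frame_def)
  have a [simp]: "arr \<sigma>' ''cell'' = arr \<sigma> ''cell''" "arr \<sigma>' ''to'' = arr \<sigma> ''to''" "arr \<sigma>' ''next'' = arr \<sigma> ''next''"
    using fr by (simp_all add: frame_def)
  have C: "cells I (reg \<sigma> ''c'') (arr \<sigma> ''cell'') (arr \<sigma> ''to'') (arr \<sigma> ''next'') (arr \<sigma> ''head'')"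
    using G by (simp add: graph_state_def)
  have cc: "?c \<in> {1..reg \<sigma> ''c''}" and tc: "tl_of \<sigma> ?c = ?o"
    using I e by (auto simp: scan_inv_def Let_def)
  have ed: "ed ?j = {?o, ?z}" and jI: "?j \<in> I" using ed_tail[OF C cc] tc cellsD(1)[OF C cc] by auto
  have nx: "?n < ?c" "?n \<le> reg \<sigma> ''c''" "?n = 0 \<or> tl_of \<sigma> ?n = ?o" "\<And>c'. ?n < c' \<Longrightarrow> c' < ?c \<Longrightarrow> tl_of \<sigma> c' \<noteq> ?o"
    using cellsD(3-5)[OF C cc] cc tc by auto
  have T: "tree I F (reg \<sigma> ''p'') ?g ?l ?Q ?vis ?hop (arr \<sigma>' ''par'') (arr \<sigma>' ''pe'')"
    using I by (simp add: scan_inv_def btree_def)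
  have S: "settled I F ?g h ?Q ?vis ?hop" using I by (simp add: scan_inv_def bsettled_def)
  have cnt: "card {c \<in> {1..?c}. tl_of \<sigma> c = ?o} = Suc (card {c \<in> {1..?n}. tl_of \<sigma> c = ?o})"
    using tail_next[OF C cc] tc by simp
  have lI: "\<forall>i < ?l. ?hop (?Q i) \<le> Suc (?hop ?o)" "reg \<sigma> ''l'' \<le> ?l" "\<forall>i < reg \<sigma> ''l''. ?Q i = arr \<sigma> ''queue'' i"
    "?hop ?o < 2 * k - 1"
    "\<And>c. c \<in> {?c<..reg \<sigma> ''c''} \<Longrightarrow> tl_of \<sigma> c = ?o \<Longrightarrow> col (arr \<sigma> ''cell'' c) \<inter> F = {} \<Longrightarrow>
          ?vis (arr \<sigma> ''to'' c) = ?g \<and> ?hop (arr \<sigma> ''to'' c) \<le> Suc (?hop ?o)"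
    "?l + card {c \<in> {1..?c}. tl_of \<sigma> c = ?o} \<le> reg \<sigma> ''l'' + card {c \<in> {1..reg \<sigma> ''e''}. tl_of \<sigma> c = ?o}"
    using I by (simp_all add: scan_inv_def Let_def)
  have oQ: "?o = ?Q h" using h lI by simp
  moreover have "?Q h \<in> ?Q ` {..<?l}" using h(1) lI(2) by auto
  ultimately have vo: "?vis ?o = ?g" using T by (simp add: tree_def)
  have vg: "?vis y \<le> ?g" for y using T by (simp add: tree_def)
  have split: "?n < c \<Longrightarrow> tl_of \<sigma> c = ?o \<Longrightarrow> c \<noteq> ?c \<Longrightarrow> ?c < c" for c using nx(4)[of c] by force
  have G': "graph_state I F (\<sigma>'\<lparr>reg := (reg \<sigma>')(''j'' := ?j, ''z'' := ?z)\<rparr>)"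
  proof -
    have "frame bfs_regs bfs_arrs \<sigma> (\<sigma>'\<lparr>reg := (reg \<sigma>')(''j'' := ?j, ''z'' := ?z)\<rparr>)"
      using fr by (auto simp: frame_def)
    then show ?thesis using graph_state_frame[of bfs_regs bfs_arrs] G by blast
  qed
  have al: "bval (alive_edge (Reg ''j'')) (\<sigma>'\<lparr>reg := (reg \<sigma>')(''j'' := ?j, ''z'' := ?z)\<rparr>) \<longleftrightarrow> col ?j \<inter> F = {}"
    by (rule alive_edge_iff[OF G']) simp
  show ?thesis
  proof (cases "?vis ?z < ?g \<and> col ?j \<inter> F = {}")
    case True
    have zo: "?z \<noteq> ?o" using True vo by auto
    have vz: "?vis ?z \<noteq> ?g" using True by simp
    let ?\<sigma> = "\<sigma>'\<lparr>arr := (arr \<sigma>')(''vis'' := ?vis(?z := ?g), ''hop'' := ?hop(?z := Suc (?hop ?o)),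
        ''par'' := (arr \<sigma>' ''par'')(?z := ?o), ''pe'' := (arr \<sigma>' ''pe'')(?z := ?j), ''queue'' := ?Q(?l := ?z)),
      reg := (reg \<sigma>')(''j'' := ?j, ''z'' := ?z, ''l'' := Suc ?l, ''e'' := ?n)\<rparr>"
    have "scan_inv I F h \<sigma> ?\<sigma>"
    proof -
      have t: "btree I F ?\<sigma>" unfolding btree_def
        using tree_visit[OF T vo lI(4) vz jI _ ed] True lI(1) by simp
      have s: "bsettled I F h ?\<sigma>" unfolding bsettled_def
        using settled_visit[OF T S _ vz] h lI(2) by simp
      have f: "frame {''e'', ''j'', ''z'', ''l''} bfs_arrs \<sigma> ?\<sigma>" using fr by (auto simp: frame_def)
      have "(?hop(?z := Suc (?hop ?o))) ((?Q(?l := ?z)) i) \<le> Suc (?hop ?o)" if "i < Suc ?l" for i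
        using lI(1) that by (auto simp: less_Suc_eq)
      moreover have "(?vis(?z := ?g)) (arr \<sigma> ''to'' c) = ?g \<and>
          (?hop(?z := Suc (?hop ?o))) (arr \<sigma> ''to'' c) \<le> Suc (?hop ?o)"
        if "c \<in> {?n<..reg \<sigma> ''c''}" "tl_of \<sigma> c = ?o" "col (arr \<sigma> ''cell'' c) \<inter> F = {}" for c
        using lI(5)[of c] that split[of c] by (cases "c = ?c") auto
      ultimately show ?thesis using t s f lI nx cnt zo unfolding scan_inv_def Let_def by simp
    qed
    then show ?thesis using True al cnt
      by (simp add: wp_simps scan_cell_def visit_def alive_edge_def unmarked_def edge_color_def end_color_def)
  next
    case False
    let ?\<sigma> = "\<sigma>'\<lparr>reg := (reg \<sigma>')(''j'' := ?j, ''z'' := ?z, ''e'' := ?n)\<rparr>"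
    have "scan_inv I F h \<sigma> ?\<sigma>"
    proof -
      have f: "frame {''e'', ''j'', ''z'', ''l''} bfs_arrs \<sigma> ?\<sigma>" using fr by (auto simp: frame_def)
      have vz: "?vis ?z = ?g \<and> ?hop ?z \<le> Suc (?hop ?o)" if "col ?j \<inter> F = {}"
      proof -
        have "?vis ?z = ?g" using False that vg[of ?z] by auto
        \<comment> \<open>A vertex visited before is already queued, and no queue entry is deeper
          than one level below the scanned vertex.\<close>
        then have "?z \<in> ?Q ` {..<?l}" using T by (simp add: tree_def)
        then show ?thesis using lI(1) \<open>?vis ?z = ?g\<close> by auto
      qed
      have "?vis (arr \<sigma> ''to'' c) = ?g \<and> ?hop (arr \<sigma> ''to'' c) \<le> Suc (?hop ?o)"
        if "c \<in> {?n<..reg \<sigma> ''c''}" "tl_of \<sigma> c = ?o" "col (arr \<sigma> ''cell'' c) \<inter> F = {}" for c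
        using lI(5)[of c] that split[of c] vz by (cases "c = ?c") auto
      then show ?thesis using T S f lI nx cnt unfolding scan_inv_def Let_def btree_def bsettled_def by simp
    qed
    then show ?thesis using False al cnt
      by (auto simp: wp_simps scan_cell_def alive_edge_def unmarked_def edge_color_def end_color_def)
  qed
qed

definition scan_post where
  "scan_post I F h D \<sigma> \<sigma>' \<longleftrightarrow> frame {''e'', ''j'', ''z'', ''l''} bfs_arrs \<sigma> \<sigma>' \<and> btree I F \<sigma>' \<and>
      bsettled I F (Suc h) \<sigma>' \<and>
      (\<forall>i < reg \<sigma>' ''l''. arr \<sigma>' ''hop'' (arr \<sigma>' ''queue'' i) \<le> Suc (arr \<sigma>' ''hop'' (reg \<sigma> ''o''))) \<and>
      reg \<sigma> ''l'' \<le> reg \<sigma>' ''l'' \<and> (\<forall>i < reg \<sigma> ''l''. arr \<sigma>' ''queue'' i = arr \<sigma> ''queue'' i) \<and>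
      reg \<sigma>' ''l'' \<le> reg \<sigma> ''l'' + D"

text \<open>\<open>D\<close> is the degree of the scanned vertex; both the time and the growth of
  the queue are charged to it.\<close>

lemma scan_wp:
  assumes G: "graph_state I F \<sigma>" and T: "btree I F \<sigma>" and S: "bsettled I F h \<sigma>"
    and h: "h < reg \<sigma> ''l''" "reg \<sigma> ''o'' = arr \<sigma> ''queue'' h" "arr \<sigma> ''hop'' (reg \<sigma> ''o'') < 2 * k - 1"
    and le: "\<And>i. i < reg \<sigma> ''l'' \<Longrightarrow> arr \<sigma> ''hop'' (arr \<sigma> ''queue'' i) \<le> Suc (arr \<sigma> ''hop'' (reg \<sigma> ''o''))"
    and e: "reg \<sigma> ''e'' = arr \<sigma> ''head'' (reg \<sigma> ''o'')"
  defines "D \<equiv> card {c \<in> {1..reg \<sigma> ''c''}. tl_of \<sigma> c = reg \<sigma> ''o''}"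
  shows "wp scan (\<lambda>T \<sigma>'. scan_post I F h D \<sigma> \<sigma>' \<and> T \<le> 100 * D + 4) \<sigma>"
  unfolding scan_def
proof (rule wp_While[where I = "scan_inv I F h \<sigma>"
      and pot = "\<lambda>\<sigma>'. 100 * card {c \<in> {1..reg \<sigma>' ''e''}. tl_of \<sigma> c = reg \<sigma> ''o''}"])
  have C: "cells I (reg \<sigma> ''c'') (arr \<sigma> ''cell'') (arr \<sigma> ''to'') (arr \<sigma> ''next'') (arr \<sigma> ''head'')"
    using G by (simp add: graph_state_def)
  have C': "reg \<sigma> ''e'' \<le> reg \<sigma> ''c''" "reg \<sigma> ''e'' = 0 \<or> tl_of \<sigma> (reg \<sigma> ''e'') = reg \<sigma> ''o''"
    "\<And>c. reg \<sigma> ''e'' < c \<Longrightarrow> c \<le> reg \<sigma> ''c'' \<Longrightarrow> tl_of \<sigma> c \<noteq> reg \<sigma> ''o''"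
    using C unfolding cells_def e by simp_all
  have le_D: "card {c \<in> {1..reg \<sigma> ''e''}. tl_of \<sigma> c = reg \<sigma> ''o''} \<le> D"
    unfolding D_def using C'(1) by (intro card_mono) auto
  show "scan_inv I F h \<sigma> \<sigma>"
    using C' T S h le by (auto simp: scan_inv_def Let_def frame_refl)
  show "wp scan_cell
     (\<lambda>T \<sigma>''. scan_inv I F h \<sigma> \<sigma>'' \<and>
       1 + bcost (Less (Num 0) (Reg ''e'')) + T + 100 * card {c \<in> {1..reg \<sigma>'' ''e''}. tl_of \<sigma> c = reg \<sigma> ''o''}
         \<le> 100 * card {c \<in> {1..reg \<sigma>' ''e''}. tl_of \<sigma> c = reg \<sigma> ''o''}) \<sigma>'"
    if "scan_inv I F h \<sigma> \<sigma>'" "bval (Less (Num 0) (Reg ''e'')) \<sigma>'" for \<sigma>'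
  proof -
    have "1 + bcost (Less (Num 0) (Reg ''e'')) = 4" "0 < reg \<sigma>' ''e''" using that(2) by simp_all
    then show ?thesis using scan_cell_wp[OF G h(1,2) that(1)] by (simp only:)
  qed
  fix T' \<sigma>'
  assume I: "scan_inv I F h \<sigma> \<sigma>'" and b: "\<not> bval (Less (Num 0) (Reg ''e'')) \<sigma>'"
    and T': "T' \<le> 100 * card {c \<in> {1..reg \<sigma> ''e''}. tl_of \<sigma> c = reg \<sigma> ''o''} + 1 + bcost (Less (Num 0) (Reg ''e''))"
  have e0: "reg \<sigma>' ''e'' = 0" using b by simp
  let ?o = "reg \<sigma> ''o''"
  have fr: "frame {''e'', ''j'', ''z'', ''l''} bfs_arrs \<sigma> \<sigma>'" using I by (simp add: scan_inv_def)
  then have g: "reg \<sigma>' ''g'' = reg \<sigma> ''g''" by (simp add: frame_def)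
  have new: "\<And>c. c \<in> {1..reg \<sigma> ''c''} \<Longrightarrow> tl_of \<sigma> c = ?o \<Longrightarrow> col (arr \<sigma> ''cell'' c) \<inter> F = {} \<Longrightarrow>
          arr \<sigma>' ''vis'' (arr \<sigma> ''to'' c) = reg \<sigma> ''g'' \<and> arr \<sigma>' ''hop'' (arr \<sigma> ''to'' c) \<le> Suc (arr \<sigma>' ''hop'' ?o)"
    using I e0 by (auto simp: scan_inv_def Let_def)
  have S': "settled I F (reg \<sigma> ''g'') h (arr \<sigma>' ''queue'') (arr \<sigma>' ''vis'') (arr \<sigma>' ''hop'')"
    and Qh: "arr \<sigma>' ''queue'' h = ?o" using I h g by (auto simp: scan_inv_def bsettled_def Let_def)
  have nb: "arr \<sigma>' ''vis'' z = reg \<sigma> ''g'' \<and> arr \<sigma>' ''hop'' z \<le> Suc (arr \<sigma>' ''hop'' ?o)"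
    if j: "j \<in> I" "col j \<inter> F = {}" "ed j = {?o, z}" for j z
  proof -
    \<comment> \<open>Every edge owns a cell in each direction, and the one directed to
      \<open>z\<close> has its tail at the scanned vertex.\<close>
    have "z = U j \<or> z = V j" using j(3) by (auto simp: ed_def doubleton_eq_iff)
    moreover have "\<exists>c \<in> {1..reg \<sigma> ''c''}. arr \<sigma> ''cell'' c = j \<and> arr \<sigma> ''to'' c = U j"
      "\<exists>c \<in> {1..reg \<sigma> ''c''}. arr \<sigma> ''cell'' c = j \<and> arr \<sigma> ''to'' c = V j"
      using C j(1) unfolding cells_def by blast+
    ultimately obtain c where c: "c \<in> {1..reg \<sigma> ''c''}" "arr \<sigma> ''cell'' c = j" "arr \<sigma> ''to'' c = z" by blast
    have "{tl_of \<sigma> c, z} = {?o, z}" using ed_tail[OF C c(1)] c j(3) by simp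
    then have "tl_of \<sigma> c = ?o" by (auto simp: doubleton_eq_iff)
    then show ?thesis using new[OF c(1)] c j by simp
  qed
  have "bsettled I F (Suc h) \<sigma>'"
    unfolding bsettled_def settled_def g
  proof (intro allI impI ballI)
    fix i j z assume a: "i < Suc h" "arr \<sigma>' ''hop'' (arr \<sigma>' ''queue'' i) < 2 * k - 1" "j \<in> I" "col j \<inter> F = {}"
      "ed j = {arr \<sigma>' ''queue'' i, z}"
    show "arr \<sigma>' ''vis'' z = reg \<sigma> ''g'' \<and> arr \<sigma>' ''hop'' z \<le> Suc (arr \<sigma>' ''hop'' (arr \<sigma>' ''queue'' i))"
    proof (cases "i = h")
      case True
      then show ?thesis using nb[OF a(3,4)] a(5) Qh by simp
    next
      case False
      then show ?thesis using S' a unfolding settled_def by (meson less_SucE)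
    qed
  qed
  then show "scan_post I F h D \<sigma> \<sigma>' \<and> T' \<le> 100 * D + 4"
    using I T' le_D by (auto simp: scan_inv_def scan_post_def Let_def)
qed

definition bfs_inv where
  "bfs_inv I F \<sigma> \<sigma>' \<longleftrightarrow> frame bfs_regs bfs_arrs \<sigma> \<sigma>' \<and> reg \<sigma>' ''g'' = Suc (reg \<sigma> ''g'') \<and> btree I F \<sigma>' \<and>
     bsettled I F (reg \<sigma>' ''h'') \<sigma>' \<and> reg \<sigma>' ''h'' \<le> reg \<sigma>' ''l'' \<and>
     (\<forall>i j. reg \<sigma>' ''h'' \<le> i \<longrightarrow> i < reg \<sigma>' ''l'' \<longrightarrow> j < reg \<sigma>' ''l'' \<longrightarrow>
        arr \<sigma>' ''hop'' (arr \<sigma>' ''queue'' j) \<le> Suc (arr \<sigma>' ''hop'' (arr \<sigma>' ''queue'' i)))"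

text \<open>Expanding a vertex of degree \<open>D\<close> takes \<open>100 * D\<close> steps up to a
  constant and adds at most \<open>D\<close> queue entries worth 40 each: hence 140 per cell of a
  vertex not yet expanded, and 40 per waiting vertex for the constant.\<close>

definition bfs_pot where
  "bfs_pot \<sigma> \<sigma>' = 40 * (reg \<sigma>' ''l'' - reg \<sigma>' ''h'') +
     140 * card {c \<in> {1..reg \<sigma> ''c''}. tl_of \<sigma> c \<notin> arr \<sigma>' ''queue'' ` {..<reg \<sigma>' ''h''}}"

lemma bfs_vertex_wp:
  assumes G: "graph_state I F \<sigma>" and I: "bfs_inv I F \<sigma> \<sigma>'" and hl: "reg \<sigma>' ''h'' < reg \<sigma>' ''l''"
  shows "wp bfs_vertex
     (\<lambda>T \<sigma>''. bfs_inv I F \<sigma> \<sigma>'' \<and> 4 + T + bfs_pot \<sigma> \<sigma>'' \<le> bfs_pot \<sigma> \<sigma>') \<sigma>'"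
proof -
  let ?h = "reg \<sigma>' ''h''" and ?l = "reg \<sigma>' ''l''" and ?Q = "arr \<sigma>' ''queue''" and ?hop = "arr \<sigma>' ''hop''"
  let ?o = "?Q ?h"
  have fr: "frame bfs_regs bfs_arrs \<sigma> \<sigma>'" and g: "reg \<sigma>' ''g'' = Suc (reg \<sigma> ''g'')" and T: "btree I F \<sigma>'"
    and S: "bsettled I F ?h \<sigma>'" and up: "\<And>i j. ?h \<le> i \<Longrightarrow> i < ?l \<Longrightarrow> j < ?l \<Longrightarrow> ?hop (?Q j) \<le> Suc (?hop (?Q i))"
    using I by (simp_all add: bfs_inv_def)
  have r [simp]: "reg \<sigma>' ''c'' = reg \<sigma> ''c''" "reg \<sigma>' ''p'' = reg \<sigma> ''p''" "arr \<sigma>' ''cell'' = arr \<sigma> ''cell''"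
    "arr \<sigma>' ''to'' = arr \<sigma> ''to''" "arr \<sigma>' ''head'' = arr \<sigma> ''head''" "reg \<sigma>' ''k'' = k"
    using fr G by (simp_all add: frame_def graph_state_def env_def)
  have inj: "inj_on ?Q {..<?l}" using T by (simp add: btree_def tree_def)
  let ?D = "card {c \<in> {1..reg \<sigma> ''c''}. tl_of \<sigma> c = ?o}"
  let ?rem = "\<lambda>h. card {c \<in> {1..reg \<sigma> ''c''}. tl_of \<sigma> c \<notin> ?Q ` {..<h}}"
  \<comment> \<open>The queue has no repetitions, so the cells of the vertex taken out are counted
    until exactly this moment.\<close>
  have rem: "?rem ?h = ?rem (Suc ?h) + ?D"
  proof -
    have "?o \<notin> ?Q ` {..<?h}" using inj_onD[OF inj, of ?h] hl by fastforce
    then have "?Q x \<noteq> ?o" if "x < ?h" for x using that by (metis imageI lessThan_iff)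
    then have eq: "{c \<in> {1..reg \<sigma> ''c''}. tl_of \<sigma> c \<notin> ?Q ` {..<?h}} =
      {c \<in> {1..reg \<sigma> ''c''}. tl_of \<sigma> c \<notin> ?Q ` {..<Suc ?h}} \<union> {c \<in> {1..reg \<sigma> ''c''}. tl_of \<sigma> c = ?o}"
      by (auto simp: lessThan_Suc)
    show ?thesis unfolding eq by (rule card_Un_disjoint) (auto simp: lessThan_Suc image_iff)
  qed
  show ?thesis
  proof (cases "Suc (?hop ?o) < k + k")
    case True
    let ?\<sigma> = "\<sigma>'\<lparr>reg := (reg \<sigma>')(''o'' := ?o, ''h'' := Suc ?h, ''e'' := arr \<sigma> ''head'' ?o)\<rparr>"
    have fr2: "frame bfs_regs bfs_arrs \<sigma> ?\<sigma>" using fr by (auto simp: frame_def)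
    have "wp scan (\<lambda>T \<sigma>'. scan_post I F ?h (card {c \<in> {1..reg ?\<sigma> ''c''}. tl_of ?\<sigma> c = reg ?\<sigma> ''o''}) ?\<sigma> \<sigma>' \<and>
      T \<le> 100 * card {c \<in> {1..reg ?\<sigma> ''c''}. tl_of ?\<sigma> c = reg ?\<sigma> ''o''} + 4) ?\<sigma>"
    proof (rule scan_wp)
      show "graph_state I F ?\<sigma>" using graph_state_frame[OF fr2] G by blast
      show "btree I F ?\<sigma>" using T by (simp add: btree_def)
      show "bsettled I F ?h ?\<sigma>" using S by (simp add: bsettled_def)
      show "arr ?\<sigma> ''hop'' (arr ?\<sigma> ''queue'' i) \<le> Suc (arr ?\<sigma> ''hop'' (reg ?\<sigma> ''o''))" if "i < reg ?\<sigma> ''l''" for i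
        using up[of ?h i] hl that by simp
    qed (use hl True in auto)
    then have "wp scan (\<lambda>T \<sigma>''. bfs_inv I F \<sigma> \<sigma>'' \<and> 34 + T + bfs_pot \<sigma> \<sigma>'' \<le> bfs_pot \<sigma> \<sigma>') ?\<sigma>"
    proof (rule wp_mono, elim conjE, intro conjI)
      fix T \<sigma>'' assume P: "scan_post I F ?h (card {c \<in> {1..reg ?\<sigma> ''c''}. tl_of ?\<sigma> c = reg ?\<sigma> ''o''}) ?\<sigma> \<sigma>''"
        and T: "T \<le> 100 * card {c \<in> {1..reg ?\<sigma> ''c''}. tl_of ?\<sigma> c = reg ?\<sigma> ''o''} + 4"
      note P' = P[unfolded scan_post_def]
      note f = P'[THEN conjunct1] and t = P'[THEN conjunct2, THEN conjunct1]
        and s = P'[THEN conjunct2, THEN conjunct2, THEN conjunct1]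
      have up': "\<forall>i < reg \<sigma>'' ''l''. arr \<sigma>'' ''hop'' (arr \<sigma>'' ''queue'' i) \<le> Suc (arr \<sigma>'' ''hop'' (reg ?\<sigma> ''o''))"
        and l: "reg ?\<sigma> ''l'' \<le> reg \<sigma>'' ''l''" and q: "\<forall>i < reg ?\<sigma> ''l''. arr \<sigma>'' ''queue'' i = arr ?\<sigma> ''queue'' i"
        and l': "reg \<sigma>'' ''l'' \<le> reg ?\<sigma> ''l'' + card {c \<in> {1..reg ?\<sigma> ''c''}. tl_of ?\<sigma> c = reg ?\<sigma> ''o''}"
        using P' by blast+
      have h'': "reg \<sigma>'' ''h'' = Suc ?h" "reg \<sigma>'' ''g'' = reg \<sigma>' ''g''" using f by (simp_all add: frame_def)
      have fr'': "frame bfs_regs bfs_arrs \<sigma> \<sigma>''" using frame_trans[OF fr2 f, of bfs_regs bfs_arrs] by simp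
      have mono: "arr \<sigma>'' ''hop'' (arr \<sigma>'' ''queue'' i) \<le> arr \<sigma>'' ''hop'' (arr \<sigma>'' ''queue'' j)"
        if "i \<le> j" "j < reg \<sigma>'' ''l''" for i j using t that by (simp add: btree_def tree_def)
      have qh: "arr \<sigma>'' ''queue'' ?h = ?o" using q hl by simp
      have "arr \<sigma>'' ''hop'' (arr \<sigma>'' ''queue'' j) \<le> Suc (arr \<sigma>'' ''hop'' (arr \<sigma>'' ''queue'' i))"
        if "Suc ?h \<le> i" "i < reg \<sigma>'' ''l''" "j < reg \<sigma>'' ''l''" for i j
      proof -
        have "arr \<sigma>'' ''hop'' (arr \<sigma>'' ''queue'' j) \<le> Suc (arr \<sigma>'' ''hop'' ?o)" using up' that by simp
        also have "\<dots> \<le> Suc (arr \<sigma>'' ''hop'' (arr \<sigma>'' ''queue'' i))" using mono[of ?h i] that qh by simp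
        finally show ?thesis .
      qed
      then show "bfs_inv I F \<sigma> \<sigma>''" unfolding bfs_inv_def using fr'' g h'' t s l hl by simp
      have "arr \<sigma>'' ''queue'' ` {..<Suc ?h} = ?Q ` {..<Suc ?h}"
        by (rule image_cong) (use q hl in auto)
      then show "34 + T + bfs_pot \<sigma> \<sigma>'' \<le> bfs_pot \<sigma> \<sigma>'"
        unfolding bfs_pot_def h'' using rem T l l' hl by simp
    qed
    then show ?thesis using True
      by (simp add: bfs_vertex_def wp_simps) (rule wp_mono, assumption, simp)
  next
    case False
    let ?\<sigma> = "\<sigma>'\<lparr>reg := (reg \<sigma>')(''o'' := ?o, ''h'' := Suc ?h)\<rparr>"
    have fr2: "frame bfs_regs bfs_arrs \<sigma> ?\<sigma>" using fr by (auto simp: frame_def)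
    have "\<not> ?hop ?o < 2 * k - 1" using False by simp
    then have "bsettled I F (Suc ?h) ?\<sigma>" using S by (simp add: bsettled_def settled_def less_Suc_eq)
    then have "bfs_inv I F \<sigma> ?\<sigma>" unfolding bfs_inv_def using fr2 T g hl up by (simp add: btree_def)
    moreover have "30 + bfs_pot \<sigma> ?\<sigma> \<le> bfs_pot \<sigma> \<sigma>'" unfolding bfs_pot_def using rem hl by simp
    ultimately show ?thesis using False by (simp add: bfs_vertex_def wp_simps)
  qed
qed

lemma bfs_wp:
  assumes G: "graph_state I F \<sigma>" and vis: "\<And>y. arr \<sigma> ''vis'' y \<le> reg \<sigma> ''g''"
  shows "wp bfs (\<lambda>T \<sigma>'. frame bfs_regs bfs_arrs \<sigma> \<sigma>' \<and> reg \<sigma>' ''g'' = Suc (reg \<sigma> ''g'') \<and> btree I F \<sigma>' \<and>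
      (\<forall>y. reach (alive I F) (2 * k - 1) (reg \<sigma> ''p'') y \<longrightarrow> arr \<sigma>' ''vis'' y = reg \<sigma>' ''g'') \<and>
      T \<le> 140 * reg \<sigma> ''c'' + 100) \<sigma>"
proof -
  let ?\<sigma> = "\<sigma>\<lparr>arr := (arr \<sigma>)(''vis'' := (arr \<sigma> ''vis'')(reg \<sigma> ''p'' := Suc (reg \<sigma> ''g'')),
        ''hop'' := (arr \<sigma> ''hop'')(reg \<sigma> ''p'' := 0), ''queue'' := (arr \<sigma> ''queue'')(0 := reg \<sigma> ''p'')),
      reg := (reg \<sigma>)(''g'' := Suc (reg \<sigma> ''g''), ''h'' := 0, ''l'' := 1)\<rparr>"
  have vis': "arr \<sigma> ''vis'' y \<noteq> Suc (reg \<sigma> ''g'')" "arr \<sigma> ''vis'' y \<le> Suc (reg \<sigma> ''g'')" for y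
    using vis[of y] by auto
  have "wp (While (Less (Reg ''h'') (Reg ''l'')) bfs_vertex)
     (\<lambda>T \<sigma>'. bfs_inv I F \<sigma> \<sigma>' \<and> reg \<sigma>' ''h'' = reg \<sigma>' ''l'' \<and> T \<le> 140 * reg \<sigma> ''c'' + 50) ?\<sigma>"
  proof (rule wp_While[where I = "bfs_inv I F \<sigma>" and pot = "bfs_pot \<sigma>"])
    show "bfs_inv I F \<sigma> ?\<sigma>"
      using vis' by (auto simp: bfs_inv_def frame_def btree_def tree_def bsettled_def settled_def lessThan_Suc)
    fix T \<sigma>' assume I: "bfs_inv I F \<sigma> \<sigma>'" and b: "\<not> bval (Less (Reg ''h'') (Reg ''l'')) \<sigma>'"
      and T: "T \<le> bfs_pot \<sigma> ?\<sigma> + 1 + bcost (Less (Reg ''h'') (Reg ''l''))"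
    have "card {c \<in> {1..reg \<sigma> ''c''}. tl_of \<sigma> c \<notin> {}} \<le> card {1..reg \<sigma> ''c''}" by (intro card_mono) auto
    then have "bfs_pot \<sigma> ?\<sigma> \<le> 140 * reg \<sigma> ''c'' + 40" by (simp add: bfs_pot_def)
    then show "bfs_inv I F \<sigma> \<sigma>' \<and> reg \<sigma>' ''h'' = reg \<sigma>' ''l'' \<and> T \<le> 140 * reg \<sigma> ''c'' + 50"
      using I b T by (auto simp: bfs_inv_def)
  next
    fix \<sigma>' assume I: "bfs_inv I F \<sigma> \<sigma>'" and b: "bval (Less (Reg ''h'') (Reg ''l'')) \<sigma>'"
    show "wp bfs_vertex
     (\<lambda>T \<sigma>''. bfs_inv I F \<sigma> \<sigma>'' \<and> 1 + bcost (Less (Reg ''h'') (Reg ''l'')) + T + bfs_pot \<sigma> \<sigma>'' \<le> bfs_pot \<sigma> \<sigma>') \<sigma>'"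
    proof -
      have "1 + bcost (Less (Reg ''h'') (Reg ''l'')) = 4" "reg \<sigma>' ''h'' < reg \<sigma>' ''l''" using b by simp_all
      then show ?thesis using bfs_vertex_wp[OF G I] by (simp only:)
    qed
  qed
  then have "wp (While (Less (Reg ''h'') (Reg ''l'')) bfs_vertex)
     (\<lambda>T \<sigma>'. frame bfs_regs bfs_arrs \<sigma> \<sigma>' \<and> reg \<sigma>' ''g'' = Suc (reg \<sigma> ''g'') \<and> btree I F \<sigma>' \<and>
      (\<forall>y. reach (alive I F) (2 * k - 1) (reg \<sigma> ''p'') y \<longrightarrow> arr \<sigma>' ''vis'' y = reg \<sigma>' ''g'') \<and>
      30 + T \<le> 140 * reg \<sigma> ''c'' + 100) ?\<sigma>"
  proof (rule wp_mono, elim conjE, intro conjI allI impI)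
    fix T \<sigma>' y assume I: "bfs_inv I F \<sigma> \<sigma>'" and hl: "reg \<sigma>' ''h'' = reg \<sigma>' ''l''"
      and y: "reach (alive I F) (2 * k - 1) (reg \<sigma> ''p'') y"
    have p: "reg \<sigma>' ''p'' = reg \<sigma> ''p''" using I by (simp add: bfs_inv_def frame_def)
    have bt: "btree I F \<sigma>'" "bsettled I F (reg \<sigma>' ''h'') \<sigma>'" using I by (simp_all add: bfs_inv_def)
    have t: "tree I F (reg \<sigma> ''p'') (reg \<sigma>' ''g'') (reg \<sigma>' ''l'')
     (arr \<sigma>' ''queue'') (arr \<sigma>' ''vis'') (arr \<sigma>' ''hop'') (arr \<sigma>' ''par'') (arr \<sigma>' ''pe'')"
      and s: "settled I F (reg \<sigma>' ''g'') (reg \<sigma>' ''l'') (arr \<sigma>' ''queue'') (arr \<sigma>' ''vis'') (arr \<sigma>' ''hop'')"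
      using bt hl p unfolding btree_def bsettled_def by simp_all
    show "arr \<sigma>' ''vis'' y = reg \<sigma>' ''g''"
      using settled_complete[OF t s y] t by (simp add: tree_def)
  qed (auto simp: bfs_inv_def)
  then show ?thesis
    by (simp add: bfs_def wp_simps) (rule wp_mono, assumption, simp)
qed

end

section \<open>Deleting the colors of a path\<close>

text \<open>
  Colors of the edge under consideration carry the stamp \<open>d\<close> in \<open>prot\<close> and are never deleted.
\<close>

definition mark_color :: "aexp \<Rightarrow> com" where
  "mark_color c = If (Less (Arr ''prot'' c) (Reg ''d''))
     (Seq (Store ''mark'' c (Reg ''d'')) (Assign ''w'' (Num 1))) Skip"

definition mark_edge :: com where
  "mark_edge = seq [mark_color (edge_color (Reg ''j'')), mark_color (end_color ''u'' (Reg ''j'')),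
     mark_color (end_color ''v'' (Reg ''j''))]"

definition trace_step :: com where
  "trace_step = seq [
     Assign ''j'' (Arr ''pe'' (Reg ''z'')),
     mark_edge,
     Assign ''z'' (Arr ''par'' (Reg ''z''))]"

text \<open>\<open>w\<close> ends as 0 exactly if the path has only colors of the edge under
  consideration; then nothing is deleted, and no faults that spare the edge can destroy the
  path.\<close>

definition trace :: com where
  "trace = seq [
     Assign ''z'' (Reg ''q''),
     Assign ''w'' (Num 0),
     While (Less (Num 0) (Arr ''hop'' (Reg ''z''))) trace_step]"

definition add_edge :: com where
  "add_edge = seq [
     Store ''out'' (Reg ''s'') (Reg ''x''),
     Assign ''s'' (Plus (Reg ''s'') (Num 1)),
     Assign ''c'' (Plus (Reg ''c'') (Num 1)),
     Store ''cell'' (Reg ''c'') (Reg ''x''),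
     Store ''to'' (Reg ''c'') (Reg ''q''),
     Store ''next'' (Reg ''c'') (Arr ''head'' (Reg ''p'')),
     Store ''head'' (Reg ''p'') (Reg ''c''),
     Assign ''c'' (Plus (Reg ''c'') (Num 1)),
     Store ''cell'' (Reg ''c'') (Reg ''x''),
     Store ''to'' (Reg ''c'') (Reg ''p''),
     Store ''next'' (Reg ''c'') (Arr ''head'' (Reg ''q'')),
     Store ''head'' (Reg ''q'') (Reg ''c'')]"

context greedy_input
begin

lemma mark_edge_wp:
  assumes E: "env \<sigma>" and P: "\<And>y. arr \<sigma> ''prot'' y \<le> reg \<sigma> ''d''" "P = {c. arr \<sigma> ''prot'' c = reg \<sigma> ''d''}"
  shows "wp mark_edge (\<lambda>T \<sigma>'. T \<le> 80 \<and> frame {''w''} {''mark''} \<sigma> \<sigma>' \<and>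
    arr \<sigma>' ''mark'' = (\<lambda>c. if c \<in> col (reg \<sigma> ''j'') - P then reg \<sigma> ''d'' else arr \<sigma> ''mark'' c) \<and>
    reg \<sigma>' ''w'' = (if col (reg \<sigma> ''j'') \<subseteq> P then reg \<sigma> ''w'' else 1)) \<sigma>"
proof -
  let ?j = "reg \<sigma> ''j''"
  define c1 c2 c3 where "c1 = ecol ?j + a" and "c2 = vcol (U ?j) + b" and "c3 = vcol (V ?j) + b"
  have colj: "col ?j = {c1, c2, c3}" by (simp add: col_def c1_def c2_def c3_def)
  have u: "arr \<sigma> ''ecol'' = ecol" "arr \<sigma> ''vcol'' = vcol" "arr \<sigma> ''u'' = U" "arr \<sigma> ''v'' = V" "reg \<sigma> ''a'' = a"
      "reg \<sigma> ''b'' = b"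
    using E by (simp_all add: env_def)
  have p: "arr \<sigma> ''prot'' c < reg \<sigma> ''d'' \<longleftrightarrow> c \<notin> P" for c using P(1)[of c] P(2) by auto
  note defs = mark_edge_def mark_color_def edge_color_def end_color_def wp_simps u p frame_def
    c1_def[symmetric] c2_def[symmetric] c3_def[symmetric] colj fun_eq_iff
  show ?thesis
    by (cases "c1 \<in> P"; cases "c2 \<in> P"; cases "c3 \<in> P") (auto simp: defs)
qed

text \<open>\<open>Z\<close> collects the edges retraced so far. Each has an end deeper than the
  current vertex, whereas the next edge has none; so all are different and \<open>card Z\<close> is
  the length of the retraced part.\<close>

definition trace_inv where
  "trace_inv I F P \<sigma> \<sigma>' \<longleftrightarrow> frame {''z'', ''j'', ''w''} {''mark''} \<sigma> \<sigma>' \<and> arr \<sigma> ''vis'' (reg \<sigma>' ''z'') = reg \<sigma> ''g'' \<and>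
     (\<exists>Z \<subseteq> I. finite Z \<and> card Z + arr \<sigma> ''hop'' (reg \<sigma>' ''z'') = arr \<sigma> ''hop'' (reg \<sigma> ''q'') \<and>
        (\<forall>i \<in> Z. col i \<inter> F = {} \<and> (\<exists>y \<in> ed i. arr \<sigma> ''hop'' (reg \<sigma>' ''z'') < arr \<sigma> ''hop'' y)) \<and>
        reach (ed ` Z) (card Z) (reg \<sigma>' ''z'') (reg \<sigma> ''q'') \<and>
        arr \<sigma>' ''mark'' = (\<lambda>c. if c \<in> \<Union> (col ` Z) - P then reg \<sigma> ''d'' else arr \<sigma> ''mark'' c) \<and>
        reg \<sigma>' ''w'' = (if \<Union> (col ` Z) \<subseteq> P then 0 else 1))"

lemma trace_step_wp:
  assumes E: "env \<sigma>" and T: "btree I F \<sigma>" and P: "\<And>y. arr \<sigma> ''prot'' y \<le> reg \<sigma> ''d''" "P = {c. arr \<sigma> ''prot'' c =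
      reg \<sigma> ''d''}"
    and I: "trace_inv I F P \<sigma> \<sigma>'" and z: "0 < arr \<sigma> ''hop'' (reg \<sigma>' ''z'')"
  shows "wp trace_step (\<lambda>T \<sigma>''. trace_inv I F P \<sigma> \<sigma>'' \<and>
      5 + T + 100 * arr \<sigma> ''hop'' (reg \<sigma>'' ''z'') \<le> 100 * arr \<sigma> ''hop'' (reg \<sigma>' ''z'')) \<sigma>'"
proof -
  let ?z = "reg \<sigma>' ''z''" and ?hop = "arr \<sigma> ''hop''"
  let ?j = "arr \<sigma> ''pe'' ?z" and ?y = "arr \<sigma> ''par'' ?z" and ?d = "reg \<sigma> ''d''"
  have fr: "frame {''z'', ''j'', ''w''} {''mark''} \<sigma> \<sigma>'" and vz: "arr \<sigma> ''vis'' ?z = reg \<sigma> ''g''"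
    using I by (simp_all add: trace_inv_def)
  then have a: "arr \<sigma>' x = arr \<sigma> x" if "x \<noteq> ''mark''" for x using that by (simp add: frame_def)
  have r: "reg \<sigma>' x = reg \<sigma> x" if "x \<noteq> ''z''" "x \<noteq> ''j''" "x \<noteq> ''w''" for x using that fr by (simp add: frame_def)
  obtain Z where Z: "Z \<subseteq> I" "finite Z" "card Z + ?hop ?z = ?hop (reg \<sigma> ''q'')"
    "\<And>i. i \<in> Z \<Longrightarrow> col i \<inter> F = {} \<and> (\<exists>y \<in> ed i. ?hop ?z < ?hop y)"
    "reach (ed ` Z) (card Z) ?z (reg \<sigma> ''q'')"
    "arr \<sigma>' ''mark'' = (\<lambda>c. if c \<in> \<Union> (col ` Z) - P then ?d else arr \<sigma> ''mark'' c)"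
    "reg \<sigma>' ''w'' = (if \<Union> (col ` Z) \<subseteq> P then 0 else 1)"
    using I unfolding trace_inv_def by blast
  have t: "?j \<in> I" "col ?j \<inter> F = {}" "ed ?j = {?y, ?z}" "arr \<sigma> ''vis'' ?y = reg \<sigma> ''g''" "?hop ?z = Suc (?hop ?y)"
    using T vz z by (auto simp: btree_def tree_def)
  have jZ: "?j \<notin> Z" using Z(4)[of ?j] t(3,5) by auto
  have inv: "trace_inv I F P \<sigma> \<sigma>''"
    if fr': "frame {''z'', ''j'', ''w''} {''mark''} \<sigma>' \<sigma>''" and z': "reg \<sigma>'' ''z'' = ?y"
      and mk: "arr \<sigma>'' ''mark'' = (\<lambda>c. if c \<in> col ?j - P then ?d else arr \<sigma>' ''mark'' c)"
      and w: "reg \<sigma>'' ''w'' = (if col ?j \<subseteq> P then reg \<sigma>' ''w'' else 1)" for \<sigma>''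
  proof -
    let ?Z = "insert ?j Z"
    have "frame {''z'', ''j'', ''w''} {''mark''} \<sigma> \<sigma>''"
      using frame_trans[OF fr fr', of "{''z'', ''j'', ''w''}" "{''mark''}"] by simp
    moreover have "?Z \<subseteq> I" "finite ?Z" "card ?Z + ?hop ?y = ?hop (reg \<sigma> ''q'')" using Z t jZ by simp_all
    moreover have "\<forall>i \<in> ?Z. col i \<inter> F = {} \<and> (\<exists>y \<in> ed i. ?hop ?y < ?hop y)"
    proof
      fix i assume i: "i \<in> ?Z"
      show "col i \<inter> F = {} \<and> (\<exists>y \<in> ed i. ?hop ?y < ?hop y)"
      proof (cases "i = ?j")
        case True
        then show ?thesis using t by auto
      next
        case False
        then show ?thesis using i Z(4)[of i] t(5) by (auto intro: Suc_lessD)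
      qed
    qed
    moreover have "reach (ed ` ?Z) (card ?Z) ?y (reg \<sigma> ''q'')"
    proof -
      have "reach (ed ` ?Z) (card Z) ?z (reg \<sigma> ''q'')" by (rule reach_mono[OF Z(5)]) auto
      moreover have "{?y, ?z} \<in> ed ` ?Z" using t(3) by (metis imageI insertI1)
      ultimately show ?thesis using Z(2) jZ by auto
    qed
    moreover have "arr \<sigma>'' ''mark'' = (\<lambda>c. if c \<in> \<Union> (col ` ?Z) - P then ?d else arr \<sigma> ''mark'' c)"
      unfolding mk Z(6) by (auto simp: fun_eq_iff)
    moreover have "reg \<sigma>'' ''w'' = (if \<Union> (col ` ?Z) \<subseteq> P then 0 else 1)"
      unfolding w Z(7) by auto
    ultimately show ?thesis unfolding trace_inv_def z' using t(4) by blast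
  qed
  let ?s = "\<sigma>'\<lparr>reg := (reg \<sigma>')(''j'' := ?j)\<rparr>"
  have "wp mark_edge (\<lambda>T \<sigma>'. T \<le> 80 \<and> frame {''w''} {''mark''} ?s \<sigma>' \<and>
    arr \<sigma>' ''mark'' = (\<lambda>c. if c \<in> col (reg ?s ''j'') - P then reg ?s ''d'' else arr ?s ''mark'' c) \<and>
    reg \<sigma>' ''w'' = (if col (reg ?s ''j'') \<subseteq> P then reg ?s ''w'' else 1)) ?s"
  proof (rule mark_edge_wp)
    show "env ?s" using E fr unfolding env_def frame_def by simp
  qed (use P in \<open>simp_all add: a r\<close>)
  then have "wp mark_edge (\<lambda>T \<sigma>''. T \<le> 80 \<and> trace_inv I F P \<sigma> (\<sigma>''\<lparr>reg := (reg \<sigma>'')(''z'' := ?y)\<rparr>)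
    \<and> arr \<sigma>'' ''par'' (reg \<sigma>'' ''z'') = ?y) ?s"
  proof (rule wp_mono, elim conjE, intro conjI)
    fix T \<sigma>'' assume f: "frame {''w''} {''mark''} ?s \<sigma>''"
      and mk: "arr \<sigma>'' ''mark'' = (\<lambda>c. if c \<in> col (reg ?s ''j'') - P then reg ?s ''d'' else arr ?s ''mark'' c)"
      and w: "reg \<sigma>'' ''w'' = (if col (reg ?s ''j'') \<subseteq> P then reg ?s ''w'' else 1)"
    show py: "arr \<sigma>'' ''par'' (reg \<sigma>'' ''z'') = ?y" using f by (simp add: frame_def a)
    show "trace_inv I F P \<sigma> (\<sigma>''\<lparr>reg := (reg \<sigma>'')(''z'' := ?y)\<rparr>)"
    proof (rule inv)
      show "frame {''z'', ''j'', ''w''} {''mark''} \<sigma>' (\<sigma>''\<lparr>reg := (reg \<sigma>'')(''z'' := ?y)\<rparr>)"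
        using f by (auto simp: frame_def)
    qed (simp_all add: py mk w r cong: if_cong)
  qed
  then show ?thesis
    by (simp add: trace_step_def wp_simps a) (rule wp_mono, assumption, use t(5) in simp)
qed

definition traced where
  "traced I F P p q h \<sigma> \<longleftrightarrow> h \<le> 2 * k - 1 \<and> (\<exists>Z \<subseteq> I. finite Z \<and> card Z = h \<and> (\<forall>i \<in> Z. col i \<inter> F = {}) \<and>
     reach (ed ` Z) (2 * k - 1) p q \<and> graph_state I (F \<union> (\<Union> (col ` Z) - P)) \<sigma> \<and>
     reg \<sigma> ''w'' = (if \<Union> (col ` Z) \<subseteq> P then 0 else 1))"

lemma trace_wp:
  assumes G: "graph_state I F \<sigma>" and T: "btree I F \<sigma>" and v: "arr \<sigma> ''vis'' (reg \<sigma> ''q'') = reg \<sigma> ''g''"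
    and P: "\<And>y. arr \<sigma> ''prot'' y \<le> reg \<sigma> ''d''" "P = {c. arr \<sigma> ''prot'' c = reg \<sigma> ''d''}"
  shows "wp trace (\<lambda>T \<sigma>'. frame {''z'', ''j'', ''w''} {''mark''} \<sigma> \<sigma>' \<and>
     traced I F P (reg \<sigma> ''p'') (reg \<sigma> ''q'') (arr \<sigma> ''hop'' (reg \<sigma> ''q'')) \<sigma>' \<and>
     T \<le> 100 * arr \<sigma> ''hop'' (reg \<sigma> ''q'') + 20) \<sigma>"
proof -
  let ?s = "\<sigma>\<lparr>reg := (reg \<sigma>)(''z'' := reg \<sigma> ''q'', ''w'' := 0)\<rparr>"
  have E: "env \<sigma>" using G by (simp add: graph_state_def)
  have hq: "arr \<sigma> ''hop'' (reg \<sigma> ''q'') \<le> 2 * k - 1" using T v by (simp add: btree_def tree_def)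
  have "wp (While (Less (Num 0) (Arr ''hop'' (Reg ''z''))) trace_step)
    (\<lambda>T \<sigma>'. trace_inv I F P \<sigma> \<sigma>' \<and> arr \<sigma> ''hop'' (reg \<sigma>' ''z'') = 0 \<and> T \<le> 100 * arr \<sigma> ''hop'' (reg \<sigma> ''q'') + 10) ?s"
  proof (rule wp_While[where I = "trace_inv I F P \<sigma>" and pot = "\<lambda>\<sigma>'. 100 * arr \<sigma> ''hop'' (reg \<sigma>' ''z'')"])
    show "trace_inv I F P \<sigma> ?s" unfolding trace_inv_def
      by (intro conjI exI[of _ "{}"]) (use v in \<open>auto simp: frame_def reach_refl\<close>)
    fix \<sigma>' assume I: "trace_inv I F P \<sigma> \<sigma>'"
    have h: "arr \<sigma>' ''hop'' = arr \<sigma> ''hop''" using I by (simp add: trace_inv_def frame_def)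
    show "wp trace_step (\<lambda>T \<sigma>''. trace_inv I F P \<sigma> \<sigma>'' \<and>
        1 + bcost (Less (Num 0) (Arr ''hop'' (Reg ''z''))) + T + 100 * arr \<sigma> ''hop'' (reg \<sigma>'' ''z'')
        \<le> 100 * arr \<sigma> ''hop'' (reg \<sigma>' ''z'')) \<sigma>'"
      if b: "bval (Less (Num 0) (Arr ''hop'' (Reg ''z''))) \<sigma>'"
    proof -
      have "1 + bcost (Less (Num 0) (Arr ''hop'' (Reg ''z''))) = 5" "0 < arr \<sigma> ''hop'' (reg \<sigma>' ''z'')"
        using b h by simp_all
      then show ?thesis using trace_step_wp[OF E T P I] by (simp only:)
    qed
    show "trace_inv I F P \<sigma> \<sigma>' \<and> arr \<sigma> ''hop'' (reg \<sigma>' ''z'') = 0 \<and> T \<le> 100 * arr \<sigma> ''hop'' (reg \<sigma> ''q'') + 10"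
      if "\<not> bval (Less (Num 0) (Arr ''hop'' (Reg ''z''))) \<sigma>'"
        "T \<le> 100 * arr \<sigma> ''hop'' (reg ?s ''z'') + 1 + bcost (Less (Num 0) (Arr ''hop'' (Reg ''z'')))" for T
      using that I h by simp
  qed
  then have "wp (While (Less (Num 0) (Arr ''hop'' (Reg ''z''))) trace_step)
    (\<lambda>T \<sigma>'. frame {''z'', ''j'', ''w''} {''mark''} \<sigma> \<sigma>' \<and>
     traced I F P (reg \<sigma> ''p'') (reg \<sigma> ''q'') (arr \<sigma> ''hop'' (reg \<sigma> ''q'')) \<sigma>' \<and>
     T + 6 \<le> 100 * arr \<sigma> ''hop'' (reg \<sigma> ''q'') + 20) ?s"
  proof (rule wp_mono, elim conjE, intro conjI)
    fix T' \<sigma>' assume I: "trace_inv I F P \<sigma> \<sigma>'" and z: "arr \<sigma> ''hop'' (reg \<sigma>' ''z'') = 0"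
      and T': "T' \<le> 100 * arr \<sigma> ''hop'' (reg \<sigma> ''q'') + 10"
    show fr: "frame {''z'', ''j'', ''w''} {''mark''} \<sigma> \<sigma>'" using I by (simp add: trace_inv_def)
    have zp: "reg \<sigma>' ''z'' = reg \<sigma> ''p''" using T I z by (auto simp: btree_def tree_def trace_inv_def)
    obtain Z where Z: "Z \<subseteq> I" "finite Z" "card Z = arr \<sigma> ''hop'' (reg \<sigma> ''q'')" "\<forall>i \<in> Z. col i \<inter> F = {}"
      "reach (ed ` Z) (card Z) (reg \<sigma> ''p'') (reg \<sigma> ''q'')"
      "arr \<sigma>' ''mark'' = (\<lambda>c. if c \<in> \<Union> (col ` Z) - P then reg \<sigma> ''d'' else arr \<sigma> ''mark'' c)"
      "reg \<sigma>' ''w'' = (if \<Union> (col ` Z) \<subseteq> P then 0 else 1)"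
      using I z zp unfolding trace_inv_def by auto
    have "graph_state I (F \<union> (\<Union> (col ` Z) - P)) \<sigma>'"
      using G fr Z(6) unfolding graph_state_def env_def frame_def by auto
    moreover have "reach (ed ` Z) (2 * k - 1) (reg \<sigma> ''p'') (reg \<sigma> ''q'')"
      using reach_mono[OF Z(5) subset_refl] Z(3) hq by simp
    ultimately show "traced I F P (reg \<sigma> ''p'') (reg \<sigma> ''q'') (arr \<sigma> ''hop'' (reg \<sigma> ''q'')) \<sigma>'"
      using Z hq unfolding traced_def by (intro conjI exI[of _ Z])
    show "T' + 6 \<le> 100 * arr \<sigma> ''hop'' (reg \<sigma> ''q'') + 20" using T' by simp
  qed
  then show ?thesis
    by (simp add: trace_def wp_simps) (rule wp_mono, assumption, simp)
qed

end

section \<open>Deciding about one edge\<close>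

definition try_step :: com where
  "try_step = Seq bfs
     (If (Less (Arr ''vis'' (Reg ''q'')) (Reg ''g''))
       (Seq add_edge (Assign ''go'' (Num 0)))
       (Seq trace
         (If (Less (Reg ''w'') (Num 1))
           (Assign ''go'' (Num 0))
           (Seq (Assign ''i'' (Plus (Reg ''i'') (Num 1)))
             (If (Less (Reg ''f'') (Reg ''i'')) (Assign ''go'' (Num 0)) Skip)))))"

text \<open>The number \<open>t\<close> of edges decided earlier yields a stamp that is larger than
  all stamps in \<open>mark\<close> and \<open>prot\<close>.\<close>

definition try_edge :: com where
  "try_edge = seq [
     Assign ''d'' (Plus (Reg ''t'') (Num 1)),
     Store ''prot'' (edge_color (Reg ''x'')) (Reg ''d''),
     Store ''prot'' (end_color ''u'' (Reg ''x'')) (Reg ''d''),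
     Store ''prot'' (end_color ''v'' (Reg ''x'')) (Reg ''d''),
     Assign ''p'' (Arr ''u'' (Reg ''x'')),
     Assign ''q'' (Arr ''v'' (Reg ''x'')),
     Assign ''i'' (Num 0),
     Assign ''go'' (Num 1),
     While (Less (Num 0) (Reg ''go'')) try_step]"

context greedy_input
begin

lemma cells_insert:
  assumes C: "cells I cn ce to nx first" and x: "U x \<noteq> V x"
  shows "cells (insert x I) (Suc (Suc cn)) (ce(Suc cn := x, Suc (Suc cn) := x)) (to(Suc cn := V x,
      Suc (Suc cn) := U x))
    (nx(Suc cn := first (U x), Suc (Suc cn) := first (V x))) (first(U x := Suc cn, V x := Suc (Suc cn)))"
    (is "cells _ _ ?ce ?to ?nx ?first")
proof -
  have first: "first y \<le> cn" "first y = 0 \<or> tail ce to (first y) = y" "first y < c \<Longrightarrow> c \<le> cn \<Longrightarrow>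
      tail ce to c \<noteq> y" for y c
    using C by (auto simp: cells_def)
  have tl: "tail ?ce ?to c = (if c = Suc cn then U x else if c = Suc (Suc cn) then V x else tail ce to c)" for c
    by (simp add: tail_def)
  have cell: "?ce c \<in> insert x I \<and> (?to c = U (?ce c) \<or> ?to c = V (?ce c)) \<and> ?nx c < c \<and>
        (?nx c = 0 \<or> tail ?ce ?to (?nx c) = tail ?ce ?to c) \<and>
        (\<forall>c' \<in> {?nx c<..<c}. tail ?ce ?to c' \<noteq> tail ?ce ?to c)" if c: "c \<in> {1..Suc (Suc cn)}" for c
  proof -
    consider "c \<in> {1..cn}" | "c = Suc cn" | "c = Suc (Suc cn)" using c by force
    then show ?thesis
    proof cases
      case 1
      note D = cellsD[OF C 1]
      have neq: "c \<noteq> Suc cn" "c \<noteq> Suc (Suc cn)" "nx c \<noteq> Suc cn" "nx c \<noteq> Suc (Suc cn)" using 1 D(3) by auto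
      have "tail ?ce ?to c' \<noteq> tail ?ce ?to c" if "c' \<in> {nx c<..<c}" for c'
        using D(5)[of c'] that 1 neq by (auto simp: tl)
      then show ?thesis using D(1-4) neq by (auto simp: tl)
    next
      case 2
      have "first (U x) \<noteq> Suc cn" "first (U x) \<noteq> Suc (Suc cn)" "first (U x) < Suc cn" using first(1)[of "U x"] by auto
      then show ?thesis using 2 first(2)[of "U x"] first(3)[of "U x"] by (auto simp: tl)
    next
      case 3
      have "first (V x) \<noteq> Suc cn" "first (V x) \<noteq> Suc (Suc cn)" "first (V x) < Suc (Suc cn)" using first(1)[of "V
          x"] by auto
      \<comment> \<open>The first of the two new cells has tail \<open>U x\<close>, which differs
        from \<open>V x\<close>, so the second may skip it.\<close>
      moreover have "tail ?ce ?to c' \<noteq> V x" if "first (V x) < c'" "c' < Suc (Suc cn)" for c'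
        using first(3)[of "V x" c'] that x by (cases "c' = Suc cn") (auto simp: tl)
      ultimately show ?thesis using 3 first(2)[of "V x"] x by (auto simp: tl)
    qed
  qed
  have both: "(\<exists>c \<in> {1..Suc (Suc cn)}. ?ce c = i \<and> ?to c = U i) \<and> (\<exists>c \<in> {1..Suc (Suc cn)}. ?ce c = i \<and> ?to c = V i)"
    if "i \<in> insert x I" for i
  proof (cases "i = x")
    case True
    then show ?thesis by (intro conjI bexI[of _ "Suc (Suc cn)"] bexI[of _ "Suc cn"]) auto
  next
    case False
    then have "i \<in> I" using that by simp
    then obtain c c' where c: "c \<in> {1..cn}" "ce c = i" "to c = U i" and c': "c' \<in> {1..cn}" "ce c' = i" "to c' = V i"
      using C unfolding cells_def by meson
    show ?thesis
      by (intro conjI bexI[of _ c] bexI[of _ c']) (use c c' in auto)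
  qed
  have "?first y \<le> Suc (Suc cn) \<and> (?first y = 0 \<or> tail ?ce ?to (?first y) = y) \<and>
      (\<forall>c' \<in> {?first y<..Suc (Suc cn)}. tail ?ce ?to c' \<noteq> y)" for y
  proof -
    consider "y = U x" | "y = V x" | "y \<noteq> U x" "y \<noteq> V x" by blast
    then show ?thesis
    proof cases
      case 1
      have "c' = Suc (Suc cn)" if "Suc cn < c'" "c' \<le> Suc (Suc cn)" for c' using that by simp
      then show ?thesis using 1 x by (auto simp: tl)
    next
      case 2
      then show ?thesis by (auto simp: tl)
    next
      case 3
      have "first y \<noteq> Suc cn" "first y \<noteq> Suc (Suc cn)" using first(1)[of y] by auto
      moreover have "tail ?ce ?to c' \<noteq> y" if "first y < c'" "c' \<le> Suc (Suc cn)" for c'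
        using first(3)[of y c'] that 3 by (auto simp: tl le_Suc_eq)
      ultimately show ?thesis using 3 first(1,2)[of y] by (auto simp: tl)
    qed
  qed
  then show ?thesis using cell both unfolding cells_def by blast
qed

text \<open>The equation for \<open>c\<close>, two cells per chosen edge, ties the time of a search
  to the size of the output.\<close>

definition core :: "nat set \<Rightarrow> state \<Rightarrow> bool" where
  "core I \<sigma> \<longleftrightarrow> env \<sigma> \<and>
     cells I (reg \<sigma> ''c'') (arr \<sigma> ''cell'') (arr \<sigma> ''to'') (arr \<sigma> ''next'') (arr \<sigma> ''head'') \<and>
     reg \<sigma> ''c'' = 2 * card I \<and> (\<forall>y. arr \<sigma> ''vis'' y \<le> reg \<sigma> ''g'') \<and>
     (\<forall>y. arr \<sigma> ''mark'' y \<le> reg \<sigma> ''d'') \<and> (\<forall>y. arr \<sigma> ''prot'' y \<le> reg \<sigma> ''d'') \<and>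
     distinct (output_list \<sigma>) \<and> set (output_list \<sigma>) = I"

lemma add_edge_wp:
  assumes C: "core I \<sigma>" and x: "reg \<sigma> ''x'' = x" "x \<notin> I" "U x \<noteq> V x" "reg \<sigma> ''p'' = U x" "reg \<sigma> ''q'' = V x"
  shows "wp add_edge (\<lambda>T \<sigma>'. frame {''s'', ''c''} {''out'', ''cell'', ''to'', ''next'', ''head''} \<sigma> \<sigma>' \<and>
    core (insert x I) \<sigma>' \<and> output_list \<sigma>' = output_list \<sigma> @ [x] \<and> T \<le> 60) \<sigma>"
proof -
  let ?c = "reg \<sigma> ''c''" and ?s = "reg \<sigma> ''s''"
  let ?s' = "\<sigma>\<lparr>reg := (reg \<sigma>)(''s'' := Suc ?s, ''c'' := Suc (Suc ?c)),
    arr := (arr \<sigma>)(''out'' := (arr \<sigma> ''out'')(?s := x),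
      ''cell'' := (arr \<sigma> ''cell'')(Suc ?c := x, Suc (Suc ?c) := x),
      ''to'' := (arr \<sigma> ''to'')(Suc ?c := V x, Suc (Suc ?c) := U x),
      ''next'' := (arr \<sigma> ''next'')(Suc ?c := arr \<sigma> ''head'' (U x), Suc (Suc ?c) := arr \<sigma> ''head'' (V x)),
      ''head'' := (arr \<sigma> ''head'')(U x := Suc ?c, V x := Suc (Suc ?c)))\<rparr>"
  have out: "output_list ?s' = output_list \<sigma> @ [x]" by (auto simp: output_list_def)
  have fin: "finite I" using C unfolding core_def by (metis List.finite_set)
  have cell: "cells I (reg \<sigma> ''c'') (arr \<sigma> ''cell'') (arr \<sigma> ''to'') (arr \<sigma> ''next'') (arr \<sigma> ''head'')"
    using C unfolding core_def by blast
  have "core (insert x I) ?s'"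
    using C x(2) fin cells_insert[OF cell x(3)] unfolding core_def out by (auto simp: env_def)
  moreover have "frame {''s'', ''c''} {''out'', ''cell'', ''to'', ''next'', ''head''} \<sigma> ?s'"
    by (simp add: frame_def)
  moreover have "wp add_edge (\<lambda>T \<sigma>'. \<sigma>' = ?s' \<and> T \<le> 60) \<sigma>"
    using x by (simp add: add_edge_def wp_simps)
  ultimately show ?thesis using out by (elim wp_mono) simp
qed

text \<open>Only the number of deleted colors, their disjointness from \<open>col x\<close> and the
  separation are remembered; this is all that the size bound uses.\<close>

definition accepted :: "nat set \<Rightarrow> nat \<Rightarrow> bool" where
  "accepted I x \<longleftrightarrow> (\<exists>F. finite F \<and> card F \<le> 6 * k * f \<and> F \<inter> col x = {} \<and> \<not> reach (alive I F) (2 * k - 1) (U x) (V x))"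

definition rejected :: "nat set \<Rightarrow> nat \<Rightarrow> bool" where
  "rejected I x \<longleftrightarrow> (\<forall>F. finite F \<longrightarrow> card F \<le> f \<longrightarrow> F \<inter> col x = {} \<longrightarrow> reach (alive I F) (2 * k - 1) (U x) (V x))"

text \<open>
  The last conjunct is the certificate for rejecting \<open>x\<close>: the paths found so far use disjoint sets of deleted
  colors, so a fault set that hits all of them has at least \<open>i\<close> colors. The bound by the number of edges that
  are still alive keeps the number of rounds polynomial when \<open>f\<close> is huge.
\<close>

definition faults :: "nat set \<Rightarrow> nat \<Rightarrow> nat \<Rightarrow> nat set \<Rightarrow> bool" where
  "faults I x i F \<longleftrightarrow> finite F \<and> F \<inter> col x = {} \<and> card F \<le> 6 * k * i \<and> i + card {j \<in> I. col j \<inter> F = {}} \<le> card I \<and>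
     (\<forall>F'. finite F' \<longrightarrow> F' \<inter> col x = {} \<longrightarrow> \<not> reach (alive I F') (2 * k - 1) (U x) (V x) \<longrightarrow> i \<le> card (F' \<inter> F))"

lemma ed_alive: "Z \<subseteq> I \<Longrightarrow> F \<inter> \<Union> (col ` Z) = {} \<Longrightarrow> ed ` Z \<subseteq> alive I F"
  unfolding alive_def by blast

text \<open>A fault set that separates the ends must hit the new path. The color that it hits is not
  in \<open>F\<close>, because the path was alive, and not among the colors of \<open>x\<close>; so
  it is a new element of the intersection. By \<open>new\<close>, some edge of the path is killed,
  which balances the increase of \<open>i\<close>.\<close>

lemma faults_step:
  assumes F: "faults I x i F" and fin: "finite I"
    and Z: "Z \<subseteq> I" "card Z \<le> 2 * k - 1" "\<forall>i \<in> Z. col i \<inter> F = {}" "reach (ed ` Z) (2 * k - 1) (U x) (V x)"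
    and new: "\<not> \<Union> (col ` Z) \<subseteq> col x"
  shows "faults I x (Suc i) (F \<union> (\<Union> (col ` Z) - col x))"
proof -
  let ?F = "F \<union> (\<Union> (col ` Z) - col x)"
  have fZ: "finite Z" using Z(1) fin finite_subset by auto
  have fcol: "finite (\<Union> (col ` Z))" using fZ by (simp add: col_def)
  have "card (\<Union> (col ` Z)) \<le> (\<Sum>j\<in>Z. card (col j))" by (rule card_UN_le[OF fZ])
  also have "\<dots> \<le> (\<Sum>j\<in>Z. 3)" by (intro sum_mono) (simp add: col_def card_insert_if)
  also have "\<dots> \<le> 6 * k" using Z(2) by simp
  finally have "card (\<Union> (col ` Z) - col x) \<le> 6 * k" using card_mono[OF fcol, of "\<Union> (col ` Z) - col x"] by auto
  then have "card ?F \<le> 6 * k * Suc i"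
    using card_Un_le[of F "\<Union> (col ` Z) - col x"] F by (simp add: faults_def)
  moreover have "card {j \<in> I. col j \<inter> ?F = {}} < card {j \<in> I. col j \<inter> F = {}}"
  proof (rule psubset_card_mono)
    obtain j where j: "j \<in> Z" "\<not> col j \<subseteq> col x" using new by blast
    then have "j \<in> {j \<in> I. col j \<inter> F = {}}" "j \<notin> {j \<in> I. col j \<inter> ?F = {}}" using Z by auto
    moreover have "{j \<in> I. col j \<inter> ?F = {}} \<subseteq> {j \<in> I. col j \<inter> F = {}}" by auto
    ultimately show "{j \<in> I. col j \<inter> ?F = {}} \<subset> {j \<in> I. col j \<inter> F = {}}" by blast
  qed (use fin in auto)
  moreover have "Suc i \<le> card (F' \<inter> ?F)"
    if F': "finite F'" "F' \<inter> col x = {}" "\<not> reach (alive I F') (2 * k - 1) (U x) (V x)" for F'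
  proof -
    have "F' \<inter> \<Union> (col ` Z) \<noteq> {}"
    proof
      assume "F' \<inter> \<Union> (col ` Z) = {}"
      then have "reach (alive I F') (2 * k - 1) (U x) (V x)"
        using reach_mono[OF Z(4) ed_alive[OF Z(1)]] by simp
      then show False using F'(3) by simp
    qed
    then obtain c where c: "c \<in> F'" "c \<in> \<Union> (col ` Z)" by blast
    have "c \<notin> F" using c(2) Z(3) by blast
    have "i \<le> card (F' \<inter> F)" using F F' by (simp add: faults_def)
    also have "Suc (card (F' \<inter> F)) = card (insert c (F' \<inter> F))" using F'(1) \<open>c \<notin> F\<close> by simp
    also have "\<dots> \<le> card (F' \<inter> ?F)" by (rule card_mono) (use F' c in auto)
    finally show ?thesis by simp
  qed
  ultimately show ?thesis using F fcol unfolding faults_def by auto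
qed

abbreviation try_regs :: "string set" where
  "try_regs \<equiv> bfs_regs \<union> {''w'', ''s'', ''c'', ''go'', ''i''}"

abbreviation try_arrs :: "string set" where
  "try_arrs \<equiv> bfs_arrs \<union> {''mark'', ''out'', ''cell'', ''to'', ''next'', ''head''}"

definition finished :: "nat list \<Rightarrow> nat \<Rightarrow> state \<Rightarrow> bool" where
  "finished xs x \<sigma> \<longleftrightarrow> (output_list \<sigma> = xs @ [x] \<and> core (insert x (set xs)) \<sigma> \<and> accepted (set xs) x) \<or>
     (output_list \<sigma> = xs \<and> core (set xs) \<sigma> \<and> rejected (set xs) x)"

definition try_inv :: "nat list \<Rightarrow> nat \<Rightarrow> state \<Rightarrow> state \<Rightarrow> bool" where
  "try_inv xs x \<sigma> \<sigma>' \<longleftrightarrow> frame try_regs try_arrs \<sigma> \<sigma>' \<and>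
     (if reg \<sigma>' ''go'' = 0 then finished xs x \<sigma>'
      else output_list \<sigma>' = xs \<and> core (set xs) \<sigma>' \<and> reg \<sigma>' ''i'' \<le> f \<and>
        faults (set xs) x (reg \<sigma>' ''i'') {c. arr \<sigma>' ''mark'' c = reg \<sigma>' ''d''})"

lemma core_graph_state: "core I \<sigma> \<Longrightarrow> graph_state I {c. arr \<sigma> ''mark'' c = reg \<sigma> ''d''} \<sigma>"
  unfolding core_def graph_state_def by blast

lemma output_list_frame:
  "frame R A \<sigma> \<sigma>' \<Longrightarrow> ''s'' \<notin> R \<Longrightarrow> ''out'' \<notin> A \<Longrightarrow> output_list \<sigma>' = output_list \<sigma>"
  by (simp add: output_list_def frame_def)

lemma core_frame:
  assumes C: "core I \<sigma>" and fr: "frame R A \<sigma> \<sigma>'" "R \<subseteq> bfs_regs \<union> {''w'', ''go'', ''i''}" "A \<subseteq> bfs_arrs \<union> {''mark''}"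
    and vis: "\<And>y. arr \<sigma>' ''vis'' y \<le> reg \<sigma>' ''g''" and mark: "\<And>y. arr \<sigma>' ''mark'' y \<le> reg \<sigma>' ''d''"
  shows "core I \<sigma>'"
proof -
  note fr' = frame_trans[OF frame_refl fr(1) empty_subsetI fr(2) empty_subsetI fr(3)]
  note r = frame_reg[OF fr'] and a = frame_arr[OF fr']
  have "output_list \<sigma>' = output_list \<sigma>" using r[of "''s''"] a[of "''out''"] by (simp add: output_list_def)
  moreover have "env \<sigma>' = env \<sigma>" using frame_rarr[OF fr(1)] by (simp add: env_def r a)
  moreover have "reg \<sigma>' ''c'' = reg \<sigma> ''c''" "reg \<sigma>' ''d'' = reg \<sigma> ''d''" "arr \<sigma>' ''cell'' = arr \<sigma> ''cell''"
    "arr \<sigma>' ''to'' = arr \<sigma> ''to''" "arr \<sigma>' ''next'' = arr \<sigma> ''next''" "arr \<sigma>' ''head'' = arr \<sigma> ''head''"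
    "arr \<sigma>' ''prot'' = arr \<sigma> ''prot''" by (simp_all add: r a)
  ultimately show ?thesis using C vis mark unfolding core_def by metis
qed

lemma core_upd [simp]:
  "x \<in> {''go'', ''i''} \<Longrightarrow> core I (\<sigma>\<lparr>reg := (reg \<sigma>)(x := v)\<rparr>) \<longleftrightarrow> core I \<sigma>"
  by (auto simp: core_def env_def output_list_def)

lemma output_list_upd [simp]:
  "x \<noteq> ''s'' \<Longrightarrow> output_list (\<sigma>\<lparr>reg := (reg \<sigma>)(x := v)\<rparr>) = output_list \<sigma>"
  by (simp add: output_list_def)

lemma try_step_wp:
  assumes x: "reg \<sigma> ''x'' = x" "x \<notin> set xs" "U x \<noteq> V x" "reg \<sigma> ''p'' = U x" "reg \<sigma> ''q'' = V x"
    and P: "col x = {c. arr \<sigma> ''prot'' c = reg \<sigma> ''d''}"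
    and I: "try_inv xs x \<sigma> \<sigma>'" and go: "0 < reg \<sigma>' ''go''"
  shows "wp try_step (\<lambda>T \<sigma>''. try_inv xs x \<sigma> \<sigma>'' \<and> T \<le> 400 * length xs + 200 \<and>
     (reg \<sigma>'' ''go'' \<noteq> 0 \<longrightarrow> reg \<sigma>'' ''i'' = Suc (reg \<sigma>' ''i''))) \<sigma>'"
proof -
  let ?I = "set xs" and ?i = "reg \<sigma>' ''i''"
  define F where "F = {c. arr \<sigma>' ''mark'' c = reg \<sigma>' ''d''}"
  have fr: "frame try_regs try_arrs \<sigma> \<sigma>'" and out: "output_list \<sigma>' = xs" and C: "core ?I \<sigma>'" and i: "?i \<le> f"
    and F: "faults ?I x ?i F" using I go unfolding try_inv_def F_def by auto
  have G: "graph_state ?I F \<sigma>'" using core_graph_state[OF C] unfolding F_def .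
  have dist: "distinct xs" and cI: "card ?I = length xs" and cc: "reg \<sigma>' ''c'' = 2 * length xs"
    and vis: "\<And>y. arr \<sigma>' ''vis'' y \<le> reg \<sigma>' ''g''"
    using C out unfolding core_def by (auto simp: distinct_card)
  have x': "reg \<sigma>' ''x'' = x" "reg \<sigma>' ''p'' = U x" "reg \<sigma>' ''q'' = V x" "reg \<sigma>' ''d'' = reg \<sigma> ''d''" "arr \<sigma>'
      ''prot'' = arr \<sigma> ''prot''"
    using fr x by (simp_all add: frame_def)
  show ?thesis unfolding try_step_def wp_Seq[of bfs]
  proof (rule wp_mono[OF bfs_wp[OF G vis]], elim conjE)
    fix T1 \<sigma>1 assume fr1: "frame bfs_regs bfs_arrs \<sigma>' \<sigma>1" and T: "btree ?I F \<sigma>1"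
      and comp: "\<forall>y. reach (alive ?I F) (2 * k - 1) (reg \<sigma>' ''p'') y \<longrightarrow> arr \<sigma>1 ''vis'' y = reg \<sigma>1 ''g''"
      and T1: "T1 \<le> 140 * reg \<sigma>' ''c'' + 100"
    have fr01: "frame try_regs try_arrs \<sigma> \<sigma>1" by (rule frame_trans[OF fr fr1]) auto
    have vis1: "\<And>y. arr \<sigma>1 ''vis'' y \<le> reg \<sigma>1 ''g''" using T by (simp add: btree_def tree_def)
    have G1: "graph_state ?I F \<sigma>1" using graph_state_frame[OF fr1 subset_refl subset_refl] G by blast
    have C1: "core ?I \<sigma>1"
      by (rule core_frame[OF C fr1 _ _ vis1]) (use G1 in \<open>auto simp: graph_state_def\<close>)
    have out1: "output_list \<sigma>1 = xs" using output_list_frame[OF fr1] out by simp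
    have x1: "reg \<sigma>1 ''x'' = x" "reg \<sigma>1 ''p'' = U x" "reg \<sigma>1 ''q'' = V x" "reg \<sigma>1 ''i'' = ?i"
      "reg \<sigma>1 ''d'' = reg \<sigma> ''d''" "arr \<sigma>1 ''prot'' = arr \<sigma> ''prot''" "reg \<sigma>1 ''f'' = f"
      using fr1 x' G1 by (simp_all add: frame_def graph_state_def env_def)
    let ?post = "\<lambda>(T::nat) \<sigma>''. try_inv xs x \<sigma> \<sigma>'' \<and> T \<le> 400 * length xs + 200 \<and>
     (reg \<sigma>'' ''go'' \<noteq> 0 \<longrightarrow> reg \<sigma>'' ''i'' = Suc (reg \<sigma>' ''i''))"
    show "wp (If (Less (Arr ''vis'' (Reg ''q'')) (Reg ''g''))
       (Seq add_edge (Assign ''go'' (Num 0)))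
       (Seq trace
         (If (Less (Reg ''w'') (Num 1))
           (Assign ''go'' (Num 0))
           (Seq (Assign ''i'' (Plus (Reg ''i'') (Num 1)))
             (If (Less (Reg ''f'') (Reg ''i'')) (Assign ''go'' (Num 0)) Skip)))))
       (\<lambda>U. ?post (T1 + U)) \<sigma>1"
    proof (cases "arr \<sigma>1 ''vis'' (V x) < reg \<sigma>1 ''g''")
      case True
      have "\<not> reach (alive ?I F) (2 * k - 1) (U x) (V x)" using comp True x' by auto
      moreover have "6 * k * ?i \<le> 6 * k * f" using i by simp
      ultimately have acc: "accepted ?I x" using F unfolding accepted_def faults_def by (meson order_trans)
      have "wp add_edge (\<lambda>T2 \<sigma>2. ?post (T1 + (1 + 4 + (T2 + 2))) (\<sigma>2\<lparr>reg := (reg \<sigma>2)(''go'' := 0)\<rparr>)) \<sigma>1"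
      proof (rule wp_mono[OF add_edge_wp[OF C1 x1(1) x(2,3) x1(2,3)]], elim conjE)
        fix T2 :: nat and \<sigma>2 assume fr2: "frame {''s'', ''c''} {''out'', ''cell'', ''to'', ''next'', ''head''} \<sigma>1 \<sigma>2"
          and C2: "core (insert x ?I) \<sigma>2" and out2: "output_list \<sigma>2 = output_list \<sigma>1 @ [x]" and T2: "T2 \<le> 60"
        have "frame try_regs try_arrs \<sigma> \<sigma>2" by (rule frame_trans[OF fr01 fr2]) auto
        then have "frame try_regs try_arrs \<sigma> (\<sigma>2\<lparr>reg := (reg \<sigma>2)(''go'' := 0)\<rparr>)" by (auto simp: frame_def)
        then have "try_inv xs x \<sigma> (\<sigma>2\<lparr>reg := (reg \<sigma>2)(''go'' := 0)\<rparr>)"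
          using C2 out2 out1 acc unfolding try_inv_def finished_def by simp
        then show "?post (T1 + (1 + 4 + (T2 + 2))) (\<sigma>2\<lparr>reg := (reg \<sigma>2)(''go'' := 0)\<rparr>)" using T1 T2 cc by simp
      qed
      then show ?thesis using True x1 by (simp add: wp_simps)
    next
      case False
      then have vq: "arr \<sigma>1 ''vis'' (reg \<sigma>1 ''q'') = reg \<sigma>1 ''g''" using vis1[of "V x"] x1 by simp
      have prot: "\<And>y. arr \<sigma>1 ''prot'' y \<le> reg \<sigma>1 ''d''" "col x = {c. arr \<sigma>1 ''prot'' c = reg \<sigma>1 ''d''}"
        using C1 P x1 by (simp_all add: core_def)
      let ?rest = "If (Less (Reg ''w'') (Num 1))
           (Assign ''go'' (Num 0))
           (Seq (Assign ''i'' (Plus (Reg ''i'') (Num 1)))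
             (If (Less (Reg ''f'') (Reg ''i'')) (Assign ''go'' (Num 0)) Skip))"
      have "wp trace (\<lambda>T2. wp ?rest (\<lambda>T3. ?post (T1 + (1 + 4 + (T2 + T3))))) \<sigma>1"
      proof (rule wp_mono[OF trace_wp[OF G1 T vq prot]], elim conjE)
        fix T2 :: nat and \<sigma>2 assume fr2: "frame {''z'', ''j'', ''w''} {''mark''} \<sigma>1 \<sigma>2"
          and tr: "traced ?I F (col x) (reg \<sigma>1 ''p'') (reg \<sigma>1 ''q'') (arr \<sigma>1 ''hop'' (reg \<sigma>1 ''q'')) \<sigma>2"
          and T2: "T2 \<le> 100 * arr \<sigma>1 ''hop'' (reg \<sigma>1 ''q'') + 20"
        obtain Z where Z: "Z \<subseteq> ?I" "finite Z" "card Z = arr \<sigma>1 ''hop'' (reg \<sigma>1 ''q'')" "card Z \<le> 2 * k - 1"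
          "\<forall>i \<in> Z. col i \<inter> F = {}" "reach (ed ` Z) (2 * k - 1) (U x) (V x)"
          "graph_state ?I (F \<union> (\<Union> (col ` Z) - col x)) \<sigma>2" "reg \<sigma>2 ''w'' = (if \<Union> (col ` Z) \<subseteq> col x then 0 else 1)"
          using tr x1 unfolding traced_def by auto
        \<comment> \<open>A path has no more edges than the current spanner, so retracing takes O(s)
          steps however large \<open>k\<close> is.\<close>
        have "card Z \<le> length xs" using card_mono[OF _ Z(1)] cI by simp
        then have T2': "T2 \<le> 100 * length xs + 20" using T2 Z(3) by simp
        have fr02: "frame try_regs try_arrs \<sigma> \<sigma>2" by (rule frame_trans[OF fr01 fr2]) auto
        have C2: "core ?I \<sigma>2"
          by (rule core_frame[OF C1 fr2]) (use Z(7) fr2 vis1 in \<open>auto simp: graph_state_def frame_def\<close>)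
        have out2: "output_list \<sigma>2 = xs" using output_list_frame[OF fr2] out1 by simp
        have x2: "reg \<sigma>2 ''i'' = ?i" "reg \<sigma>2 ''f'' = f" using fr2 x1 by (simp_all add: frame_def)
        have F2: "{c. arr \<sigma>2 ''mark'' c = reg \<sigma>2 ''d''} = F \<union> (\<Union> (col ` Z) - col x)"
          using Z(7) by (simp add: graph_state_def)
        have fr_go: "frame try_regs try_arrs \<sigma> (\<sigma>2\<lparr>reg := (reg \<sigma>2)(''go'' := 0)\<rparr>)"
          "frame try_regs try_arrs \<sigma> (\<sigma>2\<lparr>reg := (reg \<sigma>2)(''i'' := v)\<rparr>)"
          "frame try_regs try_arrs \<sigma> (\<sigma>2\<lparr>reg := (reg \<sigma>2)(''i'' := v, ''go'' := 0)\<rparr>)" for v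
          using fr02 by (auto simp: frame_def)
        show "wp ?rest (\<lambda>T3. ?post (T1 + (1 + 4 + (T2 + T3)))) \<sigma>2"
        proof (cases "\<Union> (col ` Z) \<subseteq> col x")
          case True
          \<comment> \<open>Faults that spare \<open>x\<close> cannot hit this path, since it has no
            other colors.\<close>
          have "rejected ?I x" unfolding rejected_def
          proof (intro allI impI)
            fix F' assume "F' \<inter> col x = {}"
            then have "F' \<inter> \<Union> (col ` Z) = {}" using True by blast
            then show "reach (alive ?I F') (2 * k - 1) (U x) (V x)"
              using reach_mono[OF Z(6) ed_alive[OF Z(1)]] by simp
          qed
          then have "try_inv xs x \<sigma> (\<sigma>2\<lparr>reg := (reg \<sigma>2)(''go'' := 0)\<rparr>)"
            using C2 out2 fr_go unfolding try_inv_def finished_def by simp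
          then show ?thesis using True Z(8) T1 T2' cc by (simp add: wp_simps)
        next
          case False
          have F': "faults ?I x (Suc ?i) (F \<union> (\<Union> (col ` Z) - col x))"
            by (rule faults_step[OF F _ Z(1,4,5,6) False]) simp
          show ?thesis
          proof (cases "f < Suc ?i")
            case True
            then have fi: "?i = f" using i by simp
            \<comment> \<open>After f + 1 paths a separating fault set would contain f + 1 different
              colors.\<close>
            have "rejected ?I x" unfolding rejected_def
            proof (intro allI impI)
              fix F'' :: "nat set" assume F'': "finite F''" "card F'' \<le> f" "F'' \<inter> col x = {}"
              show "reach (alive ?I F'') (2 * k - 1) (U x) (V x)"
              proof (rule ccontr)
                assume "\<not> reach (alive ?I F'') (2 * k - 1) (U x) (V x)"
                then have "Suc ?i \<le> card (F'' \<inter> (F \<union> (\<Union> (col ` Z) - col x)))"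
                  using F' F'' unfolding faults_def by blast
                also have "\<dots> \<le> card F''" using F'' by (intro card_mono) auto
                finally show False using F'' fi by simp
              qed
            qed
            then have "try_inv xs x \<sigma> (\<sigma>2\<lparr>reg := (reg \<sigma>2)(''i'' := Suc ?i, ''go'' := 0)\<rparr>)"
              using C2 out2 fr_go core_upd[of "''i''" _ \<sigma>2 "Suc ?i"]
                core_upd[of "''go''" _ "\<sigma>2\<lparr>reg := (reg \<sigma>2)(''i'' := Suc ?i)\<rparr>" 0]
                output_list_upd[of "''i''" \<sigma>2 "Suc ?i"]
                output_list_upd[of "''go''" "\<sigma>2\<lparr>reg := (reg \<sigma>2)(''i'' := Suc ?i)\<rparr>" 0]
              unfolding try_inv_def finished_def by simp
            then show ?thesis using True False Z(8) T1 T2' cc x2 by (simp add: wp_simps)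
          next
            case f: False
            let ?s = "\<sigma>2\<lparr>reg := (reg \<sigma>2)(''i'' := Suc ?i)\<rparr>"
            have "reg \<sigma>2 ''go'' \<noteq> 0" using go fr1 fr2 by (simp add: frame_def)
            then have "try_inv xs x \<sigma> ?s" using C2 out2 fr_go F' f F2 unfolding try_inv_def by simp
            then show ?thesis using f False Z(8) T1 T2' cc x2 by (simp add: wp_simps)
          qed
        qed
      qed
      then show ?thesis using False x1
        by (simp add: wp_Seq[of trace] wp_If[of "Less (Arr ''vis'' (Reg ''q'')) (Reg ''g'')"])
    qed
  qed
qed

lemma try_edge_wp:
  assumes C: "core (set xs) \<sigma>" and out: "output_list \<sigma> = xs" and d: "reg \<sigma> ''d'' \<le> reg \<sigma> ''t''"
    and x: "reg \<sigma> ''x'' = x" "x \<notin> set xs" "U x \<noteq> V x"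
  shows "wp try_edge (\<lambda>T \<sigma>'. frame (try_regs \<union> {''d'', ''p'', ''q''}) (try_arrs \<union> {''prot''}) \<sigma> \<sigma>' \<and>
     reg \<sigma>' ''d'' = Suc (reg \<sigma> ''t'') \<and> finished xs x \<sigma>' \<and>
     T \<le> (min f (length xs) + 1) * (400 * length xs + 210) + 100) \<sigma>"
proof -
  let ?d = "Suc (reg \<sigma> ''t'')"
  let ?s = "\<sigma>\<lparr>arr := (arr \<sigma>)(''prot'' := (arr \<sigma> ''prot'')(ecol x + a := ?d, vcol (U x) + b := ?d, vcol (V x) +
      b := ?d)),
    reg := (reg \<sigma>)(''d'' := ?d, ''p'' := U x, ''q'' := V x, ''i'' := 0, ''go'' := 1)\<rparr>"
  let ?K = "400 * length xs + 210"
  \<comment> \<open>While the edge is undecided, \<open>i\<close> is at most \<open>f\<close> and at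
    most the number of spanner edges, since each success kills one; this limits the rounds to
    \<open>min f (length xs) + 1\<close>.\<close>
  let ?pot = "\<lambda>\<sigma>'. if reg \<sigma>' ''go'' = 0 then 0 else (min f (length xs) + 1 - reg \<sigma>' ''i'') * ?K"
  have E: "env \<sigma>" using C by (simp add: core_def)
  have le: "arr \<sigma> ''mark'' y < ?d" "arr \<sigma> ''prot'' y < ?d" for y
    using C d unfolding core_def by (meson le_imp_less_Suc order_trans)+
  have cI: "card (set xs) = length xs" using C out by (auto simp: core_def distinct_card)
  have P: "col x = {c. arr ?s ''prot'' c = reg ?s ''d''}" using le by (auto simp: col_def nat_less_le)
  have xs: "reg ?s ''x'' = x" "reg ?s ''p'' = U x" "reg ?s ''q'' = V x" using x by simp_all
  have C': "core (set xs) ?s"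
  proof -
    have "output_list ?s = output_list \<sigma>" "env ?s = env \<sigma>" by (simp_all add: output_list_def env_def)
    moreover have "arr ?s ''mark'' y \<le> reg ?s ''d''" "arr ?s ''prot'' y \<le> reg ?s ''d''" for y
      using le[of y] by auto
    ultimately show ?thesis using C unfolding core_def by auto
  qed
  have out': "output_list ?s = xs" using out by (simp add: output_list_def)
  have "wp (While (Less (Num 0) (Reg ''go'')) try_step)
    (\<lambda>T \<sigma>'. try_inv xs x ?s \<sigma>' \<and> reg \<sigma>' ''go'' = 0 \<and> T \<le> (min f (length xs) + 1) * ?K + 4) ?s"
  proof (rule wp_While[where I = "try_inv xs x ?s" and pot = ?pot])
    have no: "{c. arr ?s ''mark'' c = reg ?s ''d''} = {}" using le by (auto simp: nat_less_le)
    have "faults (set xs) x 0 {}" by (simp add: faults_def)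
    then show "try_inv xs x ?s ?s" unfolding try_inv_def using C' out' no by (simp add: frame_refl)
  next
    fix \<sigma>' assume I: "try_inv xs x ?s \<sigma>'" and b: "bval (Less (Num 0) (Reg ''go'')) \<sigma>'"
    then have go: "0 < reg \<sigma>' ''go''" by simp
    show "wp try_step (\<lambda>T \<sigma>''. try_inv xs x ?s \<sigma>'' \<and> 1 + bcost (Less (Num 0) (Reg ''go'')) + T +
        ?pot \<sigma>'' \<le> ?pot \<sigma>') \<sigma>'"
    proof (rule wp_mono[OF try_step_wp[OF xs(1) x(2,3) xs(2,3) P I go]], elim conjE)
      fix T \<sigma>'' assume I': "try_inv xs x ?s \<sigma>''" and T: "T \<le> 400 * length xs + 200"
        and i: "reg \<sigma>'' ''go'' \<noteq> 0 \<longrightarrow> reg \<sigma>'' ''i'' = Suc (reg \<sigma>' ''i'')"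
      have bd: "reg s ''i'' \<le> min f (length xs)" if "try_inv xs x ?s s" "reg s ''go'' \<noteq> 0" for s
        using that cI by (auto simp: try_inv_def faults_def)
      have "4 + T + ?pot \<sigma>'' \<le> ?pot \<sigma>'"
      proof (cases "reg \<sigma>'' ''go'' = 0")
        case True
        have "4 + T \<le> 1 * ?K" using T by simp
        also have "1 * ?K \<le> (min f (length xs) + 1 - reg \<sigma>' ''i'') * ?K"
          using bd[OF I] go by (intro mult_right_mono) auto
        finally show ?thesis using True go by simp
      next
        case False
        then have "reg \<sigma>'' ''i'' = Suc (reg \<sigma>' ''i'')" "Suc (reg \<sigma>' ''i'') \<le> min f (length xs)" using i bd[OF I']
            by auto
        then have "min f (length xs) + 1 - reg \<sigma>' ''i'' = Suc (min f (length xs) + 1 - reg \<sigma>'' ''i'')" by linarith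
        then show ?thesis using False T go by simp
      qed
      then show "try_inv xs x ?s \<sigma>'' \<and> 1 + bcost (Less (Num 0) (Reg ''go'')) + T + ?pot \<sigma>'' \<le> ?pot \<sigma>'"
        using I' by simp
    qed
  next
    fix T \<sigma>' assume "try_inv xs x ?s \<sigma>'" "\<not> bval (Less (Num 0) (Reg ''go'')) \<sigma>'" "T \<le> ?pot ?s + 1 +
        bcost (Less (Num 0) (Reg ''go''))"
    then show "try_inv xs x ?s \<sigma>' \<and> reg \<sigma>' ''go'' = 0 \<and> T \<le> (min f (length xs) + 1) * ?K + 4" by simp
  qed
  then have "wp (While (Less (Num 0) (Reg ''go'')) try_step)
    (\<lambda>T \<sigma>'. frame (try_regs \<union> {''d'', ''p'', ''q''}) (try_arrs \<union> {''prot''}) \<sigma> \<sigma>' \<and>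
     reg \<sigma>' ''d'' = ?d \<and> finished xs x \<sigma>' \<and> T + 60 \<le> (min f (length xs) + 1) * ?K + 100) ?s"
  proof (rule wp_mono, elim conjE, intro conjI)
    fix T \<sigma>' assume I: "try_inv xs x ?s \<sigma>'" "reg \<sigma>' ''go'' = 0" and T: "T \<le> (min f (length xs) + 1) * ?K + 4"
    have f: "frame try_regs try_arrs ?s \<sigma>'" using I by (simp add: try_inv_def)
    have "frame {''d'', ''p'', ''q'', ''i'', ''go''} {''prot''} \<sigma> ?s" by (simp add: frame_def)
    from frame_trans[OF this f]
    show "frame (try_regs \<union> {''d'', ''p'', ''q''}) (try_arrs \<union> {''prot''}) \<sigma> \<sigma>'" by auto
    show "reg \<sigma>' ''d'' = ?d" using f by (simp add: frame_def)
    show "finished xs x \<sigma>'" using I by (simp add: try_inv_def)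
    show "T + 60 \<le> (min f (length xs) + 1) * ?K + 100" using T by simp
  qed
  then have w: "wp (While (Less (Num 0) (Reg ''go'')) try_step) (\<lambda>T \<sigma>'.
     frame (try_regs \<union> {''d'', ''p'', ''q''}) (try_arrs \<union> {''prot''}) \<sigma> \<sigma>' \<and>
     reg \<sigma>' ''d'' = ?d \<and> finished xs x \<sigma>' \<and> 34 + T \<le> (min f (length xs) + 1) * ?K + 100) ?s"
    by (rule wp_mono) (elim conjE, intro conjI, assumption+, linarith)
  have "wp try_edge Q \<sigma> \<longleftrightarrow> wp (While (Less (Num 0) (Reg ''go'')) try_step) (\<lambda>T. Q (34 + T)) ?s" for Q
    using E x by (simp add: try_edge_def wp_simps edge_color_def end_color_def env_def numeral_eq_Suc)
  then show ?thesis using w by (simp only:)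
qed

end

section \<open>Selecting the next edge\<close>

text \<open>
  Edge indices are split into \<open>r\<close> residue classes modulo \<open>r\<close>, where \<open>r\<close> is about the square root of \<open>m\<close>, and
  \<open>best\<close> holds a lightest remaining edge of each class, or \<open>m\<close> if there is none. Residue classes instead of
  intervals avoid the multiplication that the machine lacks.
\<close>

definition better :: "aexp \<Rightarrow> bexp" where
  "better c = Neg (Conj (Less (Reg ''v'') (Reg ''m'')) (Neg (RLess (RArr ''w'' c) (RArr ''w'' (Reg ''v'')))))"

definition rescan :: com where
  "rescan = seq [
     Assign ''j'' (Reg ''y''),
     Assign ''v'' (Reg ''m''),
     While (Less (Reg ''j'') (Reg ''m'')) (seq [
       If (Conj (Less (Arr ''done'' (Reg ''j'')) (Num 1)) (better (Reg ''j''))) (Assign ''v'' (Reg ''j'')) Skip,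
       Assign ''j'' (Plus (Reg ''j'') (Reg ''r''))]),
     Store ''best'' (Reg ''y'') (Reg ''v'')]"

definition select :: com where
  "select = seq [
     Assign ''h'' (Num 0),
     Assign ''v'' (Reg ''m''),
     While (Less (Reg ''h'') (Reg ''r'')) (seq [
       Assign ''j'' (Arr ''best'' (Reg ''h'')),
       If (Conj (Less (Reg ''j'') (Reg ''m'')) (better (Reg ''j'')))
         (Seq (Assign ''v'' (Reg ''j'')) (Assign ''y'' (Reg ''h''))) Skip,
       Assign ''h'' (Plus (Reg ''h'') (Num 1))]),
     Assign ''x'' (Reg ''v'')]"

text \<open>\<open>z\<close> is kept equal to the square of \<open>r\<close> by adding 2r + 1 as a
  sum of registers.\<close>

definition isqrt :: com where
  "isqrt = While (Less (Reg ''z'') (Reg ''m'')) (seq [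
     Assign ''z'' (Plus (Plus (Reg ''z'') (Reg ''r'')) (Plus (Reg ''r'') (Num 1))),
     Assign ''r'' (Plus (Reg ''r'') (Num 1))])"

definition init_blocks :: com where
  "init_blocks = While (Less (Reg ''y'') (Reg ''r'')) (Seq rescan (Assign ''y'' (Plus (Reg ''y'') (Num 1))))"

text \<open>\<open>select\<close> leaves the residue class of the chosen edge in \<open>y\<close>;
  only that class has to be searched again.\<close>

definition main_step :: com where
  "main_step = seq [select, try_edge, Store ''done'' (Reg ''x'') (Num 1), rescan,
     Assign ''t'' (Plus (Reg ''t'') (Num 1))]"

definition greedy :: com where
  "greedy = seq [isqrt, init_blocks, While (Less (Reg ''t'') (Reg ''m'')) main_step]"

section \<open>Lightest remaining edges\<close>

context greedy_input
begin

definition min_of :: "nat set \<Rightarrow> nat \<Rightarrow> bool" where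
  "min_of S v \<longleftrightarrow> S = {} \<and> v = m \<or> v \<in> S \<and> (\<forall>i \<in> S. W v \<le> W i)"

text \<open>The \<open>if\<close> mirrors the comparison \<open>better\<close>, where an index equal
  to \<open>m\<close> means that there is no candidate.\<close>

lemma min_of_union:
  assumes "min_of S v" "min_of S' c" "S \<subseteq> {..<m}" "S' \<subseteq> {..<m}"
  shows "min_of (S \<union> S') (if c < m \<and> \<not> (v < m \<and> \<not> W c < W v) then c else v)"
proof -
  consider "S = {}" "v = m" | "S' = {}" "c = m" | "v \<in> S" "\<And>i. i \<in> S \<Longrightarrow> W v \<le> W i" "c \<in> S'" "\<And>i. i \<in> S' \<Longrightarrow> W c \<le> W i"
    using assms unfolding min_of_def by blast
  then show ?thesis
  proof cases
    case 1
    then show ?thesis using assms(2,4) by (auto simp: min_of_def)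
  next
    case 2
    then show ?thesis using assms(1) by simp
  next
    case 3
    then have "v < m" "c < m" using assms by auto
    show ?thesis
    proof (cases "W c < W v")
      case True
      then have "W c \<le> W i" if "i \<in> S \<union> S'" for i using that 3(2)[of i] 3(4)[of i] by auto
      then show ?thesis using True \<open>c < m\<close> 3(3) unfolding min_of_def by simp
    next
      case False
      then have "W v \<le> W i" if "i \<in> S \<union> S'" for i using that 3(2)[of i] 3(4)[of i] by auto
      then show ?thesis using False \<open>v < m\<close> 3(1) unfolding min_of_def by simp
    qed
  qed
qed

definition undone :: "(nat \<Rightarrow> nat) \<Rightarrow> nat set" where
  "undone dn = {i. i < m \<and> dn i = 0}"

lemma bval_better:
  "env \<sigma> \<Longrightarrow> bval (better c) \<sigma> \<longleftrightarrow> \<not> (reg \<sigma> ''v'' < m \<and> \<not> W (aval c \<sigma>) < W (reg \<sigma> ''v''))"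
  by (auto simp: better_def env_def)

lemma bcost_better: "bcost (better c) = 10 + acost c"
  by (simp add: better_def)

lemma env_frame:
  assumes "frame R A \<sigma> \<sigma>'" "R \<inter> {''m'', ''k'', ''f'', ''a'', ''b''} = {}" "A \<inter> {''u'', ''v'', ''ecol'',
      ''vcol''} = {}"
  shows "env \<sigma>' = env \<sigma>"
proof -
  have "\<And>x. x \<in> {''m'', ''k'', ''f'', ''a'', ''b''} \<Longrightarrow> reg \<sigma>' x = reg \<sigma> x"
    "\<And>x. x \<in> {''u'', ''v'', ''ecol'', ''vcol''} \<Longrightarrow> arr \<sigma>' x = arr \<sigma> x"
    using assms unfolding frame_def by blast+
  then show ?thesis using frame_rarr[OF assms(1)] by (simp add: env_def)
qed

lemma same_residue:
  assumes "j \<le> i" "i < j + r" "i mod r = j mod (r::nat)"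
  shows "i = j"
proof -
  have "r dvd i - j" using assms by (simp add: mod_eq_dvd_iff_nat)
  then show ?thesis using assms by (auto dest: dvd_imp_le)
qed

text \<open>\<open>j\<close> starts at \<open>y\<close> and advances by \<open>r\<close>, so
  \<open>j div r\<close> counts the rounds; there are at most \<open>r\<close> of them because
  \<open>m \<le> r * r\<close>.\<close>

lemma rescan_wp:
  assumes E: "env \<sigma>" and r: "reg \<sigma> ''r'' = r" "m \<le> r * r" and y: "reg \<sigma> ''y'' = y" "y < r"
  shows "wp rescan (\<lambda>T \<sigma>'. frame {''j'', ''v''} {''best''} \<sigma> \<sigma>' \<and> T \<le> 40 * r + 20 \<and>
    (\<exists>v. min_of {i \<in> undone (arr \<sigma> ''done''). i mod r = y} v \<and> arr \<sigma>' ''best'' = (arr \<sigma> ''best'')(y := v))) \<sigma>"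
proof -
  let ?s = "\<sigma>\<lparr>reg := (reg \<sigma>)(''j'' := y, ''v'' := m)\<rparr>"
  let ?S = "\<lambda>j. {i \<in> undone (arr \<sigma> ''done''). i mod r = y \<and> i < j}"
  let ?I = "\<lambda>\<sigma>'. frame {''j'', ''v''} {} \<sigma> \<sigma>' \<and> reg \<sigma>' ''j'' mod r = y \<and> min_of (?S (reg \<sigma>' ''j'')) (reg \<sigma>' ''v'')"
  let ?b = "Less (Reg ''j'') (Reg ''m'')"
  let ?body = "seq [If (Conj (Less (Arr ''done'' (Reg ''j'')) (Num 1)) (better (Reg ''j''))) (Assign ''v'' (Reg
      ''j'')) Skip,
       Assign ''j'' (Plus (Reg ''j'') (Reg ''r''))]"
  have "wp (While ?b ?body) (\<lambda>T \<sigma>'. ?I \<sigma>' \<and> m \<le> reg \<sigma>' ''j'' \<and> T \<le> 40 * r + 4) ?s"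
  proof (rule wp_While[where I = ?I and pot = "\<lambda>\<sigma>'. 40 * (r - reg \<sigma>' ''j'' div r)"])
    have "i mod r \<noteq> y" if "i < y" for i using less_trans[OF that y(2)] that by simp
    then have "{i \<in> undone (arr \<sigma> ''done''). i mod r = y \<and> i < y} = {}" by blast
    then show "?I ?s" using y(2) by (simp add: frame_def min_of_def)
  next
    fix \<sigma>' assume I: "?I \<sigma>'" and b: "bval ?b \<sigma>'"
    have E': "env \<sigma>'" using env_frame[of _ _ \<sigma> \<sigma>'] I E by auto
    let ?j = "reg \<sigma>' ''j''" and ?v = "reg \<sigma>' ''v''"
    have r': "reg \<sigma>' ''r'' = r" "arr \<sigma>' ''done'' = arr \<sigma> ''done''" using I r by (simp_all add: frame_def)
    have jm: "?j < m" using b E' by (simp add: env_def)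
    have jr: "?j div r < r" using jm r(2) by (simp add: less_mult_imp_div_less)
    have S: "?S (?j + r) = ?S ?j \<union> (if arr \<sigma> ''done'' ?j = 0 then {?j} else {})"
    proof -
      have "i < ?j" if "i < ?j + r" "i mod r = y" "i \<noteq> ?j" for i
      proof (rule ccontr)
        assume "\<not> i < ?j"
        then show False using same_residue[of ?j i r] that I by simp
      qed
      then have iff: "i mod r = y \<and> i < ?j + r \<longleftrightarrow> i mod r = y \<and> i < ?j \<or> i = ?j" for i
        using I y(2) by fastforce
      show ?thesis unfolding iff using jm by (auto simp: undone_def)
    qed
    have sub: "?S ?j \<subseteq> {..<m}" by (auto simp: undone_def)
    have dv: "(?j + r) div r = Suc (?j div r)" "(?j + r) mod r = y" using y(2) I by simp_all
    let ?s1 = "\<sigma>'\<lparr>reg := (reg \<sigma>')(''v'' := ?j, ''j'' := ?j + r)\<rparr>" and ?s2 = "\<sigma>'\<lparr>reg := (reg \<sigma>')(''j'' := ?j + r)\<rparr>"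
    have body: "wp ?body Q \<sigma>' \<longleftrightarrow> (if arr \<sigma> ''done'' ?j = 0 \<and> \<not> (?v < m \<and>
        \<not> W ?j < W ?v) then Q 23 ?s1 else Q 22 ?s2)" for Q
      by (auto simp: wp_simps bval_better[OF E'] bcost_better r')
    have fr: "frame {''j'', ''v''} {} \<sigma> ?s1" "frame {''j'', ''v''} {} \<sigma> ?s2" using I by (simp_all add: frame_def)
    have pot: "27 + 40 * (r - Suc (?j div r)) \<le> 40 * (r - ?j div r)" using jr by simp
    show "wp ?body (\<lambda>T \<sigma>''. ?I \<sigma>'' \<and> 1 + bcost ?b + T + 40 * (r - reg \<sigma>'' ''j'' div r) \<le> 40 * (r - ?j div r)) \<sigma>'"
    proof (cases "arr \<sigma> ''done'' ?j = 0 \<and> \<not> (?v < m \<and> \<not> W ?j < W ?v)")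
      case True
      have "min_of (?S ?j \<union> {?j}) ?j"
        using min_of_union[of "?S ?j" ?v "{?j}" ?j] I sub jm True by (simp add: min_of_def)
      then have "min_of (?S (?j + r)) ?j" using S True by simp
      then show ?thesis unfolding body using True fr dv pot by simp
    next
      case False
      have "min_of (?S (?j + r)) ?v"
      proof (cases "arr \<sigma> ''done'' ?j = 0")
        case True
        then have "min_of (?S ?j \<union> {?j}) ?v"
          using min_of_union[of "?S ?j" ?v "{?j}" ?j] I sub jm False by (auto simp: min_of_def)
        then show ?thesis using S True by simp
      qed (use S I in simp)
      then show ?thesis unfolding body if_not_P[OF False] using fr dv pot by simp
    qed
  next
    fix T \<sigma>' assume I: "?I \<sigma>'" and b: "\<not> bval ?b \<sigma>'" and T: "T \<le> 40 * (r - reg ?s ''j'' div r) + 1 + bcost ?b"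
    have "env \<sigma>'" using env_frame[of _ _ \<sigma> \<sigma>'] I E by auto
    then show "?I \<sigma>' \<and> m \<le> reg \<sigma>' ''j'' \<and> T \<le> 40 * r + 4" using I b T by (auto simp: env_def)
  qed
  then have "wp (While ?b ?body) (\<lambda>T \<sigma>'. frame {''j'', ''v''} {} \<sigma> \<sigma>' \<and> T \<le> 40 * r + 4 \<and>
    min_of {i \<in> undone (arr \<sigma> ''done''). i mod r = y} (reg \<sigma>' ''v'')) ?s"
  proof (rule wp_mono, elim conjE, intro conjI)
    fix T \<sigma>' assume j: "m \<le> reg \<sigma>' ''j''" and mn: "min_of (?S (reg \<sigma>' ''j'')) (reg \<sigma>' ''v'')"
    have "?S (reg \<sigma>' ''j'') = {i \<in> undone (arr \<sigma> ''done''). i mod r = y}" using j by (auto simp: undone_def)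
    then show "min_of {i \<in> undone (arr \<sigma> ''done''). i mod r = y} (reg \<sigma>' ''v'')" using mn by simp
  qed
  then have "wp (While ?b ?body) (\<lambda>T \<sigma>'. frame {''j'', ''v''} {''best''} \<sigma>
      (\<sigma>'\<lparr>arr := (arr \<sigma>')(''best'' := (arr \<sigma>' ''best'')(reg \<sigma>' ''y'' := reg \<sigma>' ''v''))\<rparr>) \<and> T + 10 \<le> 40 * r + 20 \<and>
    (\<exists>v. min_of {i \<in> undone (arr \<sigma> ''done''). i mod r = y} v \<and>
      (arr \<sigma>' ''best'')(reg \<sigma>' ''y'' := reg \<sigma>' ''v'') = (arr \<sigma> ''best'')(y := v))) ?s"
    by (rule wp_mono) (use y in \<open>auto simp: frame_def\<close>)
  moreover have "reg \<sigma> ''m'' = m" using E by (simp add: env_def)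
  ultimately show ?thesis using y
    by (simp add: rescan_def wp_simps) (rule wp_mono, assumption, simp)
qed

lemma select_wp:
  assumes E: "env \<sigma>" and r: "reg \<sigma> ''r'' = r"
    and best: "\<And>y. y < r \<Longrightarrow> min_of {i \<in> undone (arr \<sigma> ''done''). i mod r = y} (arr \<sigma> ''best'' y)"
    and r0: "r > 0"
  shows "wp select (\<lambda>T \<sigma>'. frame {''h'', ''j'', ''v'', ''y'', ''x''} {} \<sigma> \<sigma>' \<and> T \<le> 40 * r + 20 \<and>
    min_of (undone (arr \<sigma> ''done'')) (reg \<sigma>' ''x'') \<and>
    (reg \<sigma>' ''x'' < m \<longrightarrow> reg \<sigma>' ''y'' = reg \<sigma>' ''x'' mod r)) \<sigma>"
proof -
  let ?s = "\<sigma>\<lparr>reg := (reg \<sigma>)(''h'' := 0, ''v'' := m)\<rparr>"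
  let ?U = "undone (arr \<sigma> ''done'')"
  let ?S = "\<lambda>h. {i \<in> ?U. i mod r < h}"
  let ?I = "\<lambda>\<sigma>'. frame {''h'', ''j'', ''v'', ''y''} {} \<sigma> \<sigma>' \<and> reg \<sigma>' ''h'' \<le> r \<and>
      min_of (?S (reg \<sigma>' ''h'')) (reg \<sigma>' ''v'') \<and>
    (reg \<sigma>' ''v'' < m \<longrightarrow> reg \<sigma>' ''y'' = reg \<sigma>' ''v'' mod r)"
  let ?b = "Less (Reg ''h'') (Reg ''r'')"
  let ?body = "seq [
       Assign ''j'' (Arr ''best'' (Reg ''h'')),
       If (Conj (Less (Reg ''j'') (Reg ''m'')) (better (Reg ''j'')))
         (Seq (Assign ''v'' (Reg ''j'')) (Assign ''y'' (Reg ''h''))) Skip,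
       Assign ''h'' (Plus (Reg ''h'') (Num 1))]"
  have "wp (While ?b ?body) (\<lambda>T \<sigma>'. ?I \<sigma>' \<and> reg \<sigma>' ''h'' = r \<and> T \<le> 40 * r + 4) ?s"
  proof (rule wp_While[where I = ?I and pot = "\<lambda>\<sigma>'. 40 * (r - reg \<sigma>' ''h'')"])
    show "?I ?s" by (simp add: frame_def min_of_def)
  next
    fix \<sigma>' assume I: "?I \<sigma>'" and b: "bval ?b \<sigma>'"
    have E': "env \<sigma>'" using env_frame[of _ _ \<sigma> \<sigma>'] I E by auto
    let ?h = "reg \<sigma>' ''h''" and ?v = "reg \<sigma>' ''v''"
    let ?j = "arr \<sigma> ''best'' ?h"
    have r': "reg \<sigma>' ''r'' = r" "arr \<sigma>' ''best'' = arr \<sigma> ''best''" "reg \<sigma>' ''m'' = m"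
      using I r E' by (simp_all add: frame_def env_def)
    have hr: "?h < r" using b r' by simp
    have S: "?S (Suc ?h) = ?S ?h \<union> {i \<in> ?U. i mod r = ?h}" by auto
    have new: "min_of (?S (Suc ?h)) (if ?j < m \<and> \<not> (?v < m \<and> \<not> W ?j < W ?v) then ?j else ?v)"
      unfolding S by (rule min_of_union[OF _ best[OF hr]]) (use I in \<open>auto simp: undone_def\<close>)
    have jh: "?j < m \<Longrightarrow> ?j mod r = ?h" using best[OF hr] by (auto simp: min_of_def)
    have E'': "env (\<sigma>'\<lparr>reg := (reg \<sigma>')(''j'' := ?j)\<rparr>)" using E' by (simp add: env_def)
    let ?s1 = "\<sigma>'\<lparr>reg := (reg \<sigma>')(''j'' := ?j, ''v'' := ?j, ''y'' := ?h, ''h'' := Suc ?h)\<rparr>"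
      and ?s2 = "\<sigma>'\<lparr>reg := (reg \<sigma>')(''j'' := ?j, ''h'' := Suc ?h)\<rparr>"
    have body: "wp ?body Q \<sigma>' \<longleftrightarrow> (if ?j < m \<and> \<not> (?v < m \<and> \<not> W ?j < W ?v) then Q 27 ?s1 else Q 24 ?s2)" for Q
      by (auto simp: wp_simps bval_better[OF E''] bcost_better r')
    have fr: "frame {''h'', ''j'', ''v'', ''y''} {} \<sigma> ?s1" "frame {''h'', ''j'', ''v'', ''y''} {} \<sigma> ?s2"
      using I by (simp_all add: frame_def)
    have pot: "31 + 40 * (r - Suc ?h) \<le> 40 * (r - ?h)" using hr by simp
    show "wp ?body (\<lambda>T \<sigma>''. ?I \<sigma>'' \<and> 1 + bcost ?b + T + 40 * (r - reg \<sigma>'' ''h'') \<le> 40 * (r - ?h)) \<sigma>'"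
    proof (cases "?j < m \<and> \<not> (?v < m \<and> \<not> W ?j < W ?v)")
      case True
      then have "min_of (?S (Suc ?h)) ?j" using new by simp
      then show ?thesis unfolding body if_P[OF True] using True fr pot hr jh by simp
    next
      case False
      then have "min_of (?S (Suc ?h)) ?v" using new by (simp split: if_splits)
      moreover have "?v < m \<longrightarrow> reg \<sigma>' ''y'' = ?v mod r" using I by blast
      ultimately show ?thesis unfolding body if_not_P[OF False] using fr pot hr by simp
    qed
  next
    fix T \<sigma>' assume I: "?I \<sigma>'" and b: "\<not> bval ?b \<sigma>'" and T: "T \<le> 40 * (r - reg ?s ''h'') + 1 + bcost ?b"
    have "reg \<sigma>' ''r'' = r" using I r by (simp add: frame_def)
    then show "?I \<sigma>' \<and> reg \<sigma>' ''h'' = r \<and> T \<le> 40 * r + 4" using I b T by auto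
  qed
  then have "wp (While ?b ?body) (\<lambda>T \<sigma>'. frame {''h'', ''j'', ''v'', ''y'', ''x''} {} \<sigma>
      (\<sigma>'\<lparr>reg := (reg \<sigma>')(''x'' := reg \<sigma>' ''v'')\<rparr>) \<and> T + 8 \<le> 40 * r + 20 \<and> min_of ?U (reg \<sigma>' ''v'') \<and>
      (reg \<sigma>' ''v'' < m \<longrightarrow> reg \<sigma>' ''y'' = reg \<sigma>' ''v'' mod r)) ?s"
  proof (rule wp_mono, elim conjE, intro conjI)
    fix T \<sigma>' assume h: "reg \<sigma>' ''h'' = r" and mn: "min_of (?S (reg \<sigma>' ''h'')) (reg \<sigma>' ''v'')"
    have "?S r = ?U" using r0 by auto
    then show "min_of ?U (reg \<sigma>' ''v'')" using mn h by simp
  qed (auto simp: frame_def)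
  moreover have "reg \<sigma> ''m'' = m" using E by (simp add: env_def)
  ultimately show ?thesis
    by (simp add: select_def wp_simps) (rule wp_mono, assumption, simp)
qed

text \<open>The time is expressed by the final \<open>r\<close>, which no potential knows in
  advance; hence the time-indexed rule with \<open>m - z\<close> as termination measure. The bound
  on the square of r - 1 later limits \<open>r\<close> in terms of \<open>m\<close>.\<close>

lemma isqrt_wp:
  assumes E: "env \<sigma>" and z: "reg \<sigma> ''z'' = 0" "reg \<sigma> ''r'' = 0"
  shows "wp isqrt (\<lambda>T \<sigma>'. frame {''z'', ''r''} {} \<sigma> \<sigma>' \<and> m \<le> reg \<sigma>' ''r'' * reg \<sigma>' ''r'' \<and>
    (reg \<sigma>' ''r'' = 0 \<or> (reg \<sigma>' ''r'' - 1) * (reg \<sigma>' ''r'' - 1) < m) \<and> T \<le> 20 * reg \<sigma>' ''r'' + 4) \<sigma>"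
  unfolding isqrt_def
proof (rule wp_While_time[where \<mu> = "\<lambda>\<sigma>'. m - reg \<sigma>' ''z''" and
    J = "\<lambda>T \<sigma>'. frame {''z'', ''r''} {} \<sigma> \<sigma>' \<and> reg \<sigma>' ''z'' = reg \<sigma>' ''r'' * reg \<sigma>' ''r'' \<and>
      (reg \<sigma>' ''r'' = 0 \<or> (reg \<sigma>' ''r'' - 1) * (reg \<sigma>' ''r'' - 1) < m) \<and> T \<le> 20 * reg \<sigma>' ''r''"], goal_cases)
  case 1
  then show ?case using z by (simp add: frame_def)
next
  case (2 T \<sigma>')
  then have "reg \<sigma>' ''m'' = m" using E by (simp add: frame_def env_def)
  then show ?case using 2 by (auto simp: wp_simps frame_def)
next
  case (3 T \<sigma>')
  then have "reg \<sigma>' ''m'' = m" using E by (simp add: frame_def env_def)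
  then show ?case using 3 by auto
qed

lemma init_blocks_wp:
  assumes E: "env \<sigma>" and r: "reg \<sigma> ''r'' = r" "m \<le> r * r" and y: "reg \<sigma> ''y'' = 0"
  shows "wp init_blocks (\<lambda>T \<sigma>'. frame {''j'', ''v'', ''y''} {''best''} \<sigma> \<sigma>' \<and> T \<le> r * (40 * r + 40) + 4 \<and>
    (\<forall>y<r. min_of {i \<in> undone (arr \<sigma> ''done''). i mod r = y} (arr \<sigma>' ''best'' y))) \<sigma>"
  unfolding init_blocks_def
proof (rule wp_While[where pot = "\<lambda>\<sigma>'. (r - reg \<sigma>' ''y'') * (40 * r + 40)" and
    I = "\<lambda>\<sigma>'. frame {''j'', ''v'', ''y''} {''best''} \<sigma> \<sigma>' \<and> reg \<sigma>' ''y'' \<le> r \<and>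
      (\<forall>y<reg \<sigma>' ''y''. min_of {i \<in> undone (arr \<sigma> ''done''). i mod r = y} (arr \<sigma>' ''best'' y))"], goal_cases)
  case 1
  then show ?case using y by (simp add: frame_def)
next
  case (2 \<sigma>')
  then have fr: "frame {''j'', ''v'', ''y''} {''best''} \<sigma> \<sigma>'" by simp
  have E': "env \<sigma>'" using env_frame[OF fr] E by simp
  have r': "reg \<sigma>' ''r'' = r" "arr \<sigma>' ''done'' = arr \<sigma> ''done''" using fr r by (simp_all add: frame_def)
  let ?y = "reg \<sigma>' ''y''"
  have yr: "?y < r" using 2 r' by simp
  then have eq: "r - ?y = Suc (r - Suc ?y)" by simp
  show ?case unfolding wp_Seq wp_Assign
  proof (rule wp_mono[OF rescan_wp[OF E' r'(1) r(2) refl yr]], elim conjE exE)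
    fix T \<sigma>'' v assume f: "frame {''j'', ''v''} {''best''} \<sigma>' \<sigma>''" and T: "T \<le> 40 * r + 20"
      and v: "min_of {i \<in> undone (arr \<sigma>' ''done''). i mod r = ?y} v" "arr \<sigma>'' ''best'' = (arr \<sigma>' ''best'')(?y := v)"
    have y'': "reg \<sigma>'' ''y'' = ?y" using f by (simp add: frame_def)
    let ?s = "\<sigma>''\<lparr>reg := (reg \<sigma>'')(''y'' := aval (Plus (Reg ''y'') (Num 1)) \<sigma>'')\<rparr>"
    have "frame {''j'', ''v'', ''y''} {''best''} \<sigma> ?s" using fr f by (auto simp: frame_def)
    then show "(frame {''j'', ''v'', ''y''} {''best''} \<sigma> ?s \<and> reg ?s ''y'' \<le> r \<and>
       (\<forall>y<reg ?s ''y''. min_of {i \<in> undone (arr \<sigma> ''done''). i mod r = y} (arr ?s ''best'' y))) \<and>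
      1 + bcost (Less (Reg ''y'') (Reg ''r'')) + (T + (1 + acost (Plus (Reg ''y'') (Num 1)))) +
      (r - reg ?s ''y'') * (40 * r + 40) \<le> (r - ?y) * (40 * r + 40)"
      using 2 y'' yr v T r' eq by (auto simp: less_Suc_eq)
  qed
next
  case (3 T \<sigma>')
  then have "reg \<sigma>' ''r'' = r" using r by (simp add: frame_def)
  then show ?case using 3 y by auto
qed

end

context greedy_input
begin

section \<open>The greedy algorithm\<close>

definition greedy_list :: "nat list \<Rightarrow> bool" where
  "greedy_list xs \<longleftrightarrow> (\<forall>q<length xs. accepted (set (take q xs)) (xs ! q))"

text \<open>\<open>I\<close> is the spanner at the moment when \<open>i\<close> was rejected; later
  insertions may be heavier, so the weight condition refers to \<open>I\<close> and not to the whole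
  list.\<close>

definition covered :: "nat list \<Rightarrow> nat \<Rightarrow> bool" where
  "covered xs i \<longleftrightarrow> (\<exists>I \<subseteq> set xs. (\<forall>j \<in> I. W j \<le> W i) \<and> rejected I i)"

lemma greedy_list_snoc: "greedy_list xs \<Longrightarrow> accepted (set xs) x \<Longrightarrow> greedy_list (xs @ [x])"
  by (auto simp: greedy_list_def less_Suc_eq nth_append)

text \<open>\<open>D\<close> is the set of edges decided so far. The comparison of \<open>D\<close>
  with the rest is what makes all edges of the current spanner no heavier than the next one
  chosen.\<close>

definition main_inv :: "nat \<Rightarrow> nat list \<Rightarrow> nat set \<Rightarrow> state \<Rightarrow> bool" where
  "main_inv r xs D \<sigma> \<longleftrightarrow> core (set xs) \<sigma> \<and> output_list \<sigma> = xs \<and> reg \<sigma> ''r'' = r \<and> reg \<sigma> ''t'' = card D \<and>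
     reg \<sigma> ''d'' \<le> card D \<and> arr \<sigma> ''done'' = (\<lambda>i. if i \<in> D then 1 else 0) \<and>
     (\<forall>y<r. min_of {i \<in> {..<m} - D. i mod r = y} (arr \<sigma> ''best'' y)) \<and>
     D \<subseteq> {..<m} \<and> (\<forall>i \<in> D. \<forall>j \<in> {..<m} - D. W i \<le> W j) \<and>
     greedy_list xs \<and> set xs \<subseteq> D \<and> (\<forall>i \<in> D - set xs. covered xs i)"

lemma core_frame':
  assumes "frame R A \<sigma> \<sigma>'" "R \<inter> {''m'', ''k'', ''f'', ''a'', ''b'', ''c'', ''g'', ''d'', ''s''} = {}"
    "A \<inter> {''u'', ''v'', ''ecol'', ''vcol'', ''vis'', ''mark'', ''prot'', ''out'', ''cell'', ''to'', ''next'',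
        ''head''} = {}"
  shows "core I \<sigma>' = core I \<sigma>"
proof -
  have "\<And>x. x \<in> {''m'', ''k'', ''f'', ''a'', ''b'', ''c'', ''g'', ''d'', ''s''} \<Longrightarrow> reg \<sigma>' x = reg \<sigma> x"
    using frame_reg[OF assms(1)] assms(2) by (metis disjoint_iff)
  moreover have "\<And>x. x \<in> {''u'', ''v'', ''ecol'', ''vcol'', ''vis'', ''mark'', ''prot'', ''out'', ''cell'',
      ''to'', ''next'', ''head''} \<Longrightarrow>
      arr \<sigma>' x = arr \<sigma> x"
    using frame_arr[OF assms(1)] assms(3) by (metis disjoint_iff)
  ultimately show ?thesis using frame_rarr[OF assms(1)] by (simp add: core_def env_def output_list_def)
qed

lemma undone_indicator: "undone (\<lambda>i. if i \<in> D then 1 else 0) = {..<m} - D"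
  by (auto simp: undone_def)

text \<open>Separates the bookkeeping from the three real subprograms; 3 and 4 are the exact costs
  of the store to \<open>done\<close> and of the increment of \<open>t\<close>.\<close>

lemma wp_main_step:
  "wp main_step Q \<sigma> \<longleftrightarrow> wp select (\<lambda>T1. wp try_edge (\<lambda>T2 \<sigma>2. wp rescan
     (\<lambda>T3 \<sigma>3. Q (T1 + (T2 + (3 + (T3 + 4)))) (\<sigma>3\<lparr>reg := (reg \<sigma>3)(''t'' := reg \<sigma>3 ''t'' + 1)\<rparr>))
     (\<sigma>2\<lparr>arr := (arr \<sigma>2)(''done'' := (arr \<sigma>2 ''done'')(reg \<sigma>2 ''x'' := 1))\<rparr>))) \<sigma>"
  by (simp add: main_step_def wp_simps numeral_eq_Suc)

lemma main_step_wp: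
  assumes I: "main_inv r xs D \<sigma>" and lt: "card D < m" and r: "m \<le> r * r"
    and loop: "\<And>i. i < m \<Longrightarrow> U i \<noteq> V i"
  shows "wp main_step (\<lambda>T \<sigma>'. \<exists>xs' D'. main_inv r xs' D' \<sigma>' \<and> card D' = Suc (card D) \<and> length xs \<le> length xs' \<and>
     T \<le> (min f (length xs) + 1) * (400 * length xs + 210) + 80 * r + 150) \<sigma>"
proof -
  have C: "core (set xs) \<sigma>" and out: "output_list \<sigma> = xs" and rr: "reg \<sigma> ''r'' = r" and t: "reg \<sigma> ''t'' = card D"
    and d: "reg \<sigma> ''d'' \<le> card D" and dn: "arr \<sigma> ''done'' = (\<lambda>i. if i \<in> D then 1 else 0)"
    and best: "\<And>y. y < r \<Longrightarrow> min_of {i \<in> {..<m} - D. i mod r = y} (arr \<sigma> ''best'' y)"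
    and D: "D \<subseteq> {..<m}" and ord: "\<And>i j. i \<in> D \<Longrightarrow> j \<in> {..<m} - D \<Longrightarrow> W i \<le> W j"
    and gl: "greedy_list xs" and xsD: "set xs \<subseteq> D" and cov: "\<And>i. i \<in> D - set xs \<Longrightarrow> covered xs i"
    using I unfolding main_inv_def by (simp_all only:)
  have E: "env \<sigma>" using C by (simp add: core_def)
  have finD: "finite D" using D finite_subset by blast
  have r0: "r > 0" using lt r by (cases r) auto
  have ne: "{..<m} - D \<noteq> {}" using lt card_mono[OF finD, of "{..<m}"] by auto
  have best': "\<And>y. y < r \<Longrightarrow> min_of {i \<in> undone (arr \<sigma> ''done''). i mod r = y} (arr \<sigma> ''best'' y)"
    unfolding dn undone_indicator by (rule best)
  let ?post = "\<lambda>T \<sigma>'. \<exists>xs' D'. main_inv r xs' D' \<sigma>' \<and> card D' = Suc (card D) \<and> length xs \<le> length xs' \<and>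
     T \<le> (min f (length xs) + 1) * (400 * length xs + 210) + 80 * r + 150"
  show ?thesis unfolding wp_main_step
  proof (rule wp_mono[OF select_wp[OF E rr best' r0]], assumption, elim conjE)
    fix T1 \<sigma>1 assume fr1: "frame {''h'', ''j'', ''v'', ''y'', ''x''} {} \<sigma> \<sigma>1" and T1: "T1 \<le> 40 * r + 20"
      and mn: "min_of (undone (arr \<sigma> ''done'')) (reg \<sigma>1 ''x'')"
      and y1: "reg \<sigma>1 ''x'' < m \<longrightarrow> reg \<sigma>1 ''y'' = reg \<sigma>1 ''x'' mod r"
    define x where "x = reg \<sigma>1 ''x''"
    have x: "x \<in> {..<m} - D" "\<And>i. i \<in> {..<m} - D \<Longrightarrow> W x \<le> W i"
      using mn ne unfolding dn undone_indicator min_of_def x_def by auto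
    have C1: "core (set xs) \<sigma>1" using core_frame'[OF fr1] C by simp
    have out1: "output_list \<sigma>1 = xs" using output_list_frame[OF fr1] out by simp
    have d1: "reg \<sigma>1 ''d'' \<le> reg \<sigma>1 ''t''" using fr1 d t by (simp add: frame_def)
    have xxs: "x \<notin> set xs" "U x \<noteq> V x" using x xsD loop by auto
    show "wp try_edge (\<lambda>T2 \<sigma>2. wp rescan
     (\<lambda>T3 \<sigma>3. ?post (T1 + (T2 + (3 + (T3 + 4)))) (\<sigma>3\<lparr>reg := (reg \<sigma>3)(''t'' := reg \<sigma>3 ''t'' + 1)\<rparr>))
     (\<sigma>2\<lparr>arr := (arr \<sigma>2)(''done'' := (arr \<sigma>2 ''done'')(reg \<sigma>2 ''x'' := 1))\<rparr>)) \<sigma>1"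
    proof (rule wp_mono[OF try_edge_wp[OF C1 out1 d1 x_def[symmetric] xxs]], elim conjE)
      fix T2 \<sigma>2 assume fr2: "frame (try_regs \<union> {''d'', ''p'', ''q''}) (try_arrs \<union> {''prot''}) \<sigma>1 \<sigma>2"
        and d2: "reg \<sigma>2 ''d'' = Suc (reg \<sigma>1 ''t'')" and fin: "finished xs x \<sigma>2"
        and T2: "T2 \<le> (min f (length xs) + 1) * (400 * length xs + 210) + 100"
      define xs' where "xs' = output_list \<sigma>2"
      have reg2: "reg \<sigma>2 ''x'' = x" "reg \<sigma>2 ''y'' = x mod r" "reg \<sigma>2 ''r'' = r" "reg \<sigma>2 ''t'' = card D"
        "arr \<sigma>2 ''done'' = (\<lambda>i. if i \<in> D then 1 else 0)" "arr \<sigma>2 ''best'' = arr \<sigma> ''best''"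
        using fr2 fr1 x_def x y1 rr t dn by (simp_all add: frame_def)
      have d2': "reg \<sigma>2 ''d'' = Suc (card D)" using d2 fr1 t by (simp add: frame_def)
      have C2: "core (set xs') \<sigma>2" using fin by (auto simp: finished_def xs'_def)
      have xs'D: "set xs \<subseteq> set xs'" "set xs' \<subseteq> insert x D" "length xs \<le> length xs'"
        using fin xsD by (auto simp: finished_def xs'_def)
      have gl': "greedy_list xs'" using fin gl greedy_list_snoc by (auto simp: finished_def xs'_def)
      have cov': "covered xs' i" if i: "i \<in> insert x D - set xs'" for i
      proof (cases "i = x")
        case True
        then have "rejected (set xs) x" using fin i by (auto simp: finished_def xs'_def)
        moreover have "\<forall>j \<in> set xs. W j \<le> W x" using ord[OF subsetD[OF xsD] x(1)] by simp
        ultimately show ?thesis unfolding covered_def True by (intro exI[of _ "set xs"] conjI xs'D(1))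
      next
        case False
        then have "covered xs i" using cov i xs'D by blast
        then show ?thesis using subset_trans[OF _ xs'D(1)] unfolding covered_def by metis
      qed
      let ?s2 = "\<sigma>2\<lparr>arr := (arr \<sigma>2)(''done'' := (arr \<sigma>2 ''done'')(reg \<sigma>2 ''x'' := 1))\<rparr>"
      have dn2: "arr ?s2 ''done'' = (\<lambda>i. if i \<in> insert x D then 1 else 0)" using reg2 by auto
      have E2: "env ?s2" using C2 by (simp add: core_def env_def)
      have r2: "reg ?s2 ''r'' = r" "reg ?s2 ''y'' = x mod r" "x mod r < r" using reg2 r0 by simp_all
      show "wp rescan
       (\<lambda>T3 \<sigma>3. ?post (T1 + (T2 + (3 + (T3 + 4)))) (\<sigma>3\<lparr>reg := (reg \<sigma>3)(''t'' := reg \<sigma>3 ''t'' + 1)\<rparr>)) ?s2"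
      proof (rule wp_mono[OF rescan_wp[OF E2 r2(1) r r2(2,3)]], elim conjE exE)
        fix T3 \<sigma>3 v assume fr3: "frame {''j'', ''v''} {''best''} ?s2 \<sigma>3" and T3: "T3 \<le> 40 * r + 20"
          and v: "min_of {i \<in> undone (arr ?s2 ''done''). i mod r = x mod r} v"
          and best3: "arr \<sigma>3 ''best'' = (arr ?s2 ''best'')(x mod r := v)"
        let ?s3 = "\<sigma>3\<lparr>reg := (reg \<sigma>3)(''t'' := reg \<sigma>3 ''t'' + 1)\<rparr>"
        let ?D = "insert x D"
        have fr3': "frame {''j'', ''v'', ''t''} {''best'', ''done''} \<sigma>2 ?s3" using fr3 by (auto simp: frame_def)
        have "core (set xs') ?s3" using core_frame'[OF fr3'] C2 by simp
        moreover have "output_list ?s3 = xs'" using output_list_frame[OF fr3'] xs'_def by simp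
        moreover have "reg ?s3 ''r'' = r" "reg ?s3 ''t'' = Suc (card D)" "reg ?s3 ''d'' \<le> Suc (card D)"
          "arr ?s3 ''done'' = (\<lambda>i. if i \<in> ?D then 1 else 0)"
          using fr3 reg2 d2' dn2 by (simp_all add: frame_def)
        moreover have "card ?D = Suc (card D)" using x finD by simp
        moreover have "min_of {i \<in> {..<m} - ?D. i mod r = y} (arr ?s3 ''best'' y)" if y: "y < r" for y
        proof (cases "y = x mod r")
          case True
          then show ?thesis using v best3 unfolding dn2 undone_indicator by simp
        next
          case False
          then have "{i \<in> {..<m} - ?D. i mod r = y} = {i \<in> {..<m} - D. i mod r = y}" by auto
          then show ?thesis using best[OF y] best3 reg2 False by simp
        qed
        moreover have "W i \<le> W j" if "i \<in> ?D" "j \<in> {..<m} - ?D" for i j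
          using that ord[of i j] x(2)[of j] by auto
        moreover have "?D \<subseteq> {..<m}" using D x by auto
        ultimately have "main_inv r xs' ?D ?s3" using gl' xs'D cov' unfolding main_inv_def by simp
        moreover have "T1 + (T2 + (3 + (T3 + 4))) \<le> (min f (length xs) + 1) * (400 * length xs + 210) + 80 * r + 150"
          using T1 T2 T3 by linarith
        ultimately show "?post (T1 + (T2 + (3 + (T3 + 4)))) ?s3"
          using \<open>card ?D = Suc (card D)\<close> xs'D(3) by blast
      qed
    qed
  qed
qed

definition greedy_post :: "nat \<Rightarrow> state \<Rightarrow> bool" where
  "greedy_post T \<sigma>' \<longleftrightarrow> (\<exists>xs r. output_list \<sigma>' = xs \<and> distinct xs \<and> set xs \<subseteq> {..<m} \<and> greedy_list xs \<and>
     (\<forall>i<m. i \<notin> set xs \<longrightarrow> covered xs i) \<and> (r = 0 \<or> (r - 1) * (r - 1) < m) \<and>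
     T \<le> m * ((min f (length xs) + 1) * (400 * length xs + 210) + 80 * r + 160) + r * (40 * r + 60) + 20)"

lemma greedy_wp:
  assumes E: "env \<sigma>" and zero: "\<And>x. x \<in> {''r'', ''z'', ''y'', ''t'', ''c'', ''s'', ''g'', ''d''} \<Longrightarrow> reg \<sigma> x = 0"
    "\<And>x i. x \<in> {''head'', ''vis'', ''mark'', ''prot'', ''done''} \<Longrightarrow> arr \<sigma> x i = 0"
    and loop: "\<And>i. i < m \<Longrightarrow> U i \<noteq> V i"
  shows "wp greedy greedy_post \<sigma>"
proof -
  have zr: "reg \<sigma> ''z'' = 0" "reg \<sigma> ''r'' = 0" using zero by auto
  show ?thesis unfolding greedy_def seq.simps wp_Seq
  proof (rule wp_mono[OF isqrt_wp[OF E zr]], elim conjE)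
    fix T1 \<sigma>1 assume fr1: "frame {''z'', ''r''} {} \<sigma> \<sigma>1" and rm: "m \<le> reg \<sigma>1 ''r'' * reg \<sigma>1 ''r''"
      and rb: "reg \<sigma>1 ''r'' = 0 \<or> (reg \<sigma>1 ''r'' - 1) * (reg \<sigma>1 ''r'' - 1) < m" and T1: "T1 \<le> 20 * reg \<sigma>1 ''r'' + 4"
    define r where "r = reg \<sigma>1 ''r''"
    have E1: "env \<sigma>1" using env_frame[OF fr1] E by simp
    have y1: "reg \<sigma>1 ''y'' = 0" using fr1 zero by (simp add: frame_def)
    show "wp init_blocks (\<lambda>T2. wp (While (Less (Reg ''t'') (Reg ''m'')) main_step) (\<lambda>T3. greedy_post (T1 + (T2 +
        T3)))) \<sigma>1"
    proof (rule wp_mono[OF init_blocks_wp[OF E1 r_def[symmetric] rm[folded r_def] y1]], elim conjE)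
      fix T2 \<sigma>2 assume fr2: "frame {''j'', ''v'', ''y''} {''best''} \<sigma>1 \<sigma>2" and T2: "T2 \<le> r * (40 * r + 40) + 4"
        and best: "\<forall>y<r. min_of {i \<in> undone (arr \<sigma>1 ''done''). i mod r = y} (arr \<sigma>2 ''best'' y)"
      have fr: "frame {''j'', ''v'', ''y'', ''z'', ''r''} {''best''} \<sigma> \<sigma>2"
        by (rule frame_trans[OF fr1 fr2]) auto
      have r2: "reg \<sigma>2 ''r'' = r" using fr2 r_def by (simp add: frame_def)
      have dn: "arr \<sigma> ''done'' = (\<lambda>i. 0)" using zero(2) by auto
      have init: "main_inv r [] {} \<sigma>2"
      proof -
        have "core {} \<sigma>"
          using E zero by (simp add: core_def cells_def output_list_def)
        then have "core {} \<sigma>2" using core_frame'[OF fr] by simp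
        moreover have "output_list \<sigma>2 = []" using output_list_frame[OF fr] zero by (simp add: output_list_def)
        moreover have "reg \<sigma>2 ''t'' = 0" "reg \<sigma>2 ''d'' = 0" using fr zero by (simp_all add: frame_def)
        moreover have "arr \<sigma>2 ''done'' = (\<lambda>i. 0)" "arr \<sigma>1 ''done'' = (\<lambda>i. 0)"
          using fr fr1 dn by (simp_all add: frame_def)
        moreover have "undone (\<lambda>i. 0) = {..<m}" by (auto simp: undone_def)
        ultimately show ?thesis using best r2 by (simp add: main_inv_def greedy_list_def)
      qed
      \<comment> \<open>Cost of one round when the output has \<open>l\<close> edges. The output
        only grows and \<open>?K\<close> is monotone, so all earlier rounds can be charged at the
        current size.\<close>
      let ?K = "\<lambda>l. (min f l + 1) * (400 * l + 210) + 80 * r + 160"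
      show "wp (While (Less (Reg ''t'') (Reg ''m'')) main_step) (\<lambda>T3. greedy_post (T1 + (T2 + T3))) \<sigma>2"
      proof (rule wp_While_time[where \<mu> = "\<lambda>\<sigma>'. m - reg \<sigma>' ''t''" and
          J = "\<lambda>T \<sigma>'. \<exists>xs D. main_inv r xs D \<sigma>' \<and> T \<le> card D * ?K (length xs)"], goal_cases)
        case 1
        then show ?case using init by (intro exI[of _ "[]"] exI[of _ "{}"]) simp
      next
        case (2 T \<sigma>')
        then obtain xs D where I: "main_inv r xs D \<sigma>'" and T: "T \<le> card D * ?K (length xs)" by blast
        have "reg \<sigma>' ''m'' = m" "reg \<sigma>' ''t'' = card D" using I by (simp_all add: main_inv_def core_def env_def)
        then have lt: "card D < m" using 2 by simp
        show ?case
        proof (rule wp_mono[OF main_step_wp[OF I lt rm[folded r_def] loop]], assumption, elim exE conjE)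
          fix T' \<sigma>'' xs' D' assume I': "main_inv r xs' D' \<sigma>''" and D': "card D' = Suc (card D)"
            and len: "length xs \<le> length xs'"
            and T': "T' \<le> (min f (length xs) + 1) * (400 * length xs + 210) + 80 * r + 150"
          have mono: "?K (length xs) \<le> ?K (length xs')"
            using len by (intro add_mono mult_mono) auto
          have "T + 1 + bcost (Less (Reg ''t'') (Reg ''m'')) + T' \<le> card D * ?K (length xs) + ?K (length xs)"
            using T T' by simp
          also have "\<dots> = card D' * ?K (length xs)" using D' by simp
          also have "\<dots> \<le> card D' * ?K (length xs')" using mono by (rule mult_left_mono) simp
          finally have "\<exists>xs D. main_inv r xs D \<sigma>'' \<and> T + 1 + bcost (Less (Reg ''t'') (Reg ''m'')) +
              T' \<le> card D * ?K (length xs)"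
            using I' by blast
          moreover have "m - reg \<sigma>'' ''t'' < m - reg \<sigma>' ''t''" using I I' D' lt by (simp add: main_inv_def)
          ultimately show "(\<exists>xs D. main_inv r xs D \<sigma>'' \<and> T + 1 + bcost (Less (Reg ''t'') (Reg ''m'')) +
              T' \<le> card D * ?K (length xs)) \<and>
            m - reg \<sigma>'' ''t'' < m - reg \<sigma>' ''t''" by blast
        qed
      next
        case (3 T \<sigma>')
        then obtain xs D where I: "main_inv r xs D \<sigma>'" and T: "T \<le> card D * ?K (length xs)" by blast
        have "reg \<sigma>' ''m'' = m" "reg \<sigma>' ''t'' = card D" using I by (simp_all add: main_inv_def core_def env_def)
        then have "m \<le> card D" using 3 by simp
        moreover have sub: "D \<subseteq> {..<m}" using I by (simp add: main_inv_def)
        ultimately have D: "D = {..<m}" using card_seteq[of "{..<m}" D] by simp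
        have "distinct xs" "output_list \<sigma>' = xs" using I by (auto simp: main_inv_def core_def)
        moreover have "set xs \<subseteq> {..<m}" "greedy_list xs" "\<forall>i<m. i \<notin> set xs \<longrightarrow> covered xs i"
          using I D by (auto simp: main_inv_def)
        moreover have "T1 + (T2 + (T + 1 + bcost (Less (Reg ''t'') (Reg ''m'')))) \<le> m * ?K (length xs) +
            r * (40 * r + 60) + 20"
        proof -
          have "r * (40 * r + 60) = r * (40 * r + 40) + 20 * r" by (simp add: algebra_simps)
          then show ?thesis using T T1 T2 D r_def by simp
        qed
        moreover have "r = 0 \<or> (r - 1) * (r - 1) < m" using rb r_def by simp
        ultimately show ?case unfolding greedy_post_def by blast
      qed
    qed
  qed
qed

end

section \<open>Size and running time\<close>

text \<open>
  All three settings are treated as MCFT. In ECFT every vertex and in VCFT every edge gets the dummy color 0, while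
  the actual colors are shifted by 1. The dummy color occurs on every edge, hence it is never deleted.
\<close>

definition setup_shifts :: com where
  "setup_shifts = seq [
     Assign ''a'' (Num 1),
     Assign ''b'' (Num 1),
     If (Less (Reg ''setting'') (Num 1)) (Assign ''b'' (Num 0))
       (If (Less (Reg ''setting'') (Num 2)) (Assign ''a'' (Num 0)) Skip)]"

fun edge_shift :: "('v, 'c) coloring \<Rightarrow> nat" where
  "edge_shift (VCFT cv) = 0"
| "edge_shift _ = 1"

fun vertex_shift :: "('v, 'c) coloring \<Rightarrow> nat" where
  "vertex_shift (ECFT ce) = 0"
| "vertex_shift _ = 1"

lemma setup_shifts_wp:
  fixes \<sigma> :: state and X :: "('v, 'c) coloring"
  assumes "reg \<sigma> ''setting'' = setting_code X"
  shows "wp setup_shifts (\<lambda>T \<sigma>'. frame {''a'', ''b''} {} \<sigma> \<sigma>' \<and> reg \<sigma>' ''a'' = edge_shift X \<and>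
    reg \<sigma>' ''b'' = vertex_shift X \<and> T \<le> 20) \<sigma>"
  using assms by (cases X) (simp_all add: setup_shifts_def wp_simps frame_def)

context greedy_input
begin

lemma greedy_post_antimono: "greedy_post T \<sigma> \<Longrightarrow> T' \<le> T \<Longrightarrow> greedy_post T' \<sigma>"
  unfolding greedy_post_def by (elim exE conjE, intro exI conjI, assumption+, rule order_trans)

text \<open>The rank of an edge is its position in the output, so the edges of lower rank form the
  prefix it was tested against; \<open>F\<close> consists of the color sets from
  \<open>accepted\<close>. The inverse of \<open>ed\<close> makes the colors a function of the edge
  rather than of its index.\<close>

lemma ed_blocked_graph:
  assumes xs: "set xs \<subseteq> {..<m}" "distinct xs" and inj: "inj_on ed {..<m}"
    and V: "finite X" "\<And>i. i < m \<Longrightarrow> ed i \<subseteq> X" and gl: "greedy_list xs" and f1: "f \<ge> 1"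
  obtains r F where "blocked_graph X (ed ` set xs) r (\<lambda>e. col (the_inv_into {..<m} ed e)) F k (6 * k * f)"
proof -
  have injq: "inj_on (\<lambda>q. ed (xs ! q)) {..<length xs}"
  proof (rule inj_onI)
    fix p q assume pq: "p \<in> {..<length xs}" "q \<in> {..<length xs}" and "ed (xs ! p) = ed (xs ! q)"
    moreover have "xs ! p \<in> {..<m}" "xs ! q \<in> {..<m}" using pq nth_mem xs(1) by auto
    ultimately have "xs ! p = xs ! q" using inj by (auto dest: inj_onD)
    then show "p = q" using pq xs(2) by (simp add: nth_eq_iff_index_eq)
  qed
  have E: "ed ` set xs = (\<lambda>q. ed (xs ! q)) ` {..<length xs}"
    by (auto simp: set_conv_nth image_iff)
  define r where "r = the_inv_into {..<length xs} (\<lambda>q. ed (xs ! q))"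
  have r: "r (ed (xs ! q)) = q" if "q < length xs" for q
    unfolding r_def by (rule the_inv_into_f_f[OF injq]) (use that in simp)
  have "\<forall>q. \<exists>F. q < length xs \<longrightarrow> finite F \<and> card F \<le> 6 * k * f \<and> F \<inter> col (xs ! q) = {} \<and>
      \<not> reach (alive (set (take q xs)) F) (2 * k - 1) (U (xs ! q)) (V (xs ! q))"
    using gl unfolding greedy_list_def accepted_def by blast
  then obtain F' where F': "\<And>q. q < length xs \<Longrightarrow> finite (F' q) \<and> card (F' q) \<le> 6 * k * f \<and> F' q \<inter> col (xs ! q) = {} \<and>
      \<not> reach (alive (set (take q xs)) (F' q)) (2 * k - 1) (U (xs ! q)) (V (xs ! q))" by metis
  have c: "col (the_inv_into {..<m} ed (ed (xs ! q))) = col (xs ! q)" if "q < length xs" for q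
  proof -
    have "xs ! q \<in> {..<m}" using nth_mem[OF that] xs(1) by blast
    then show ?thesis using the_inv_into_f_f[OF inj] by simp
  qed
  have "blocked_graph X (ed ` set xs) r (\<lambda>e. col (the_inv_into {..<m} ed e)) (\<lambda>e. F' (r e)) k (6 * k * f)"
  proof
    show "inj_on r (ed ` set xs)" unfolding E by (auto simp: inj_on_def r)
    show "1 \<le> 6 * k * f" using k1 f1 by (simp add: Suc_leI)
    show "1 \<le> k" by (rule k1)
  next
    fix e assume "e \<in> ed ` set xs"
    then obtain q where q: "q < length xs" "e = ed (xs ! q)" unfolding E by auto
    then have "xs ! q < m" using subsetD[OF xs(1) nth_mem[OF q(1)]] by simp
    then show "\<exists>u\<in>X. \<exists>v\<in>X. e = {u, v}" using V(2)[of "xs ! q"] q(2) by (auto simp: ed_def)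
    show "finite (F' (r e))" "card (F' (r e)) \<le> 6 * k * f" using F'[OF q(1)] r[OF q(1)] q(2) by simp_all
    show "F' (r e) \<inter> col (the_inv_into {..<m} ed e) = {}" using F'[OF q(1)] r[OF q(1)] c[OF q(1)] q(2) by simp
    show "finite (col (the_inv_into {..<m} ed e))" by (simp add: col_def)
  next
    fix u v assume "{u, v} \<in> ed ` set xs"
    then obtain q where q: "q < length xs" "{u, v} = ed (xs ! q)" unfolding E by auto
    have rq: "r {u, v} = q" using r q by simp
    have sub: "{e \<in> ed ` set xs. r e < r {u, v} \<and> col (the_inv_into {..<m} ed e) \<inter> F' (r {u, v}) = {}} \<subseteq>
      alive (set (take q xs)) (F' q)"
    proof
      fix e assume e: "e \<in> {e \<in> ed ` set xs. r e < r {u, v} \<and> col (the_inv_into {..<m} ed e) \<inter> F' (r {u, v}) = {}}"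
      then obtain p where p: "p < length xs" "e = ed (xs ! p)" unfolding E by auto
      have "p < q" using e p r rq by auto
      then have "xs ! p \<in> set (take q xs)" using q(1) by (metis in_set_conv_nth length_take min.absorb4 nth_take)
      moreover have "col (xs ! p) \<inter> F' q = {}" using e c[OF p(1)] p(2) rq by simp
      ultimately show "e \<in> alive (set (take q xs)) (F' q)" unfolding alive_def p(2) by blast
    qed
    have no: "\<not> reach (alive (set (take q xs)) (F' q)) (2 * k - 1) (U (xs ! q)) (V (xs ! q))" using F'[OF q(1)] by
        simp
    have uv: "u = U (xs ! q) \<and> v = V (xs ! q) \<or> u = V (xs ! q) \<and> v = U (xs ! q)"
      using q(2) by (auto simp: ed_def doubleton_eq_iff)
    show "\<not> reach {e \<in> ed ` set xs. r e < r {u, v} \<and> col (the_inv_into {..<m} ed e) \<inter> F' (r {u,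
        v}) = {}} (2 * k - 1) u v"
    proof
      assume "reach {e \<in> ed ` set xs. r e < r {u, v} \<and> col (the_inv_into {..<m} ed e) \<inter> F' (r {u,
          v}) = {}} (2 * k - 1) u v"
      then have "reach (alive (set (take q xs)) (F' q)) (2 * k - 1) u v" by (rule reach_mono[OF _ sub order_refl])
      then show False using no uv reach_sym[of _ _ u v] by auto
    qed
  qed (use V in simp_all)
  then show ?thesis by (rule that)
qed

end

section \<open>Sizes in the three settings\<close>

lemma (in blocked_graph) card_by_class:
  "card E = card {e \<in> E. \<exists>c. vc ` e = {c}} + card {e \<in> E. \<nexists>c. vc ` e = {c}}"
  using finite_E by (subst card_Un_disjoint[symmetric]) (auto intro: arg_cong[where f = card])

text \<open>All vertices have the dummy color 0, so every edge lies in one class and only the color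
  of the edge itself is paid for: q = 1, and 20 times 2K = 12kf gives 240.\<close>

lemma ecft_size:
  fixes vc :: "'v \<Rightarrow> nat" and col :: "'v set \<Rightarrow> nat set"
  assumes B: "blocked_graph V E r col F k (6 * k * f)"
    and col: "\<And>e. e \<in> E \<Longrightarrow> col e = insert (ec e) (vc ` e)" and vc: "\<And>v. vc v = 0"
  shows "real (card E) \<le> 240 * (real k * f * real (card V) powr (1 + 1 / k))"
proof -
  interpret blocked_graph V E r col F k "6 * k * f" by (rule B)
  have ne: "e \<noteq> {}" if "e \<in> E" for e using edge[OF that] by auto
  have E: "{e \<in> E. \<exists>c. vc ` e = {c}} = E" using ne vc by (auto simp: image_constant_conv)
  have "real (card {e \<in> E. \<exists>c. vc ` e = {c}}) \<le> 20 * (2 * (6 * k * f)) ^ 1 * real (card V) powr (1 + 1 / k)"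
  proof (rule mono_card[where D = "{0}"])
    fix e assume e: "e \<in> E"
    show "vc ` e \<subseteq> col e" using col[OF e] by auto
    have "0 \<in> col e" using col[OF e] ne[OF e] vc by auto
    then show "{0} \<inter> F e = {}" using F_col[OF e] by auto
    fix c
    have "col e - {0} - {c} \<subseteq> {ec e}" using col[OF e] vc by auto
    then show "card (col e - {0} - {c}) \<le> 1" using card_mono[of "{ec e}"] by fastforce
  qed
  then show ?thesis unfolding E by simp
qed

text \<open>The factor \<open>c\<close> will be 12k; rounding its exponent up gives the k and k^2 of
  the bounds, while f keeps the fractional exponent.\<close>

lemma powr_scale_le:
  fixes x c y :: real
  assumes "c \<ge> 1" "y \<ge> 0" "x \<le> real n" "x \<ge> 0"
  shows "(c * y) powr x \<le> c ^ n * y powr x"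
proof -
  have "c powr x \<le> c powr real n" using assms by (intro powr_mono) auto
  then have "c powr x \<le> c ^ n" using assms by (simp add: powr_realpow)
  then show ?thesis using assms by (simp add: powr_mult mult_right_mono)
qed

text \<open>Edges inside a class need no sampled color (q = 0) and cost no factor depending on K;
  those between classes need two vertex colors (q = 2), which produces the exponent 1 - 1/k. The
  constant is 20 + 20 times 12.\<close>

lemma vcft_size:
  fixes vc :: "'v \<Rightarrow> nat" and col :: "'v set \<Rightarrow> nat set"
  assumes B: "blocked_graph V E r col F k (6 * k * f)"
    and col: "\<And>e. e \<in> E \<Longrightarrow> col e = insert 0 (vc ` e)" and vc: "\<And>v. v \<in> V \<Longrightarrow> vc v \<noteq> 0"
  shows "real (card E) \<le> 260 * (real k * real f powr (1 - 1 / k) * real (card V) powr (1 + 1 / k))"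
proof -
  interpret blocked_graph V E r col F k "6 * k * f" by (rule B)
  let ?n = "real (card V) powr (1 + 1 / k)"
  have kf: "real k \<ge> 1" "real f \<ge> 1" using K k by (auto simp: Suc_le_eq)
  have D: "{0} \<inter> F e = {}" "vc ` e \<subseteq> col e" if "e \<in> E" for e using F_col[OF that] col[OF that] by auto
  have ce: "card (vc ` e) \<le> 2" if "e \<in> E" for e
  proof -
    obtain u v where "e = {u, v}" using edge[OF \<open>e \<in> E\<close>] by blast
    then show ?thesis by (simp add: card_insert_if)
  qed
  have mono: "real (card {e \<in> E. \<exists>c. vc ` e = {c}}) \<le> 20 * (2 * (6 * k * f)) ^ 0 * ?n"
  proof (rule mono_card[where D = "{0}", OF D(2,1)])
    fix e c assume "e \<in> E" "vc ` e = {c}"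
    then have "col e - {0} - {c} = {}" using col by auto
    then show "card (col e - {0} - {c}) \<le> 0" by (simp only: card.empty)
  qed
  have bi: "real (card {e \<in> E. \<nexists>c. vc ` e = {c}}) \<le> 20 * (2 * real (6 * k * f)) powr (real 2 - 1 - 1 / k) * ?n"
  proof (rule bichromatic_card[where D = "{0}", OF D(2,1)])
    fix e assume e: "e \<in> E"
    have "col e - {0} \<subseteq> vc ` e" using col[OF e] by auto
    moreover have "finite (vc ` e)" using finite_col[OF e] D(2)[OF e] finite_subset by auto
    ultimately show "card (col e - {0}) \<le> 2" using ce[OF e] card_mono le_trans by metis
  qed (use vc in auto)
  have "(12 * real k * f) powr (1 - 1 / k) \<le> (12 * real k) ^ 1 * real f powr (1 - 1 / k)"
    by (rule powr_scale_le) (use kf in auto)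
  moreover have "1 * 1 \<le> real k * real f powr (1 - 1 / k)"
    using kf by (intro mult_mono ge_one_powr_ge_zero) auto
  ultimately have "20 + 20 * (12 * real k * f) powr (1 - 1 / k) \<le> 260 * (real k * real f powr (1 - 1 / k))" by simp
  then have "(20 + 20 * (12 * real k * f) powr (1 - 1 / k)) * ?n \<le> 260 * (real k * real f powr (1 - 1 / k)) * ?n"
    by (rule mult_right_mono) simp
  moreover have "real (card E) \<le> (20 + 20 * (12 * real k * f) powr (1 - 1 / k)) * ?n"
    using mono bi card_by_class[of vc] by (simp add: algebra_simps)
  ultimately show ?thesis by (simp add: mult.assoc)
qed

text \<open>Here q = 1 inside a class, for the color of the edge, and q = 3 between classes; 3120 is
  240 + 20 times 144, the last factor being the square of 12.\<close>

lemma mcft_size: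
  fixes vc :: "'v \<Rightarrow> nat" and col :: "'v set \<Rightarrow> nat set"
  assumes B: "blocked_graph V E r col F k (6 * k * f)"
    and col: "\<And>e. e \<in> E \<Longrightarrow> col e = insert (ec e) (vc ` e)"
  shows "real (card E) \<le> 3120 * ((real k)\<^sup>2 * real f powr (2 - 1 / k) * real (card V) powr (1 + 1 / k))"
proof -
  interpret blocked_graph V E r col F k "6 * k * f" by (rule B)
  let ?n = "real (card V) powr (1 + 1 / k)"
  have kf: "real k \<ge> 1" "real f \<ge> 1" using K k by (auto simp: Suc_le_eq)
  have D: "{} \<inter> F e = {}" "vc ` e \<subseteq> col e" if "e \<in> E" for e using col[OF that] by auto
  have mono: "real (card {e \<in> E. \<exists>c. vc ` e = {c}}) \<le> 20 * (2 * (6 * k * f)) ^ 1 * ?n"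
  proof (rule mono_card[where D = "{}", OF D(2,1)])
    fix e c assume "e \<in> E" "vc ` e = {c}"
    then have "col e - {} - {c} \<subseteq> {ec e}" using col by auto
    then show "card (col e - {} - {c}) \<le> 1" using card_mono[of "{ec e}"] by fastforce
  qed
  have bi: "real (card {e \<in> E. \<nexists>c. vc ` e = {c}}) \<le> 20 * (2 * real (6 * k * f)) powr (real 3 - 1 - 1 / k) * ?n"
  proof (rule bichromatic_card[where D = "{}", OF D(2,1)])
    fix e assume e: "e \<in> E"
    obtain u v where "e = {u, v}" using edge[OF e] by blast
    then show "card (col e - {}) \<le> 3" using col[OF e] by (simp add: card_insert_if)
  qed auto
  have "(12 * real k * f) powr (2 - 1 / k) \<le> (12 * real k) ^ 2 * real f powr (2 - 1 / k)"
    by (rule powr_scale_le) (use kf in \<open>auto simp: field_simps\<close>)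
  moreover have "real k * real f \<le> (real k)\<^sup>2 * real f powr (2 - 1 / k)"
  proof (rule mult_mono)
    show "real k \<le> (real k)\<^sup>2" using kf self_le_power[of "real k" 2] by simp
    have "real f powr 1 \<le> real f powr (2 - 1 / k)" using kf by (intro powr_mono) (auto simp: field_simps)
    then show "real f \<le> real f powr (2 - 1 / k)" using kf by simp
  qed (use kf in auto)
  ultimately have "240 * (real k * f) + 20 * (12 * real k * f) powr (2 - 1 / k) \<le> 3120 * ((real k)\<^sup>2 * real f powr
      (2 - 1 / k))"
    by (simp add: power_mult_distrib)
  then have "(240 * (real k * f) + 20 * (12 * real k * f) powr (2 - 1 / k)) * ?n \<le> 3120 * ((real k)\<^sup>2 * real f
      powr (2 - 1 / k)) * ?n"
    by (rule mult_right_mono) simp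
  moreover have "real (card E) \<le> (240 * (real k * f) + 20 * (12 * real k * f) powr (2 - 1 / k)) * ?n"
    using mono bi card_by_class[of vc] by (simp add: algebra_simps)
  ultimately show ?thesis by (simp add: mult.assoc)
qed

text \<open>From \<open>m \<le> 4 * s * s\<close> and the bound on r - 1 follow r \<le> 2s and
  \<open>r * r \<le> 4 * m\<close>, so that selection and the set-up of the blocks are dominated by
  m times s. The polynomial bound estimates \<open>min f s\<close> by \<open>N\<close>, since f
  itself can be exponential in the input length; the added 1 covers graphs without edges.\<close>

lemma time_arith:
  fixes m s r f N :: nat
  assumes T: "T \<le> 20 + (m * ((min f s + 1) * (400 * s + 210) + 80 * r + 160) + r * (40 * r + 60) + 20)"
    and r: "r = 0 \<or> (r - 1) * (r - 1) < m" and ms: "m \<le> 4 * s * s" and f: "f \<ge> 1" and sm: "s \<le> m"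
  shows "T \<le> 2000 * (m * f * s + 1)" "m \<le> N \<Longrightarrow> 1 \<le> N \<Longrightarrow> T \<le> 2000 * N ^ 3"
proof -
  have "T \<le> 40 + 1960 * (m * min f s * s)"
  proof (cases "m = 0")
    case True
    then show ?thesis using T r by simp
  next
    case False
    then have s1: "s \<ge> 1" using ms by (cases s) auto
    have r2s: "r \<le> 2 * s"
    proof (rule ccontr)
      assume "\<not> r \<le> 2 * s"
      then have "2 * s \<le> r - 1" "r \<noteq> 0" by auto
      then have "(2 * s) * (2 * s) \<le> (r - 1) * (r - 1)" by (intro mult_mono) auto
      then show False using r ms \<open>r \<noteq> 0\<close> by simp
    qed
    have r4m: "r * r \<le> 4 * m"
    proof (cases "r \<le> 1")
      case True
      then have "r * r \<le> 1 * 1" by (intro mult_mono) auto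
      then show ?thesis using False by simp
    next
      case False
      then have "r * r \<le> (2 * (r - 1)) * (2 * (r - 1))" by (intro mult_mono) auto
      then show ?thesis using r False by simp
    qed
    let ?M = "min f s"
    have M1: "?M \<ge> 1" using f s1 by simp
    have Ms: "s \<le> ?M * s" "1 \<le> ?M * s" using M1 s1 by (auto simp: Suc_le_eq)
    have "(?M + 1) * (400 * s + 210) \<le> (2 * ?M) * (610 * s)" using M1 s1 by (intro mult_mono) auto
    also have "\<dots> = 1220 * (?M * s)" by simp
    finally have "(?M + 1) * (400 * s + 210) + 80 * r + 160 \<le> 1540 * (?M * s)" using r2s Ms by linarith
    then have "m * ((?M + 1) * (400 * s + 210) + 80 * r + 160) \<le> m * (1540 * (?M * s))" by (rule mult_le_mono2)
    also have "\<dots> = 1540 * (m * ?M * s)" by simp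
    finally have "m * ((?M + 1) * (400 * s + 210) + 80 * r + 160) \<le> 1540 * (m * ?M * s)" .
    moreover have "r * (40 * r + 60) \<le> 400 * m"
    proof -
      have "r \<le> r * r" by (cases r) auto
      moreover have "r * (40 * r + 60) = 40 * (r * r) + 60 * r" by (simp add: algebra_simps)
      ultimately show ?thesis using r4m by linarith
    qed
    moreover have "m * 1 \<le> m * (?M * s)" using Ms(2) by (rule mult_le_mono2)
    then have "m \<le> m * ?M * s" by (simp only: mult.assoc mult_1_right)
    ultimately show ?thesis using T by linarith
  qed
  note * = this
  have "m * min f s * s \<le> m * f * s" by (intro mult_le_mono) auto
  then have "T \<le> 2000 * (m * f * s) + 2000" using * by linarith
  then show "T \<le> 2000 * (m * f * s + 1)" by simp
  assume N: "m \<le> N" "1 \<le> N"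
  have "m * min f s * s \<le> N * N * N" using N sm by (intro mult_le_mono) auto
  moreover have "1 \<le> N * N * N" using N by simp
  ultimately have "T \<le> 2000 * (N * N * N)" using * by linarith
  then show "T \<le> 2000 * N ^ 3" by (simp add: power3_eq_cube)
qed

text \<open>The edges in \<open>E\<close> touch at most \<open>2 * card E\<close> vertices, and an
  edge is determined by an ordered pair of its ends.\<close>

lemma card_le_endpoints:
  assumes "finite E" "\<And>e. e \<in> E \<Longrightarrow> \<exists>x y. e = {x, y}"
    and "finite E'" "\<And>e. e \<in> E' \<Longrightarrow> \<exists>x y. e = {x, y}" "\<Union> E' \<subseteq> \<Union> E"
  shows "card E' \<le> 4 * card E * card E"
proof -
  have fin: "finite (\<Union> E)" using assms(1) by (rule finite_Union) (use assms(2) in fastforce)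
  have "card (\<Union> E) \<le> (\<Sum>e\<in>E. card e)" using card_UN_le[OF assms(1), of "\<lambda>e. e"] by simp
  also have "\<dots> \<le> (\<Sum>e\<in>E. 2)"
  proof (rule sum_mono)
    fix e assume "e \<in> E"
    then obtain x y where "e = {x, y}" using assms(2) by blast
    then show "card e \<le> 2" by (simp add: card_insert_if)
  qed
  finally have two: "card (\<Union> E) \<le> 2 * card E" by simp
  have "E' \<subseteq> (\<lambda>(x, y). {x, y}) ` (\<Union> E \<times> \<Union> E)"
  proof
    fix e assume e: "e \<in> E'"
    then obtain x y where xy: "e = {x, y}" using assms(4) by blast
    then have "(x, y) \<in> \<Union> E \<times> \<Union> E" using e assms(5) by auto
    then show "e \<in> (\<lambda>(x, y). {x, y}) ` (\<Union> E \<times> \<Union> E)" using xy by (intro image_eqI[of _ _ "(x, y)"]) auto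
  qed
  then have "card E' \<le> card (\<Union> E \<times> \<Union> E)"
    using fin by (intro surj_card_le) auto
  also have "\<dots> \<le> (2 * card E) * (2 * card E)"
    unfolding card_cartesian_product using two by (intro mult_mono) auto
  finally show ?thesis by simp
qed

lemma input_size_ge: "k \<ge> 1 \<Longrightarrow> m \<le> input_size n m k f \<and> 1 \<le> input_size n m k f"
  by (simp add: input_size_def floorlog_def)

lemma greedy_correct:
  fixes G :: "(nat, nat) cgraph"
  assumes wf: "wf_cgraph G" and pr: "presents n es G" and m: "m = card (edges G)" and k: "k \<ge> 1" and f: "f \<ge> 1"
  shows "\<exists>T \<sigma> H s. runs (Seq setup_shifts greedy) (input_state n es G k f) T \<sigma> \<and> outputs \<sigma> es G H \<and>
    cft_spanner f (2 * real k - 1) H G \<and> s = card (edges H) \<and>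
    real s \<le> 3120 * size_bound (coloring G) (real k) (real f) (real n) \<and>
    T \<le> 2000 * (m * f * s + 1) \<and> T \<le> 2000 * input_size n m k f ^ 3"
proof -
  let ?X = "coloring G" and ?\<sigma> = "input_state n es G k f"
  have dist: "distinct (map edge_of es)" and edges: "edges G = set (map edge_of es)" and verts: "verts G = {..<n}"
    using pr by (simp_all add: presents_def)
  have len: "length es = m" unfolding m edges using distinct_card[OF dist] by simp
  define U where "U i = (if i < length es then fst (es ! i) else 0)" for i
  define V where "V i = (if i < length es then snd (es ! i) else 0)" for i
  define ecol where "ecol i = (if i < length es then ecol_input ?X (edge_of (es ! i)) else 0)" for i
  define vcol where "vcol v = (if v < n then vcol_input ?X v else 0)" for v
  define W where "W i = (if i < length es then weight G (edge_of (es ! i)) else 0)" for i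
  interpret greedy_input U V ecol vcol W m k f "edge_shift ?X" "vertex_shift ?X" by unfold_locales (rule k)
  have ed: "ed i = edge_of (es ! i)" if "i < m" for i using that by (simp add: ed_def U_def V_def len edge_of_def)
  have edG: "ed i \<in> edges G" if "i < m" for i using that ed edges len by auto
  have edges_ed: "edges G = ed ` {..<m}"
  proof -
    have "edges G = (\<lambda>i. edge_of (es ! i)) ` {..<m}"
      using nth_image[of "length es" es] by (simp add: edges len atLeast0LessThan flip: image_image)
    also have "\<dots> = ed ` {..<m}" using ed by (intro image_cong) auto
    finally show ?thesis .
  qed
  have loop: "U i \<noteq> V i" and in_n: "U i < n" "V i < n" if "i < m" for i
  proof -
    have "\<exists>u \<in> verts G. \<exists>v \<in> verts G. u \<noteq> v \<and> ed i = {u, v}"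
      using wf edG[OF that] by (simp add: wf_cgraph_def)
    then obtain u v where uv: "u \<in> verts G" "v \<in> verts G" "u \<noteq> v" "ed i = {u, v}" by blast
    then show "U i \<noteq> V i" by (auto simp: ed_def doubleton_eq_iff)
    have "{U i, V i} = {u, v}" using uv(4) by (simp add: ed_def)
    then show "U i < n" "V i < n" using uv verts by (auto simp: doubleton_eq_iff)
  qed
  have inj: "inj_on ed {..<m}"
  proof (rule inj_onI)
    fix i j assume "i \<in> {..<m}" "j \<in> {..<m}" "ed i = ed j"
    then show "i = j" using nth_eq_iff_index_eq[OF dist, of i j] len ed by simp
  qed
  \<comment> \<open>Setting the shifts takes at most 20 steps; they are taken off here and added
    again in the bound for \<open>T\<close> below.\<close>
  have "wp (Seq setup_shifts greedy) (\<lambda>T. greedy_post (T - 20)) ?\<sigma>"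
    unfolding wp_Seq
  proof (rule wp_mono[OF setup_shifts_wp[where X = ?X]], goal_cases)
    case 1
    show ?case by (simp add: input_state_def)
  next
    case (2 T \<sigma>)
    then have fr: "frame {''a'', ''b''} {} ?\<sigma> \<sigma>" and T: "T \<le> 20" by simp_all
    have "env \<sigma>" using 2 unfolding env_def frame_def
      by (simp add: input_state_def U_def[abs_def] V_def[abs_def] ecol_def[abs_def] vcol_def[abs_def]
          W_def[abs_def] len)
    then have "wp greedy greedy_post \<sigma>"
    proof (rule greedy_wp)
      show "reg \<sigma> x = 0" if "x \<in> {''r'', ''z'', ''y'', ''t'', ''c'', ''s'', ''g'', ''d''}" for x
        using that frame_reg[OF fr, of x] by (auto simp: input_state_def)
      show "arr \<sigma> x i = 0" if "x \<in> {''head'', ''vis'', ''mark'', ''prot'', ''done''}" for x i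
        using that frame_arr[OF fr, of x] by (auto simp: input_state_def)
    qed (rule loop)
    then show ?case
    proof (rule wp_mono)
      fix T' \<sigma>' assume "greedy_post T' \<sigma>'"
      moreover have "T + T' - 20 \<le> T'" using T by simp
      ultimately show "greedy_post (T + T' - 20) \<sigma>'" by (rule greedy_post_antimono)
    qed
  qed
  then obtain T \<sigma> xs r where run: "runs (Seq setup_shifts greedy) ?\<sigma> T \<sigma>" and out: "output_list \<sigma> = xs"
    and xs: "distinct xs" "set xs \<subseteq> {..<m}" and gl: "greedy_list xs" and cov: "\<And>i. i < m \<Longrightarrow> i \<notin> set xs \<Longrightarrow> covered xs i"
    and r: "r = 0 \<or> (r - 1) * (r - 1) < m"
    and "T - 20 \<le> m * ((min f (length xs) + 1) * (400 * length xs + 210) + 80 * r + 160) + r * (40 * r + 60) + 20"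
    unfolding wp_def greedy_post_def by blast
  then have T: "T \<le> 20 + (m * ((min f (length xs) + 1) * (400 * length xs + 210) + 80 * r + 160) + r * (40 * r +
      60) + 20)"
    by linarith
  define EH where "EH = ed ` set xs"
  define H where "H = G\<lparr>edges := EH\<rparr>"
  have sub: "EH \<subseteq> edges G" using xs(2) by (auto simp: EH_def edges_ed)
  have s: "card (edges H) = length xs"
    unfolding H_def EH_def using card_image[OF inj_on_subset[OF inj xs(2)]] distinct_card[OF xs(1)] by simp
  have "outputs \<sigma> es G H"
  proof -
    have "(\<lambda>i. edge_of (es ! i)) ` set xs = EH"
      unfolding EH_def using xs(2) ed by (intro image_cong) auto
    then show ?thesis using xs len by (simp add: outputs_def out H_def lessThan_def)
  qed
  \<comment> \<open>The faults are shifted like the actual colors, and their image under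
    \<open>Suc\<close> never contains the dummy color 0.\<close>
  have colors: "edge_colors ?X (ed i) \<inter> Fs = {} \<longleftrightarrow> col i \<inter> Suc ` Fs = {}" if "i < m" for i Fs
  proof -
    have e: "edge_of (es ! i) = {U i, V i}" using ed[OF that] by (simp add: ed_def)
    have "col i = {ecol_input ?X {U i, V i} + edge_shift ?X, vcol_input ?X (U i) + vertex_shift ?X,
        vcol_input ?X (V i) + vertex_shift ?X}"
      using in_n[OF that] that e by (simp add: col_def ecol_def vcol_def len)
    then show ?thesis unfolding ed_def by (cases ?X) auto
  qed
  have key: "reach {e \<in> EH. edge_colors ?X e \<inter> Fs = {} \<and> weight G e \<le> weight G {u, v}} (2 * k - 1) u v"
    if uv: "{u, v} \<in> edges G" and Fs: "finite Fs" "card Fs \<le> f" "edge_colors ?X {u, v} \<inter> Fs = {}" for u v Fs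
  proof -
    let ?A = "{e \<in> EH. edge_colors ?X e \<inter> Fs = {} \<and> weight G e \<le> weight G {u, v}}"
    obtain i where i: "i < m" "ed i = {u, v}" using uv edges_ed by auto
    have "reach ?A (2 * k - 1) (U i) (V i)"
    proof (cases "i \<in> set xs")
      case True
      then have "{U i, V i} \<in> ?A" using i Fs(3) by (auto simp: EH_def ed_def)
      then have "reach ?A (Suc (2 * k - 2)) (U i) (V i)" by (rule reach_edge)
      then show ?thesis using k by (simp add: numeral_eq_Suc Suc_diff_Suc)
    next
      case False
      then obtain I where I: "I \<subseteq> set xs" "\<And>j. j \<in> I \<Longrightarrow> W j \<le> W i" "rejected I i"
        using cov[OF i(1)] unfolding covered_def by blast
      have "Suc ` Fs \<inter> col i = {}" using colors[OF i(1)] i(2) Fs(3) by auto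
      moreover have "card (Suc ` Fs) \<le> f" using Fs(2) by (simp add: card_image)
      ultimately have re: "reach (alive I (Suc ` Fs)) (2 * k - 1) (U i) (V i)"
        using I(3) Fs(1) unfolding rejected_def by simp
      have "alive I (Suc ` Fs) \<subseteq> ?A"
      proof
        fix e assume "e \<in> alive I (Suc ` Fs)"
        then obtain j where j: "j \<in> I" "col j \<inter> Suc ` Fs = {}" "e = ed j" by (auto simp: alive_def)
        have jm: "j < m" using j(1) I(1) xs(2) by auto
        have "weight G (ed j) \<le> weight G (ed i)" using I(2)[OF j(1)] jm i(1) by (simp add: W_def len ed)
        then show "e \<in> ?A" using j I(1) colors[OF jm] i(2) by (auto simp: EH_def)
      qed
      then show ?thesis by (rule reach_mono[OF re _ order_refl])
    qed
    moreover have "u = U i \<and> v = V i \<or> u = V i \<and> v = U i" using i(2) by (auto simp: ed_def doubleton_eq_iff)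
    ultimately show ?thesis using reach_sym[of ?A _ "U i" "V i"] by (elim disjE conjE) simp_all
  qed
  have spanner: "cft_spanner f (2 * real k - 1) H G"
    by (rule cft_spannerI[OF wf H_def sub k key])
  have size: "real (length xs) \<le> 3120 * size_bound ?X (real k) (real f) (real n)"
  proof -
    have V: "finite {..<n}" "\<And>i. i < m \<Longrightarrow> ed i \<subseteq> {..<n}" using in_n by (auto simp: ed_def)
    let ?col = "\<lambda>e. col (the_inv_into {..<m} ed e)"
    obtain r' F where B: "blocked_graph {..<n} EH r' ?col F k (6 * k * f)"
      unfolding EH_def by (rule ed_blocked_graph[OF xs(2,1) inj V gl f])
    define vc where "vc v = vcol v + vertex_shift ?X" for v
    define ec where "ec e = ecol (the_inv_into {..<m} ed e) + edge_shift ?X" for e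
    have inv: "the_inv_into {..<m} ed e \<in> {..<m}" "ed (the_inv_into {..<m} ed e) = e" if "e \<in> EH" for e
      using the_inv_into_into[OF inj, of e "{..<m}"] f_the_inv_into_f[OF inj, of e] that xs(2) by (auto simp: EH_def)
    have col: "?col e = insert (ec e) (vc ` e)" if "e \<in> EH" for e
    proof -
      have "vc ` e = vc ` ed (the_inv_into {..<m} ed e)" using inv(2)[OF that] by simp
      then show ?thesis by (simp add: col_def ec_def vc_def ed_def)
    qed
    have cE: "card EH = length xs" using s by (simp add: H_def)
    show ?thesis
    proof (cases ?X)
      case (ECFT ce)
      have "vc v = 0" for v by (simp add: vc_def vcol_def ECFT)
      then show ?thesis using ecft_size[OF B col] cE by (simp add: ECFT)
    next
      case (VCFT cv)
      have "?col e = insert 0 (vc ` e)" if "e \<in> EH" for e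
        using col[OF that] inv(1)[OF that] by (simp add: ec_def ecol_def VCFT)
      moreover have "vc v \<noteq> 0" for v by (simp add: vc_def VCFT)
      ultimately show ?thesis using vcft_size[OF B, of vc] cE by (simp add: VCFT)
    next
      case (MCFT ce cv)
      then show ?thesis using mcft_size[OF B col] cE by simp
    qed
  qed
  have ms: "m \<le> 4 * length xs * length xs"
  proof -
    have two: "\<exists>x y. e = {x, y}" if "e \<in> edges G" for e using wf that unfolding wf_cgraph_def by blast
    have fin: "finite (edges G)" "finite EH" by (simp_all add: edges_ed EH_def)
    \<comment> \<open>Even without faults every edge has a detour in the output, whose first step is
      an output edge at the chosen end.\<close>
    have cover: "\<Union> (edges G) \<subseteq> \<Union> EH"
    proof
      fix x assume "x \<in> \<Union> (edges G)"
      then obtain e where e: "e \<in> edges G" "x \<in> e" by blast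
      have "\<exists>u \<in> verts G. \<exists>v \<in> verts G. u \<noteq> v \<and> e = {u, v}" using wf e(1) by (simp add: wf_cgraph_def)
      then obtain u v where uv: "u \<noteq> v" "e = {u, v}" by blast
      define y where "y = (if x = u then v else u)"
      have y: "{x, y} \<in> edges G" "x \<noteq> y" using e uv by (auto simp: y_def insert_commute)
      obtain l where l: "2 * k - 1 = Suc l" using k by (cases "2 * k - 1") auto
      have "reach {e \<in> EH. edge_colors ?X e \<inter> {} = {} \<and> weight G e \<le> weight G {x, y}} (2 * k - 1) x y"
        by (rule key[OF y(1)]) simp_all
      then show "x \<in> \<Union> EH" using y(2) unfolding l by auto
    qed
    have "card (edges G) \<le> 4 * card EH * card EH"
      by (rule card_le_endpoints[OF fin(2) two[OF subsetD[OF sub]] fin(1) two cover])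
    then show ?thesis using m s by (simp add: H_def)
  qed
  have sm: "length xs \<le> m" using card_mono[OF _ xs(2)] distinct_card[OF xs(1)] by simp
  have "T \<le> 2000 * (m * f * length xs + 1)" "T \<le> 2000 * input_size n m k f ^ 3"
    using time_arith(1)[OF T r ms f sm] time_arith(2)[OF T r ms f sm] input_size_ge[OF k, of m n f] by simp_all
  then show ?thesis
    by (intro exI[of _ T] exI[of _ \<sigma>] exI[of _ H] exI[of _ "length xs"] conjI run spanner size)
      (simp_all add: s \<open>outputs \<sigma> es G H\<close>)
qed

theorem theorem5p1:
  "\<exists>(P :: com) (C :: real) (c :: nat) (d :: nat).
     \<forall>(n :: nat) (m :: nat) (k :: nat) (f :: nat) (G :: (nat, nat) cgraph) (es :: (nat \<times> nat) list).
       wf_cgraph G \<and> presents n es G \<and> m = card (edges G) \<and> k \<ge> 1 \<and> f \<ge> 1 \<longrightarrow>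
       (\<exists>T \<sigma> H s.
          runs P (input_state n es G k f) T \<sigma> \<and> outputs \<sigma> es G H \<and>
          cft_spanner f (2 * real k - 1) H G \<and>
          s = card (edges H) \<and>
          real s \<le> C * size_bound (coloring G) (real k) (real f) (real n) \<and>
          real T \<le> C * (real m * real f * real s + 1) \<and>
          T \<le> c * input_size n m k f ^ d)"
\<comment> \<open>One constant serves both size and time: 3120 comes from the MCFT bound and exceeds
  the 2000 of the running time.\<close>
proof (rule exI[of _ "Seq setup_shifts greedy"], rule exI[of _ 3120], rule exI[of _ 2000], rule exI[of _ 3],
    intro allI impI, elim conjE)
  fix n m k f :: nat and G :: "(nat, nat) cgraph" and es
  assume "wf_cgraph G" "presents n es G" "m = card (edges G)" "k \<ge> 1" "f \<ge> 1"
  from greedy_correct[OF this] obtain T \<sigma> H s where *: "runs (Seq setup_shifts greedy) (input_state n es G k f) T \<sigma>"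
    "outputs \<sigma> es G H" "cft_spanner f (2 * real k - 1) H G" "s = card (edges H)"
    "real s \<le> 3120 * size_bound (coloring G) (real k) (real f) (real n)"
    "T \<le> 2000 * (m * f * s + 1)" "T \<le> 2000 * input_size n m k f ^ 3" by (elim exE conjE)
  have "real T \<le> real (2000 * (m * f * s + 1))" using *(6) by (simp only: of_nat_le_iff)
  also have "\<dots> \<le> 3120 * (real m * real f * real s + 1)" by simp
  finally show "\<exists>T \<sigma> H s. runs (Seq setup_shifts greedy) (input_state n es G k f) T \<sigma> \<and> outputs \<sigma> es G H \<and>
      cft_spanner f (2 * real k - 1) H G \<and> s = card (edges H) \<and>
      real s \<le> 3120 * size_bound (coloring G) (real k) (real f) (real n) \<and>
      real T \<le> 3120 * (real m * real f * real s + 1) \<and> T \<le> 2000 * input_size n m k f ^ 3"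
    by (intro exI[of _ T] exI[of _ \<sigma>] exI[of _ H] exI[of _ s] conjI *(1-5,7))
qed

end
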